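(* Let $E$ be a $d$-spherical object ($d>0$) of a triangulated category $\mathcal{D}$ of finite type admitting a split-generator, and let $T^{\mathbb{S}}_E$ be the spherical twist along $E$. Then, for all $t\in\mathbb{R}$, $$(1-d)t \leq h_t(T^{\mathbb{S}}_E) \leq \begin{cases} 0 & (\text{if } t \geq 0),\\ (1-d)t & (\text{if } t \leq 0).\end{cases}$$ If moreover $E^\perp \neq 0$, then $h_t(T^{\mathbb{S}}_E) = 0$ for all $t \geq 0$.
   Context: Standing assumptions: all triangulated categories are linear over a field $\mathbb{K}$, admit a dg enhancement (i.e. are equivalent, as triangulated categories, to $H^0(\mathcal{A})$ for a pretriangulated dg category $\mathcal{A}$), and all exact functors between them admit dg lifts; cones of natural transformations are formed functorially via these. $\mathrm{Hom}^*_\mathcal{D}(E,F)=\bigoplus_{i\in\mathbb{Z}}\mathrm{Hom}_\mathcal{D}(E,F[i])[-i]$. Finite type: $\dim\mathrm{Hom}^*_\mathcal{D}(E,F)<\infty$ for all objects $E,F$. $E^\perp=\{F\in\mathrm{Ob}(\mathcal{D}) : \mathrm{Hom}^*_\mathcal{D}(E,F)=0\}$. $d$-spherical object ($d>0$) of $\mathcal{D}$ of finite type: an object $E$ such that (1) $\mathrm{Hom}^*_\mathcal{D}(E,E)\cong\mathbb{K}[h]/(h^2)$ with $\deg h=d$; (2) there is a functorial isomorphism $\mathrm{Hom}^*_\mathcal{D}(E,-)\cong\mathrm{Hom}^*_\mathcal{D}(-,E[d])^\vee$. The spherical twist $T^{\mathbb{S}}_E$ is the exact autoequivalence of $\mathcal{D}$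 given on objects by $T^{\mathbb{S}}_EF=\mathrm{Cone}(\mathrm{Hom}^*_\mathcal{D}(E,F)\otimes E\xrightarrow{\mathrm{ev}}F)$ (made functorial via the dg enhancement). Split-generator: an object $G$ of a triangulated category $\mathcal{D}$ such that the smallest full triangulated subcategory containing $G$ and closed under taking direct summands is $\mathcal{D}$. Categorical complexity: for objects $E,F$ of $\mathcal{D}$ and $t \in \mathbb{R}$, $\delta_t(E,F)=0$ if $F\cong 0$; otherwise $\delta_t(E,F) \in [0,\infty]$ is the infimum of $\sum_{i=1}^k e^{n_i t}$ over all sequences of integers $(n_1,\dots,n_k)$ for which there exist an object $F'$ and objects $0=A_0,A_1,\dots,A_k = F\oplus F'$ with exact triangles $A_{i-1}\to A_i \to E[n_i] \to A_{i-1}[1]$ for $i=1,\dots,k$. Categorical entropy of an exact endofunctor $\Phi$ of $\mathcal{D}$: $h_t(\Phi) = \lim_{n\to\infty}\frac1n\log\delta_t(G,\Phi^nG) \in [-\infty,\infty)$ for a split-generator $G$ (the limit exists and is independent of $G$). *)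

theory Defs
  imports Complex_Main "HOL-Library.Extended_Real" "HOL-Computational_Algebra.Polynomial"
begin

section \<open>Linear categories\<close>

text \<open>
  All Hom spaces of a category are subspaces of one ambient vector space \<open>'m\<close> (one may take the
  direct sum of all Hom spaces), so that \<open>0\<close>, \<open>+\<close> and the library notions of span and subspace are
  available. Distinct Hom spaces are not required to meet only in \<open>0\<close>; everything said about a
  morphism is relative to a source and a target. \<open>g \<cdot> f\<close> is ``first \<open>f\<close>, then \<open>g\<close>''.
\<close>

record ('o, 'm, 'k) lin_cat =
  Ob :: "'o set"
  Hom :: "'o \<Rightarrow> 'o \<Rightarrow> 'm set"
  Id :: "'o \<Rightarrow> 'm"
  Comp :: "'m \<Rightarrow> 'm \<Rightarrow> 'm"  (infixr "\<cdot>\<index>" 70)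
  Scale :: "'k \<Rightarrow> 'm \<Rightarrow> 'm"

definition klinear_on ::
  "('k \<Rightarrow> 'm::ab_group_add \<Rightarrow> 'm) \<Rightarrow> 'm set \<Rightarrow> ('k \<Rightarrow> 'n::ab_group_add \<Rightarrow> 'n) \<Rightarrow> ('m \<Rightarrow> 'n) \<Rightarrow> bool"
  where
  "klinear_on s V s' \<phi> \<longleftrightarrow>
     (\<forall>x\<in>V. \<forall>y\<in>V. \<phi> (x + y) = \<phi> x + \<phi> y) \<and> (\<forall>c. \<forall>x\<in>V. \<phi> (s c x) = s' c (\<phi> x))"

definition zero_object :: "('o, 'm::ab_group_add, 'k, 'z) lin_cat_scheme \<Rightarrow> 'o \<Rightarrow> bool" where
  "zero_object D Z \<longleftrightarrow> Z \<in> Ob D \<and> (\<forall>X\<in>Ob D. Hom D X Z = {0} \<and> Hom D Z X = {0})"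

definition is_iso :: "('o, 'm, 'k, 'z) lin_cat_scheme \<Rightarrow> 'o \<Rightarrow> 'o \<Rightarrow> 'm \<Rightarrow> bool" where
  "is_iso D X Y f \<longleftrightarrow>
     f \<in> Hom D X Y \<and> (\<exists>g\<in>Hom D Y X. g \<cdot>\<^bsub>D\<^esub> f = Id D X \<and> f \<cdot>\<^bsub>D\<^esub> g = Id D Y)"

definition biproduct :: "('o, 'm::ab_group_add, 'k, 'z) lin_cat_scheme \<Rightarrow> 'o \<Rightarrow> 'o \<Rightarrow> 'o \<Rightarrow> bool" where
  "biproduct D X Y P \<longleftrightarrow> P \<in> Ob D \<and>
     (\<exists>i\<in>Hom D X P. \<exists>j\<in>Hom D Y P. \<exists>p\<in>Hom D P X. \<exists>q\<in>Hom D P Y.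
        p \<cdot>\<^bsub>D\<^esub> i = Id D X \<and> q \<cdot>\<^bsub>D\<^esub> j = Id D Y \<and> p \<cdot>\<^bsub>D\<^esub> j = 0 \<and> q \<cdot>\<^bsub>D\<^esub> i = 0 \<and>
        i \<cdot>\<^bsub>D\<^esub> p + j \<cdot>\<^bsub>D\<^esub> q = Id D P)"

locale linear_category =
  fixes D :: "('o, 'm::ab_group_add, 'k::field, 'z) lin_cat_scheme" (structure)
  assumes scale_vector_space: "vector_space (Scale D)"
    and hom_subspace: "\<lbrakk>X \<in> Ob D; Y \<in> Ob D\<rbrakk> \<Longrightarrow> module.subspace (Scale D) (Hom D X Y)"
    and id_hom: "X \<in> Ob D \<Longrightarrow> Id D X \<in> Hom D X X"
    and comp_hom: "\<lbrakk>X \<in> Ob D; Y \<in> Ob D; Z \<in> Ob D; f \<in> Hom D X Y; g \<in> Hom D Y Z\<rbrakk>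
           \<Longrightarrow> g \<cdot> f \<in> Hom D X Z"
    and comp_id_left: "\<lbrakk>X \<in> Ob D; Y \<in> Ob D; f \<in> Hom D X Y\<rbrakk> \<Longrightarrow> Id D Y \<cdot> f = f"
    and comp_id_right: "\<lbrakk>X \<in> Ob D; Y \<in> Ob D; f \<in> Hom D X Y\<rbrakk> \<Longrightarrow> f \<cdot> Id D X = f"
    and comp_assoc: "\<lbrakk>W \<in> Ob D; X \<in> Ob D; Y \<in> Ob D; Z \<in> Ob D;
           f \<in> Hom D W X; g \<in> Hom D X Y; h \<in> Hom D Y Z\<rbrakk> \<Longrightarrow> (h \<cdot> g) \<cdot> f = h \<cdot> (g \<cdot> f)"
    and comp_linear_right: "\<lbrakk>X \<in> Ob D; Y \<in> Ob D; Z \<in> Ob D; g \<in> Hom D Y Z\<rbrakk>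
           \<Longrightarrow> klinear_on (Scale D) (Hom D X Y) (Scale D) (\<lambda>f. g \<cdot> f)"
    and comp_linear_left: "\<lbrakk>X \<in> Ob D; Y \<in> Ob D; Z \<in> Ob D; f \<in> Hom D X Y\<rbrakk>
           \<Longrightarrow> klinear_on (Scale D) (Hom D Y Z) (Scale D) (\<lambda>g. g \<cdot> f)"
    and zero_object_exists: "\<exists>Z. zero_object D Z"
    and biproduct_exists: "\<lbrakk>X \<in> Ob D; Y \<in> Ob D\<rbrakk> \<Longrightarrow> \<exists>P. biproduct D X Y P"


section \<open>Triangulated categories\<close>

text \<open>
  The shift is an automorphism; \<open>Sh n X\<close> is \<open>X[n]\<close>, \<open>ShM n f\<close> is \<open>f[n]\<close> (\<open>n\<close> any integer).
  \<open>Dist X Y Z f g h\<close>: the triangle \<open>X \<rightarrow> Y \<rightarrow> Z \<rightarrow> X[1]\<close> with maps \<open>f\<close>, \<open>g\<close>, \<open>h\<close> is exact.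
\<close>

record ('o, 'm, 'k) tri_cat = "('o, 'm, 'k) lin_cat" +
  Sh :: "int \<Rightarrow> 'o \<Rightarrow> 'o"
  ShM :: "int \<Rightarrow> 'm \<Rightarrow> 'm"
  Dist :: "'o \<Rightarrow> 'o \<Rightarrow> 'o \<Rightarrow> 'm \<Rightarrow> 'm \<Rightarrow> 'm \<Rightarrow> bool"

locale triangulated_category = linear_category D
  for D :: "('o, 'm::ab_group_add, 'k::field, 'z) tri_cat_scheme" (structure) +
  assumes sh_ob: "X \<in> Ob D \<Longrightarrow> Sh D n X \<in> Ob D"
    and sh_zero: "X \<in> Ob D \<Longrightarrow> Sh D 0 X = X"
    and sh_add: "X \<in> Ob D \<Longrightarrow> Sh D (m + n) X = Sh D m (Sh D n X)"
    and shm_hom: "\<lbrakk>X \<in> Ob D; Y \<in> Ob D; f \<in> Hom D X Y\<rbrakk> \<Longrightarrow> ShM D n f \<in> Hom D (Sh D n X) (Sh D n Y)"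
    and shm_zero: "\<lbrakk>X \<in> Ob D; Y \<in> Ob D; f \<in> Hom D X Y\<rbrakk> \<Longrightarrow> ShM D 0 f = f"
    and shm_add: "\<lbrakk>X \<in> Ob D; Y \<in> Ob D; f \<in> Hom D X Y\<rbrakk> \<Longrightarrow> ShM D (m + n) f = ShM D m (ShM D n f)"
    and shm_linear: "\<lbrakk>X \<in> Ob D; Y \<in> Ob D\<rbrakk> \<Longrightarrow> klinear_on (Scale D) (Hom D X Y) (Scale D) (ShM D n)"
    and shm_id: "X \<in> Ob D \<Longrightarrow> ShM D n (Id D X) = Id D (Sh D n X)"
    and shm_comp: "\<lbrakk>X \<in> Ob D; Y \<in> Ob D; Z \<in> Ob D; f \<in> Hom D X Y; g \<in> Hom D Y Z\<rbrakk>
           \<Longrightarrow> ShM D n (g \<cdot> f) = ShM D n g \<cdot> ShM D n f"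
    and dist_typed: "Dist D X Y Z f g h \<Longrightarrow> X \<in> Ob D \<and> Y \<in> Ob D \<and> Z \<in> Ob D \<and>
           f \<in> Hom D X Y \<and> g \<in> Hom D Y Z \<and> h \<in> Hom D Z (Sh D 1 X)"
    and dist_iso: "\<lbrakk>Dist D X Y Z f g h; X' \<in> Ob D; Y' \<in> Ob D; Z' \<in> Ob D;
           f' \<in> Hom D X' Y'; g' \<in> Hom D Y' Z'; h' \<in> Hom D Z' (Sh D 1 X');
           is_iso D X X' a; is_iso D Y Y' b; is_iso D Z Z' c;
           b \<cdot> f = f' \<cdot> a; c \<cdot> g = g' \<cdot> b; ShM D 1 a \<cdot> h = h' \<cdot> c\<rbrakk>
           \<Longrightarrow> Dist D X' Y' Z' f' g' h'"
    and TR1_id: "\<lbrakk>X \<in> Ob D; zero_object D Z\<rbrakk> \<Longrightarrow> Dist D X X Z (Id D X) 0 0"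
    and TR1_cone: "\<lbrakk>X \<in> Ob D; Y \<in> Ob D; f \<in> Hom D X Y\<rbrakk> \<Longrightarrow> \<exists>Z g h. Dist D X Y Z f g h"
    and TR2: "\<lbrakk>X \<in> Ob D; Y \<in> Ob D; Z \<in> Ob D;
           f \<in> Hom D X Y; g \<in> Hom D Y Z; h \<in> Hom D Z (Sh D 1 X)\<rbrakk>
           \<Longrightarrow> Dist D X Y Z f g h \<longleftrightarrow> Dist D Y Z (Sh D 1 X) g h (- ShM D 1 f)"
    and TR3: "\<lbrakk>Dist D X Y Z f g h; Dist D X' Y' Z' f' g' h';
           a \<in> Hom D X X'; b \<in> Hom D Y Y'; b \<cdot> f = f' \<cdot> a\<rbrakk>
           \<Longrightarrow> \<exists>c\<in>Hom D Z Z'. c \<cdot> g = g' \<cdot> b \<and> ShM D 1 a \<cdot> h = h' \<cdot> c"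
    and TR4: "\<lbrakk>Dist D X Y U f f1 f2; Dist D Y Z V g g1 g2; Dist D X Z W (g \<cdot> f) h1 h2\<rbrakk>
           \<Longrightarrow> \<exists>a b. Dist D U W V a b (ShM D 1 f1 \<cdot> g2) \<and>
                 a \<cdot> f1 = h1 \<cdot> g \<and> b \<cdot> h1 = g1 \<and> h2 \<cdot> a = f2 \<and> g2 \<cdot> b = ShM D 1 f \<cdot> h2"

record ('o, 'm, 'p, 'n) func =
  FOb :: "'o \<Rightarrow> 'p"
  FMor :: "'m \<Rightarrow> 'n"

definition linear_functor ::
  "('o, 'm::ab_group_add, 'k, 'z) lin_cat_scheme \<Rightarrow> ('p, 'n::ab_group_add, 'k, 'y) lin_cat_scheme
     \<Rightarrow> ('o, 'm, 'p, 'n) func \<Rightarrow> bool" where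
  "linear_functor D D' T \<longleftrightarrow>
     (\<forall>X\<in>Ob D. FOb T X \<in> Ob D' \<and> FMor T (Id D X) = Id D' (FOb T X)) \<and>
     (\<forall>X\<in>Ob D. \<forall>Y\<in>Ob D. FMor T ` Hom D X Y \<subseteq> Hom D' (FOb T X) (FOb T Y) \<and>
        klinear_on (Scale D) (Hom D X Y) (Scale D') (FMor T)) \<and>
     (\<forall>X\<in>Ob D. \<forall>Y\<in>Ob D. \<forall>Z\<in>Ob D. \<forall>f\<in>Hom D X Y. \<forall>g\<in>Hom D Y Z.
        FMor T (g \<cdot>\<^bsub>D\<^esub> f) = FMor T g \<cdot>\<^bsub>D'\<^esub> FMor T f)"

text \<open>\<open>\<omega>\<close> is the natural isomorphism \<open>T(X[1]) \<cong> T(X)[1]\<close> belonging to an exact functor.\<close>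

definition exact_functor ::
  "('o, 'm::ab_group_add, 'k) tri_cat \<Rightarrow> ('p, 'n::ab_group_add, 'k) tri_cat
     \<Rightarrow> ('o, 'm, 'p, 'n) func \<Rightarrow> bool" where
  "exact_functor D D' T \<longleftrightarrow> linear_functor D D' T \<and>
     (\<exists>\<omega>.
        (\<forall>X\<in>Ob D. is_iso D' (FOb T (Sh D 1 X)) (Sh D' 1 (FOb T X)) (\<omega> X)) \<and>
        (\<forall>X\<in>Ob D. \<forall>Y\<in>Ob D. \<forall>f\<in>Hom D X Y.
           \<omega> Y \<cdot>\<^bsub>D'\<^esub> FMor T (ShM D 1 f) = ShM D' 1 (FMor T f) \<cdot>\<^bsub>D'\<^esub> \<omega> X) \<and>
        (\<forall>X Y Z f g h. Dist D X Y Z f g h \<longrightarrow>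
           Dist D' (FOb T X) (FOb T Y) (FOb T Z) (FMor T f) (FMor T g) (\<omega> X \<cdot>\<^bsub>D'\<^esub> FMor T h)))"

definition exact_autoequivalence ::
  "('o, 'm::ab_group_add, 'k) tri_cat \<Rightarrow> ('o, 'm, 'o, 'm) func \<Rightarrow> bool" where
  "exact_autoequivalence D T \<longleftrightarrow> exact_functor D D T \<and>
     (\<forall>X\<in>Ob D. \<forall>Y\<in>Ob D. bij_betw (FMor T) (Hom D X Y) (Hom D (FOb T X) (FOb T Y))) \<and>
     (\<forall>Y\<in>Ob D. \<exists>X\<in>Ob D. \<exists>f. is_iso D (FOb T X) Y f)"

definition finite_type :: "('o, 'm::ab_group_add, 'k::field) tri_cat \<Rightarrow> bool" where
  "finite_type D \<longleftrightarrow>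
     (\<forall>E\<in>Ob D. \<forall>F\<in>Ob D.
        finite {i. Hom D E (Sh D i F) \<noteq> {0}} \<and>
        (\<forall>i. \<exists>B. finite B \<and> Hom D E (Sh D i F) = module.span (Scale D) B))"

definition right_orthogonal :: "('o, 'm::ab_group_add, 'k) tri_cat \<Rightarrow> 'o \<Rightarrow> 'o set" where
  "right_orthogonal D E = {F \<in> Ob D. \<forall>i. Hom D E (Sh D i F) = {0}}"


section \<open>Split-generators, complexity and entropy\<close>

definition thick_subcategory :: "('o, 'm::ab_group_add, 'k) tri_cat \<Rightarrow> 'o set \<Rightarrow> bool" where
  "thick_subcategory D S \<longleftrightarrow> S \<subseteq> Ob D \<and>
     (\<forall>X\<in>S. \<forall>n. Sh D n X \<in> S) \<and>
     (\<forall>X Y Z f g h. X \<in> S \<longrightarrow> Y \<in> S \<longrightarrow> Dist D X Y Z f g h \<longrightarrow> Z \<in> S) \<and>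
     (\<forall>X\<in>Ob D. \<forall>Y\<in>Ob D. \<forall>P\<in>S. biproduct D X Y P \<longrightarrow> X \<in> S)"

definition split_generator :: "('o, 'm::ab_group_add, 'k) tri_cat \<Rightarrow> 'o \<Rightarrow> bool" where
  "split_generator D G \<longleftrightarrow> G \<in> Ob D \<and> \<Inter>{S. thick_subcategory D S \<and> G \<in> S} = Ob D"

definition tower :: "('o, 'm::ab_group_add, 'k) tri_cat \<Rightarrow> 'o \<Rightarrow> int list \<Rightarrow> (nat \<Rightarrow> 'o) \<Rightarrow> bool" where
  "tower D E ns A \<longleftrightarrow> zero_object D (A 0) \<and>
     (\<forall>i<length ns. \<exists>f g h. Dist D (A i) (A (Suc i)) (Sh D (ns ! i) E) f g h)"

definition complexity :: "('o, 'm::ab_group_add, 'k) tri_cat \<Rightarrow> real \<Rightarrow> 'o \<Rightarrow> 'o \<Rightarrow> ereal" where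
  "complexity D t E F =
     (if zero_object D F then 0
      else Inf {ereal (\<Sum>n\<leftarrow>ns. exp (real_of_int n * t)) | ns.
             \<exists>A. \<exists>F'\<in>Ob D. tower D E ns A \<and> biproduct D F F' (A (length ns))})"

definition log_ereal :: "ereal \<Rightarrow> ereal" where
  "log_ereal x = (if x \<le> 0 then - \<infinity> else if x = \<infinity> then \<infinity> else ereal (ln (real_of_ereal x)))"

text \<open>The common limit for all split-generators.\<close>

definition entropy ::
  "('o, 'm::ab_group_add, 'k) tri_cat \<Rightarrow> real \<Rightarrow> ('o, 'm, 'o, 'm) func \<Rightarrow> ereal" where
  "entropy D t \<Phi> =
     (THE h. \<forall>G. split_generator D G \<longrightarrow>
        (\<lambda>n. ereal (1 / real n) * log_ereal (complexity D t G ((FOb \<Phi> ^^ n) G))) \<longlonglongrightarrow> h)"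


section \<open>Spherical objects\<close>

text \<open>
  The degree \<open>i\<close> part of the graded algebra \<open>K[h]/(h\<^sup>2)\<close> with \<open>deg h = d\<close>. Elements are represented
  by polynomials of degree less than 2, multiplied modulo \<open>h\<^sup>2\<close>.
\<close>

definition dual_numbers_part :: "int \<Rightarrow> int \<Rightarrow> 'k::field poly set" where
  "dual_numbers_part d i = {p. degree p < 2 \<and> (\<forall>k. coeff p k \<noteq> 0 \<longrightarrow> int k * d = i)}"

definition dual_numbers_mult :: "'k::field poly \<Rightarrow> 'k poly \<Rightarrow> 'k poly" where
  "dual_numbers_mult p q = (p * q) mod [:0, 0, 1:]"

text \<open>
  In the first condition the product of \<open>a \<in> Hom(E, E[i])\<close> and \<open>b \<in> Hom(E, E[j])\<close> is
  \<open>a[j] \<circ> b \<in> Hom(E, E[i + j])\<close>.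
  In the second one, \<open>\<beta> F i\<close> is a map from \<open>Hom(E, F[i])\<close> to the dual of \<open>Hom(F, E[d - i])\<close>, i.e. to
  the degree \<open>i\<close> part of the graded dual of \<open>Hom\<^sup>*(F, E[d])\<close>; it is required to be linear, bijective
  and natural in \<open>F\<close>.
\<close>

definition spherical_object :: "('o, 'm::ab_group_add, 'k::field) tri_cat \<Rightarrow> int \<Rightarrow> 'o \<Rightarrow> bool" where
  "spherical_object D d E \<longleftrightarrow> E \<in> Ob D \<and>
     (\<exists>\<phi>.
        (\<forall>i. klinear_on (Scale D) (Hom D E (Sh D i E)) smult (\<phi> i) \<and>
             bij_betw (\<phi> i) (Hom D E (Sh D i E)) (dual_numbers_part d i)) \<and>
        \<phi> 0 (Id D E) = 1 \<and>
        (\<forall>i j. \<forall>a\<in>Hom D E (Sh D i E). \<forall>b\<in>Hom D E (Sh D j E).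
           \<phi> (i + j) (ShM D j a \<cdot>\<^bsub>D\<^esub> b) = dual_numbers_mult (\<phi> i a) (\<phi> j b))) \<and>
     (\<exists>\<beta>.
        (\<forall>F\<in>Ob D. \<forall>i.
           (\<forall>f\<in>Hom D E (Sh D i F).
              klinear_on (Scale D) (Hom D F (Sh D (d - i) E)) (*) (\<beta> F i f)) \<and>
           (\<forall>g\<in>Hom D F (Sh D (d - i) E).
              klinear_on (Scale D) (Hom D E (Sh D i F)) (*) (\<lambda>f. \<beta> F i f g)) \<and>
           (\<forall>l. klinear_on (Scale D) (Hom D F (Sh D (d - i) E)) (*) l \<longrightarrow>
              (\<exists>!f. f \<in> Hom D E (Sh D i F) \<and> (\<forall>g\<in>Hom D F (Sh D (d - i) E). \<beta> F i f g = l g)))) \<and>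
        (\<forall>F\<in>Ob D. \<forall>F'\<in>Ob D. \<forall>a\<in>Hom D F F'. \<forall>i.
           \<forall>f\<in>Hom D E (Sh D i F). \<forall>g\<in>Hom D F' (Sh D (d - i) E).
             \<beta> F' i (ShM D i a \<cdot>\<^bsub>D\<^esub> f) g = \<beta> F i f (g \<cdot>\<^bsub>D\<^esub> a)))"


section \<open>Dg categories and dg enhancements\<close>

text \<open>
  \<open>DHom X Y n\<close> is the degree \<open>n\<close> part of the morphism complex; \<open>Dif\<close> is the differential,
  raising degrees by one.
\<close>

record ('a, 'r, 'k) dg_cat =
  DOb :: "'a set"
  DHom :: "'a \<Rightarrow> 'a \<Rightarrow> int \<Rightarrow> 'r set"
  DId :: "'a \<Rightarrow> 'r"
  DComp :: "'r \<Rightarrow> 'r \<Rightarrow> 'r"  (infixr "\<odot>\<index>" 70)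
  DScale :: "'k \<Rightarrow> 'r \<Rightarrow> 'r"
  Dif :: "'r \<Rightarrow> 'r"

definition sgn_power :: "int \<Rightarrow> 'r::ab_group_add \<Rightarrow> 'r" where
  "sgn_power n x = (if even n then x else - x)"

locale dg_category =
  fixes A :: "('a, 'r::ab_group_add, 'k::field) dg_cat" (structure)
  assumes dscale_vector_space: "vector_space (DScale A)"
    and dhom_subspace: "\<lbrakk>X \<in> DOb A; Y \<in> DOb A\<rbrakk> \<Longrightarrow> module.subspace (DScale A) (DHom A X Y n)"
    and did_hom: "X \<in> DOb A \<Longrightarrow> DId A X \<in> DHom A X X 0"
    and dcomp_hom: "\<lbrakk>X \<in> DOb A; Y \<in> DOb A; Z \<in> DOb A; f \<in> DHom A X Y n; g \<in> DHom A Y Z m\<rbrakk>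
           \<Longrightarrow> g \<odot> f \<in> DHom A X Z (m + n)"
    and dcomp_id_left: "\<lbrakk>X \<in> DOb A; Y \<in> DOb A; f \<in> DHom A X Y n\<rbrakk> \<Longrightarrow> DId A Y \<odot> f = f"
    and dcomp_id_right: "\<lbrakk>X \<in> DOb A; Y \<in> DOb A; f \<in> DHom A X Y n\<rbrakk> \<Longrightarrow> f \<odot> DId A X = f"
    and dcomp_assoc: "\<lbrakk>W \<in> DOb A; X \<in> DOb A; Y \<in> DOb A; Z \<in> DOb A;
           f \<in> DHom A W X l; g \<in> DHom A X Y m; h \<in> DHom A Y Z n\<rbrakk>
           \<Longrightarrow> (h \<odot> g) \<odot> f = h \<odot> (g \<odot> f)"
    and dcomp_linear_right: "\<lbrakk>X \<in> DOb A; Y \<in> DOb A; Z \<in> DOb A; g \<in> DHom A Y Z m\<rbrakk>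
           \<Longrightarrow> klinear_on (DScale A) (DHom A X Y n) (DScale A) (\<lambda>f. g \<odot> f)"
    and dcomp_linear_left: "\<lbrakk>X \<in> DOb A; Y \<in> DOb A; Z \<in> DOb A; f \<in> DHom A X Y n\<rbrakk>
           \<Longrightarrow> klinear_on (DScale A) (DHom A Y Z m) (DScale A) (\<lambda>g. g \<odot> f)"
    and dif_hom: "\<lbrakk>X \<in> DOb A; Y \<in> DOb A; f \<in> DHom A X Y n\<rbrakk> \<Longrightarrow> Dif A f \<in> DHom A X Y (n + 1)"
    and dif_linear: "\<lbrakk>X \<in> DOb A; Y \<in> DOb A\<rbrakk>
           \<Longrightarrow> klinear_on (DScale A) (DHom A X Y n) (DScale A) (Dif A)"
    and dif_dif: "\<lbrakk>X \<in> DOb A; Y \<in> DOb A; f \<in> DHom A X Y n\<rbrakk> \<Longrightarrow> Dif A (Dif A f) = 0"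
    and leibniz: "\<lbrakk>X \<in> DOb A; Y \<in> DOb A; Z \<in> DOb A; f \<in> DHom A X Y n; g \<in> DHom A Y Z m\<rbrakk>
           \<Longrightarrow> Dif A (g \<odot> f) = Dif A g \<odot> f + sgn_power m (g \<odot> Dif A f)"

definition cycles :: "('a, 'r::ab_group_add, 'k) dg_cat \<Rightarrow> 'a \<Rightarrow> 'a \<Rightarrow> int \<Rightarrow> 'r set" where
  "cycles A X Y n = {f \<in> DHom A X Y n. Dif A f = 0}"

definition boundaries :: "('a, 'r::ab_group_add, 'k) dg_cat \<Rightarrow> 'a \<Rightarrow> 'a \<Rightarrow> int \<Rightarrow> 'r set" where
  "boundaries A X Y n = Dif A ` DHom A X Y (n - 1)"

text \<open>
  \<open>C\<close> is the cone of the closed degree 0 morphism \<open>f : X \<rightarrow> Y\<close>: as a graded object it is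
  \<open>X[1] \<oplus> Y\<close> with inclusions \<open>i\<close>, \<open>j\<close> and projections \<open>p\<close>, \<open>q\<close>, and \<open>f\<close> is the off-diagonal part of
  its differential. The remaining identities \<open>d p = 0\<close> and \<open>d q = - f p\<close> follow.
\<close>

definition dg_cone ::
  "('a, 'r::ab_group_add, 'k) dg_cat \<Rightarrow> 'a \<Rightarrow> 'a \<Rightarrow> 'r \<Rightarrow> 'a \<Rightarrow> 'r \<Rightarrow> 'r \<Rightarrow> 'r \<Rightarrow> 'r \<Rightarrow> bool" where
  "dg_cone A X Y f C i p j q \<longleftrightarrow> C \<in> DOb A \<and>
     i \<in> DHom A X C (- 1) \<and> p \<in> DHom A C X 1 \<and> j \<in> DHom A Y C 0 \<and> q \<in> DHom A C Y 0 \<and>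
     p \<odot>\<^bsub>A\<^esub> i = DId A X \<and> q \<odot>\<^bsub>A\<^esub> j = DId A Y \<and> p \<odot>\<^bsub>A\<^esub> j = 0 \<and> q \<odot>\<^bsub>A\<^esub> i = 0 \<and>
     i \<odot>\<^bsub>A\<^esub> p + j \<odot>\<^bsub>A\<^esub> q = DId A C \<and>
     Dif A i = j \<odot>\<^bsub>A\<^esub> f \<and> Dif A j = 0"

text \<open>
  Pretriangulated in the sense of Bondal and Kapranov: zero object, shifts and cones of closed degree
  0 morphisms exist in the dg category itself (equivalently, every twisted complex is representable).
\<close>

definition pretriangulated :: "('a, 'r::ab_group_add, 'k::field) dg_cat \<Rightarrow> bool" where
  "pretriangulated A \<longleftrightarrow> dg_category A \<and>
     (\<exists>Z\<in>DOb A. \<forall>X\<in>DOb A. \<forall>n. DHom A X Z n = {0} \<and> DHom A Z X n = {0}) \<and>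
     (\<forall>X\<in>DOb A. \<forall>n. \<exists>X'\<in>DOb A. \<exists>s\<in>cycles A X X' (- n). \<exists>s'\<in>cycles A X' X n.
        s' \<odot>\<^bsub>A\<^esub> s = DId A X \<and> s \<odot>\<^bsub>A\<^esub> s' = DId A X') \<and>
     (\<forall>X\<in>DOb A. \<forall>Y\<in>DOb A. \<forall>f\<in>cycles A X Y 0. \<exists>C i p j q. dg_cone A X Y f C i p j q)"

definition dg_functor ::
  "('a, 'r::ab_group_add, 'k) dg_cat \<Rightarrow> ('b, 's::ab_group_add, 'k) dg_cat
     \<Rightarrow> ('a, 'r, 'b, 's) func \<Rightarrow> bool" where
  "dg_functor A B S \<longleftrightarrow>
     (\<forall>X\<in>DOb A. FOb S X \<in> DOb B \<and> FMor S (DId A X) = DId B (FOb S X)) \<and>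
     (\<forall>X\<in>DOb A. \<forall>Y\<in>DOb A. \<forall>n. FMor S ` DHom A X Y n \<subseteq> DHom B (FOb S X) (FOb S Y) n \<and>
        klinear_on (DScale A) (DHom A X Y n) (DScale B) (FMor S) \<and>
        (\<forall>f\<in>DHom A X Y n. FMor S (Dif A f) = Dif B (FMor S f))) \<and>
     (\<forall>X\<in>DOb A. \<forall>Y\<in>DOb A. \<forall>Z\<in>DOb A. \<forall>m n. \<forall>f\<in>DHom A X Y m. \<forall>g\<in>DHom A Y Z n.
        FMor S (g \<odot>\<^bsub>A\<^esub> f) = FMor S g \<odot>\<^bsub>B\<^esub> FMor S f)"

text \<open>
  An equivalence of triangulated categories \<open>\<Psi> : H\<^sup>0(A) \<rightarrow> D\<close> is presented without forming
  quotients and without choosing shifts in \<open>A\<close>, through its effect on all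
  \<open>H\<^sup>n(hom\<^sub>A(X, Y)) = Hom(X, Y[n])\<close>: \<open>EMor \<Psi> n\<close> maps closed degree \<open>n\<close> morphisms \<open>X \<rightarrow> Y\<close> onto
  \<open>Hom(\<Psi> X, (\<Psi> Y)[n])\<close> and its kernel consists of the boundaries. The degrees \<open>n \<noteq> 0\<close> encode the
  isomorphism \<open>\<Psi>(Y[n]) \<cong> (\<Psi> Y)[n]\<close>. The exact triangles of \<open>H\<^sup>0(A)\<close> are those given by cones, where
  the map \<open>C \<rightarrow> X[1]\<close> is the degree 1 projection \<open>p : C \<rightarrow> X\<close>.
\<close>

record ('a, 'r, 'o, 'm) enh =
  EOb :: "'a \<Rightarrow> 'o"
  EMor :: "int \<Rightarrow> 'r \<Rightarrow> 'm"

definition dg_enhancement ::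
  "('o, 'm::ab_group_add, 'k::field) tri_cat \<Rightarrow> ('a, 'r::ab_group_add, 'k) dg_cat
     \<Rightarrow> ('a, 'r, 'o, 'm) enh \<Rightarrow> bool" where
  "dg_enhancement D A \<Psi> \<longleftrightarrow> pretriangulated A \<and>
     (\<forall>X\<in>DOb A. EOb \<Psi> X \<in> Ob D \<and> EMor \<Psi> 0 (DId A X) = Id D (EOb \<Psi> X)) \<and>
     (\<forall>X\<in>DOb A. \<forall>Y\<in>DOb A. \<forall>n.
        klinear_on (DScale A) (cycles A X Y n) (Scale D) (EMor \<Psi> n) \<and>
        EMor \<Psi> n ` cycles A X Y n = Hom D (EOb \<Psi> X) (Sh D n (EOb \<Psi> Y)) \<and>
        (\<forall>f\<in>cycles A X Y n. EMor \<Psi> n f = 0 \<longleftrightarrow> f \<in> boundaries A X Y n)) \<and>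
     (\<forall>X\<in>DOb A. \<forall>Y\<in>DOb A. \<forall>Z\<in>DOb A. \<forall>m n. \<forall>f\<in>cycles A X Y n. \<forall>g\<in>cycles A Y Z m.
        EMor \<Psi> (m + n) (g \<odot>\<^bsub>A\<^esub> f) = ShM D n (EMor \<Psi> m g) \<cdot>\<^bsub>D\<^esub> EMor \<Psi> n f) \<and>
     (\<forall>F\<in>Ob D. \<exists>X\<in>DOb A. \<exists>f. is_iso D (EOb \<Psi> X) F f) \<and>
     (\<forall>X\<in>DOb A. \<forall>Y\<in>DOb A. \<forall>f\<in>cycles A X Y 0. \<forall>C i p j q. dg_cone A X Y f C i p j q \<longrightarrow>
        Dist D (EOb \<Psi> X) (EOb \<Psi> Y) (EOb \<Psi> C) (EMor \<Psi> 0 f) (EMor \<Psi> 0 j) (EMor \<Psi> 1 p))"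


section \<open>Spherical twists\<close>

text \<open>
  \<open>P\<close> is the object \<open>V \<otimes> E = \<Oplus>\<^sub>n V\<^sub>n \<otimes> E[-n]\<close> for a graded vector space \<open>V\<close>, given by its universal
  property \<open>Hom(V \<otimes> E, Z) \<cong> Hom\<^sub>K(V, Hom\<^sup>*(E, Z))\<close> (graded maps of degree 0); \<open>\<iota> n v\<close> is the
  map \<open>E \<rightarrow> (V \<otimes> E)[n]\<close>, \<open>e \<mapsto> v \<otimes> e\<close>.
\<close>

definition tensor_object ::
  "('o, 'm::ab_group_add, 'k) tri_cat \<Rightarrow> (int \<Rightarrow> 'm set) \<Rightarrow> 'o \<Rightarrow> 'o \<Rightarrow> (int \<Rightarrow> 'm \<Rightarrow> 'm) \<Rightarrow> bool" where
  "tensor_object D V E P \<iota> \<longleftrightarrow> P \<in> Ob D \<and>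
     (\<forall>n. klinear_on (Scale D) (V n) (Scale D) (\<iota> n) \<and> \<iota> n ` V n \<subseteq> Hom D E (Sh D n P)) \<and>
     (\<forall>Z\<in>Ob D. \<forall>l.
        (\<forall>n. klinear_on (Scale D) (V n) (Scale D) (l n) \<and> l n ` V n \<subseteq> Hom D E (Sh D n Z)) \<longrightarrow>
        (\<exists>!g. g \<in> Hom D P Z \<and> (\<forall>n. \<forall>v\<in>V n. ShM D n g \<cdot>\<^bsub>D\<^esub> \<iota> n v = l n v)))"

text \<open>
  A dg lift of the evaluation \<open>Hom\<^sup>*(E, -) \<otimes> E \<rightarrow> Id\<close>: a dg functor \<open>S\<close> and a closed degree 0 dg
  natural transformation \<open>\<epsilon> : S \<rightarrow> Id\<close> such that \<open>S\<close> induces the functor \<open>Hom\<^sup>*(E, -) \<otimes> E\<close> on \<open>D\<close>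
  (naturally, via \<open>\<iota>\<close>) and \<open>\<epsilon>\<close> induces \<open>v \<otimes> e \<mapsto> v(e)\<close>.
\<close>

definition evaluation_lift ::
  "('o, 'm::ab_group_add, 'k::field) tri_cat \<Rightarrow> ('a, 'r::ab_group_add, 'k) dg_cat
     \<Rightarrow> ('a, 'r, 'o, 'm) enh \<Rightarrow> 'o \<Rightarrow> ('a, 'r, 'a, 'r) func \<Rightarrow> ('a \<Rightarrow> 'r) \<Rightarrow> bool" where
  "evaluation_lift D A \<Psi> E S \<epsilon> \<longleftrightarrow> dg_functor A A S \<and>
     (\<forall>X\<in>DOb A. \<epsilon> X \<in> cycles A (FOb S X) X 0) \<and>
     (\<forall>X\<in>DOb A. \<forall>Y\<in>DOb A. \<forall>n. \<forall>f\<in>DHom A X Y n. \<epsilon> Y \<odot>\<^bsub>A\<^esub> FMor S f = f \<odot>\<^bsub>A\<^esub> \<epsilon> X) \<and>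
     (\<exists>\<iota>.
        (\<forall>X\<in>DOb A.
           tensor_object D (\<lambda>n. Hom D E (Sh D n (EOb \<Psi> X))) E (EOb \<Psi> (FOb S X)) (\<iota> X)) \<and>
        (\<forall>X\<in>DOb A. \<forall>Y\<in>DOb A. \<forall>f\<in>cycles A X Y 0. \<forall>n. \<forall>v\<in>Hom D E (Sh D n (EOb \<Psi> X)).
           ShM D n (EMor \<Psi> 0 (FMor S f)) \<cdot>\<^bsub>D\<^esub> \<iota> X n v = \<iota> Y n (ShM D n (EMor \<Psi> 0 f) \<cdot>\<^bsub>D\<^esub> v)) \<and>
        (\<forall>X\<in>DOb A. \<forall>n. \<forall>v\<in>Hom D E (Sh D n (EOb \<Psi> X)).
           ShM D n (EMor \<Psi> 0 (\<epsilon> X)) \<cdot>\<^bsub>D\<^esub> \<iota> X n v = v))"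

text \<open>
  \<open>T\<close> is the exact autoequivalence of \<open>D\<close> induced by the functorial cone of a dg lift \<open>\<epsilon>\<close> of the
  evaluation: \<open>\<tau>\<close> is a natural isomorphism from \<open>T\<close> to the functor \<open>X \<mapsto> C X\<close>, which acts on a
  closed degree 0 morphism \<open>f : X \<rightarrow> Y\<close> by \<open>S(f)[1] \<oplus> f\<close>.
\<close>

definition spherical_twist ::
  "('o, 'm::ab_group_add, 'k::field) tri_cat \<Rightarrow> ('a, 'r::ab_group_add, 'k) dg_cat
     \<Rightarrow> ('a, 'r, 'o, 'm) enh \<Rightarrow> 'o \<Rightarrow> ('o, 'm, 'o, 'm) func \<Rightarrow> bool" where
  "spherical_twist D A \<Psi> E T \<longleftrightarrow> exact_autoequivalence D T \<and>
     (\<exists>S \<epsilon> C i p j q \<tau>. evaluation_lift D A \<Psi> E S \<epsilon> \<and>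
        (\<forall>X\<in>DOb A. dg_cone A (FOb S X) X (\<epsilon> X) (C X) (i X) (p X) (j X) (q X)) \<and>
        (\<forall>X\<in>DOb A. is_iso D (FOb T (EOb \<Psi> X)) (EOb \<Psi> (C X)) (\<tau> X)) \<and>
        (\<forall>X\<in>DOb A. \<forall>Y\<in>DOb A. \<forall>f\<in>cycles A X Y 0.
           \<tau> Y \<cdot>\<^bsub>D\<^esub> FMor T (EMor \<Psi> 0 f) =
           EMor \<Psi> 0 (i Y \<odot>\<^bsub>A\<^esub> FMor S f \<odot>\<^bsub>A\<^esub> p X + j Y \<odot>\<^bsub>A\<^esub> f \<odot>\<^bsub>A\<^esub> q X) \<cdot>\<^bsub>D\<^esub> \<tau> X))"

end

theory Submission
  imports Defs
begin

text \<open>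
  Submultiplicativity and subadditivity of complexity, together with the exact triangle
  \<open>G \<rightarrow> T G \<rightarrow> Hom\<^sup>*(E, G) \<otimes> E[1]\<close>, give \<open>\<delta>(G, T\<^sup>n\<^sup>+\<^sup>1 G) \<le> \<delta>(G, T\<^sup>n G) + C \<cdot> \<delta>(G, T\<^sup>n E)\<close>. Since
  \<open>T E \<cong> E[1 - d]\<close>, the last factor is \<open>exp (n (1 - d) t) \<delta>(G, E)\<close>, which bounds the growth from above.
  Conversely, a nonzero \<open>F\<close> with \<open>T F \<cong> F[m]\<close> satisfies
  \<open>exp (m n t) \<delta>(G, F) = \<delta>(G, T\<^sup>n F) \<le> \<delta>(G, T\<^sup>n G) \<delta>(G, F)\<close>; take \<open>F = E\<close>, or \<open>F\<close> in the right
  orthogonal of \<open>E\<close>, where \<open>T F \<cong> F\<close>. Finite type makes \<open>\<delta>(G, F)\<close> positive: only shifts in a finite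
  range admit a nonzero map from \<open>G\<close>.
\<close>

section \<open>Triangulated categories\<close>

text \<open>The shift in \<open>T E = E[1 - d]\<close> comes from the two classes, in degrees 0 and
  d, that span the graded Hom from E to itself: tensored with E it is E + E[-d], the evaluation is a
  split epimorphism onto the first summand, and its cone is E[-d] shifted once. The obstacle is that
  inside D cones are unique only up to noncanonical isomorphism, and tensor objects are known only
  by a universal property. The argument therefore runs on objects up to isomorphism or retract and
  on the mere existence of triangles; the dg data are opened once, to produce the evaluation
  triangle for an object isomorphic to a given one. Since \<open>entropy\<close> is a definite
  description, a limit common to all split-generators must be established first: Fekete's lemma
  gives it for each generator, with E supplying the linear lower bound that keeps it finite, and
  changing the generator costs a constant factor that disappears after taking logarithms and
  dividing by n. The same division removes the factor \<open>1 + C n\<close> that the recursion for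
  the upper bound accumulates when its n terms are summed.\<close>

locale tricat = triangulated_category D
  for D :: "('o, 'm::ab_group_add, 'k::field) tri_cat" (structure)
begin

sublocale vs: vector_space "Scale D"
  by (rule scale_vector_space)

text \<open>Every axiom is conditional on its objects lying in \<open>Ob D\<close>. Carrying this
  inside the typing judgement lets arrows be composed by resolution, without separate object
  premises.\<close>

definition arr :: "'m \<Rightarrow> 'o \<Rightarrow> 'o \<Rightarrow> bool" where
  "arr f X Y \<longleftrightarrow> X \<in> Ob D \<and> Y \<in> Ob D \<and> f \<in> Hom D X Y"

lemma arr_ob: "arr f X Y \<Longrightarrow> X \<in> Ob D" "arr f X Y \<Longrightarrow> Y \<in> Ob D"
  by (auto simp: arr_def)

lemma arr_comp: "arr f X Y \<Longrightarrow> arr g Y Z \<Longrightarrow> arr (g \<cdot> f) X Z"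
  using comp_hom by (auto simp: arr_def)

lemma arr_id: "X \<in> Ob D \<Longrightarrow> arr (Id D X) X X"
  by (simp add: arr_def id_hom)

lemma arr_zero: "X \<in> Ob D \<Longrightarrow> Y \<in> Ob D \<Longrightarrow> arr 0 X Y"
  using hom_subspace vs.subspace_0 by (simp add: arr_def)

lemma arr_add: "arr f X Y \<Longrightarrow> arr g X Y \<Longrightarrow> arr (f + g) X Y"
  using hom_subspace vs.subspace_add by (auto simp: arr_def)

lemma arr_diff: "arr f X Y \<Longrightarrow> arr g X Y \<Longrightarrow> arr (f - g) X Y"
  using hom_subspace vs.subspace_diff by (auto simp: arr_def)

lemma arr_uminus: "arr f X Y \<Longrightarrow> arr (- f) X Y"
  using hom_subspace vs.subspace_neg by (auto simp: arr_def)

lemma arr_scale: "arr f X Y \<Longrightarrow> arr (Scale D c f) X Y"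
  using hom_subspace vs.subspace_scale by (auto simp: arr_def)

lemma arr_shift: "arr f X Y \<Longrightarrow> arr (ShM D n f) (Sh D n X) (Sh D n Y)"
  using shm_hom sh_ob by (auto simp: arr_def)

lemma assoc: "arr f W X \<Longrightarrow> arr g X Y \<Longrightarrow> arr h Y Z \<Longrightarrow> (h \<cdot> g) \<cdot> f = h \<cdot> (g \<cdot> f)"
  using comp_assoc by (auto simp: arr_def)

lemma id_left: "arr f X Y \<Longrightarrow> Id D Y \<cdot> f = f"
  using comp_id_left by (auto simp: arr_def)

lemma id_right: "arr f X Y \<Longrightarrow> f \<cdot> Id D X = f"
  using comp_id_right by (auto simp: arr_def)

lemma comp_add_right: "arr g Y Z \<Longrightarrow> arr f X Y \<Longrightarrow> arr f' X Y \<Longrightarrow> g \<cdot> (f + f') = g \<cdot> f + g \<cdot> f'"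
  using comp_linear_right[of X Y Z g] by (auto simp: arr_def klinear_on_def)

lemma comp_add_left: "arr f X Y \<Longrightarrow> arr g Y Z \<Longrightarrow> arr g' Y Z \<Longrightarrow> (g + g') \<cdot> f = g \<cdot> f + g' \<cdot> f"
  using comp_linear_left[of X Y Z f] by (auto simp: arr_def klinear_on_def)

lemma comp_scale_right: "arr g Y Z \<Longrightarrow> arr f X Y \<Longrightarrow> g \<cdot> Scale D c f = Scale D c (g \<cdot> f)"
  using comp_linear_right[of X Y Z g] by (auto simp: arr_def klinear_on_def)

lemma comp_scale_left: "arr f X Y \<Longrightarrow> arr g Y Z \<Longrightarrow> Scale D c g \<cdot> f = Scale D c (g \<cdot> f)"
  using comp_linear_left[of X Y Z f] by (auto simp: arr_def klinear_on_def)

lemma comp_zero_right: "arr g Y Z \<Longrightarrow> g \<cdot> 0 = 0"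
  using comp_scale_right[of g Y Z 0 Y 0] arr_zero[of Y Y] by (simp add: arr_ob)

lemma comp_zero_left: "arr f X Y \<Longrightarrow> 0 \<cdot> f = 0"
  using comp_scale_left[of f X Y 0 Y 0] arr_zero[of Y Y] by (simp add: arr_ob)

lemma comp_uminus_right: "arr g Y Z \<Longrightarrow> arr f X Y \<Longrightarrow> g \<cdot> (- f) = - (g \<cdot> f)"
  using comp_scale_right[of g Y Z f X "-1"] by simp

lemma comp_uminus_left: "arr f X Y \<Longrightarrow> arr g Y Z \<Longrightarrow> (- g) \<cdot> f = - (g \<cdot> f)"
  using comp_scale_left[of f X Y g Z "-1"] by simp

lemma comp_diff_right: "arr g Y Z \<Longrightarrow> arr f X Y \<Longrightarrow> arr f' X Y \<Longrightarrow> g \<cdot> (f - f') = g \<cdot> f - g \<cdot> f'"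
  using comp_add_right[of g Y Z f X "- f'"] by (simp add: comp_uminus_right arr_uminus)

lemma comp_diff_left: "arr f X Y \<Longrightarrow> arr g Y Z \<Longrightarrow> arr g' Y Z \<Longrightarrow> (g - g') \<cdot> f = g \<cdot> f - g' \<cdot> f"
  using comp_add_left[of f X Y g Z "- g'"] by (simp add: comp_uminus_left arr_uminus)

lemma shift_comp: "arr f X Y \<Longrightarrow> arr g Y Z \<Longrightarrow> ShM D n (g \<cdot> f) = ShM D n g \<cdot> ShM D n f"
  using shm_comp by (auto simp: arr_def)

lemma shift_add: "arr f X Y \<Longrightarrow> arr g X Y \<Longrightarrow> ShM D n (f + g) = ShM D n f + ShM D n g"
  using shm_linear[of X Y n] by (auto simp: arr_def klinear_on_def)

lemma shift_scale: "arr f X Y \<Longrightarrow> ShM D n (Scale D c f) = Scale D c (ShM D n f)"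
  using shm_linear[of X Y n] by (auto simp: arr_def klinear_on_def)

lemma shift_zero: "X \<in> Ob D \<Longrightarrow> ShM D n 0 = 0"
  using shift_scale[of 0 X X n 0] arr_zero[of X X] by simp

lemma shift_uminus: "arr f X Y \<Longrightarrow> ShM D n (- f) = - ShM D n f"
  using shift_scale[of f X Y n "-1"] by simp

lemma shift_shift: "arr f X Y \<Longrightarrow> ShM D m (ShM D n f) = ShM D (m + n) f"
  using shm_add by (auto simp: arr_def)

lemma sh_sh: "X \<in> Ob D \<Longrightarrow> Sh D m (Sh D n X) = Sh D (m + n) X"
  by (simp add: sh_add)

lemma shift_0: "arr f X Y \<Longrightarrow> ShM D 0 f = f"
  using shm_zero by (auto simp: arr_def)

lemma shift_cancel: "arr f X Y \<Longrightarrow> ShM D (- n) (ShM D n f) = f" "arr f X Y \<Longrightarrow> ShM D n (ShM D (- n) f) = f"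
  by (simp_all add: shift_shift shift_0)

lemma shift_inj: "arr f X Y \<Longrightarrow> arr g X' Y' \<Longrightarrow> ShM D n f = ShM D n g \<Longrightarrow> f = g"
  by (metis shift_cancel(1))

lemma arr_unshift:
  assumes "arr f (Sh D n X) (Sh D n Y)" "X \<in> Ob D" "Y \<in> Ob D"
  shows "arr (ShM D (- n) f) X Y"
  using arr_shift[OF assms(1), of "- n"] assms by (simp add: sh_sh sh_zero)

lemma dist_arr:
  assumes "Dist D X Y Z f g h"
  shows "arr f X Y" "arr g Y Z" "arr h Z (Sh D 1 X)"
  using dist_typed[OF assms] by (auto simp: arr_def sh_ob)

subsection \<open>Isomorphisms and retracts\<close>

definition iso :: "'o \<Rightarrow> 'o \<Rightarrow> bool" where
  "iso X Y \<longleftrightarrow> (\<exists>f g. arr f X Y \<and> arr g Y X \<and> g \<cdot> f = Id D X \<and> f \<cdot> g = Id D Y)"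

definition retr :: "'o \<Rightarrow> 'o \<Rightarrow> bool" where
  "retr X Y \<longleftrightarrow> (\<exists>f g. arr f X Y \<and> arr g Y X \<and> g \<cdot> f = Id D X)"

lemma is_iso_arr:
  assumes "X \<in> Ob D" "Y \<in> Ob D"
  shows "is_iso D X Y f \<longleftrightarrow> arr f X Y \<and> (\<exists>g. arr g Y X \<and> g \<cdot> f = Id D X \<and> f \<cdot> g = Id D Y)"
  using assms by (auto simp: is_iso_def arr_def)

lemma isoI: "X \<in> Ob D \<Longrightarrow> Y \<in> Ob D \<Longrightarrow> is_iso D X Y f \<Longrightarrow> iso X Y"
  by (auto simp: is_iso_arr iso_def)

lemma iso_ob: "iso X Y \<Longrightarrow> X \<in> Ob D" "iso X Y \<Longrightarrow> Y \<in> Ob D"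
  by (auto simp: iso_def arr_def)

lemma retr_ob: "retr X Y \<Longrightarrow> X \<in> Ob D" "retr X Y \<Longrightarrow> Y \<in> Ob D"
  by (auto simp: retr_def arr_def)

lemma iso_refl: "X \<in> Ob D \<Longrightarrow> iso X X"
  using arr_id id_left unfolding iso_def by blast

lemma iso_sym: "iso X Y \<Longrightarrow> iso Y X"
  by (auto simp: iso_def)

lemma iso_retr: "iso X Y \<Longrightarrow> retr X Y"
  by (auto simp: iso_def retr_def)

lemma retr_refl: "X \<in> Ob D \<Longrightarrow> retr X X"
  by (simp add: iso_refl iso_retr)

lemma comp_inverse:
  assumes "arr f X Y" "arr g Y X" "g \<cdot> f = Id D X"
    and "arr f' Y Z" "arr g' Z Y" "g' \<cdot> f' = Id D Y"
  shows "(g \<cdot> g') \<cdot> (f' \<cdot> f) = Id D X"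
proof -
  have "(g \<cdot> g') \<cdot> (f' \<cdot> f) = g \<cdot> (g' \<cdot> (f' \<cdot> f))"
    using assms by (meson arr_comp assoc)
  also have "g' \<cdot> (f' \<cdot> f) = f"
    using assms by (metis assoc id_left)
  finally show ?thesis using assms by simp
qed

lemma retr_trans: "retr X Y \<Longrightarrow> retr Y Z \<Longrightarrow> retr X Z"
  unfolding retr_def by (elim exE conjE) (intro exI conjI, erule (1) arr_comp, erule (1) arr_comp, rule comp_inverse)

lemma iso_trans: "iso X Y \<Longrightarrow> iso Y Z \<Longrightarrow> iso X Z"
  unfolding iso_def by (elim exE conjE) (intro exI conjI, erule (1) arr_comp, erule (1) arr_comp, (rule comp_inverse; assumption)+)

lemma retr_shift: "retr X Y \<Longrightarrow> retr (Sh D n X) (Sh D n Y)"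
  unfolding retr_def using arr_shift shift_comp shm_id arr_ob by metis

lemma iso_shift: "iso X Y \<Longrightarrow> iso (Sh D n X) (Sh D n Y)"
  unfolding iso_def using arr_shift shift_comp shm_id arr_ob by metis

lemma two_sided_iso:
  assumes f: "arr f X Y" and g: "arr g Y X" "g \<cdot> f = Id D X" and g': "arr g' Y X" "f \<cdot> g' = Id D Y"
  shows "iso X Y"
proof -
  have "g = g'"
    using assoc[OF g'(1) f g(1)] g(2) g'(2) id_left[OF g'(1)] id_right[OF g(1)] by simp
  then show ?thesis using assms unfolding iso_def by blast
qed

lemma zero_ob: "zero_object D Z \<Longrightarrow> Z \<in> Ob D"
  by (simp add: zero_object_def)

lemma zero_arr_to: "zero_object D Z \<Longrightarrow> arr f X Z \<Longrightarrow> f = 0"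
  by (auto simp: zero_object_def arr_def)

lemma zero_arr_from: "zero_object D Z \<Longrightarrow> arr f Z X \<Longrightarrow> f = 0"
  by (auto simp: zero_object_def arr_def)

lemma zero_object_iff: "X \<in> Ob D \<Longrightarrow> zero_object D X \<longleftrightarrow> Id D X = 0"
proof
  assume X: "X \<in> Ob D" and "Id D X = 0"
  then have "f = 0" if "arr f Y X \<or> arr f X Y" for f Y
    using that id_left[of f Y X] id_right[of f X Y] comp_zero_left[of f Y X] comp_zero_right[of f X Y] by auto
  then show "zero_object D X"
    using X arr_zero by (auto simp: zero_object_def arr_def)
next
  assume "X \<in> Ob D" "zero_object D X"
  then show "Id D X = 0" using zero_arr_to arr_id by blast
qed

lemma zero_retr: "zero_object D Y \<Longrightarrow> retr X Y \<Longrightarrow> zero_object D X"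
  unfolding retr_def by (metis zero_object_iff arr_ob(1) comp_zero_left zero_arr_from)

lemma zero_shift: "zero_object D X \<Longrightarrow> zero_object D (Sh D n X)"
  by (metis shift_zero shm_id sh_ob zero_ob zero_object_iff)


subsection \<open>Exact triangles\<close>

text \<open>Complexity depends only on which triangles exist, so the maps and their signs are
  forgotten.\<close>

definition tri :: "'o \<Rightarrow> 'o \<Rightarrow> 'o \<Rightarrow> bool" where
  "tri X Y Z \<longleftrightarrow> (\<exists>f g h. Dist D X Y Z f g h)"

lemma tri_ob: "tri X Y Z \<Longrightarrow> X \<in> Ob D" "tri X Y Z \<Longrightarrow> Y \<in> Ob D" "tri X Y Z \<Longrightarrow> Z \<in> Ob D"
  unfolding tri_def using dist_typed by blast+

lemma dist_rotate: "Dist D X Y Z f g h \<Longrightarrow> Dist D Y Z (Sh D 1 X) g h (- ShM D 1 f)"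
  using TR2 dist_typed by blast

lemma dist_rotate_back:
  assumes "Dist D X Y Z f g h"
  shows "Dist D (Sh D (- 1) Z) X Y (- ShM D (- 1) h) f g"
proof -
  note arrs = dist_arr[OF assms]
  have h: "arr (ShM D (- 1) h) (Sh D (- 1) Z) X"
    using arr_shift[OF arrs(3), of "- 1"] arrs by (simp add: sh_sh arr_ob sh_zero)
  have Z: "Sh D 1 (Sh D (- 1) Z) = Z"
    using arrs by (simp add: sh_sh arr_ob sh_zero)
  have eq: "- ShM D 1 (- ShM D (- 1) h) = h"
    by (simp add: shift_uminus[OF h] shift_cancel[OF arrs(3)])
  show ?thesis
    using TR2[of "Sh D (- 1) Z" X Y "- ShM D (- 1) h" f g] assms arr_uminus[OF h] arrs
    unfolding Z eq by (simp add: arr_def Z)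
qed

lemma tri_rotate: "tri X Y Z \<Longrightarrow> tri Y Z (Sh D 1 X)"
  unfolding tri_def using dist_rotate by blast

lemma tri_rotate_back: "tri X Y Z \<Longrightarrow> tri (Sh D (- 1) Z) X Y"
  unfolding tri_def using dist_rotate_back by blast

text \<open>Three rotations shift a triangle by one; the signs they put on the maps are invisible to
  \<open>tri\<close>.\<close>

lemma tri_shift: "tri X Y Z \<Longrightarrow> tri (Sh D n X) (Sh D n Y) (Sh D n Z)"
proof (induction n rule: int_induct[where k = 0])
  case base
  then show ?case using tri_ob by (simp add: sh_zero)
next
  case (step1 i)
  then have "tri (Sh D 1 (Sh D i X)) (Sh D 1 (Sh D i Y)) (Sh D 1 (Sh D i Z))"
    by (blast intro: tri_rotate)
  then show ?case using step1 tri_ob by (simp add: sh_sh add.commute)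
next
  case (step2 i)
  then have "tri (Sh D (-1) (Sh D i X)) (Sh D (-1) (Sh D i Y)) (Sh D (-1) (Sh D i Z))"
    by (blast intro: tri_rotate_back)
  then show ?case using step2 tri_ob by (simp add: sh_sh)
qed

lemma dist_map:
  assumes "Dist D X Y Z f g h" "Dist D X' Y' Z' f' g' h'"
    and "arr a X X'" "arr b Y Y'" "b \<cdot> f = f' \<cdot> a"
  obtains c where "arr c Z Z'" "c \<cdot> g = g' \<cdot> b" "ShM D 1 a \<cdot> h = h' \<cdot> c"
  using TR3[OF assms(1,2) _ _ assms(5)] assms(3,4) dist_arr[OF assms(1)] dist_arr[OF assms(2)]
  unfolding arr_def by auto

lemma dist_zero_right: "X \<in> Ob D \<Longrightarrow> \<exists>Z. zero_object D Z \<and> Dist D X X Z (Id D X) 0 0"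
  using TR1_id zero_object_exists by blast

lemma dist_zero_left:
  assumes "X \<in> Ob D" "zero_object D Z" shows "Dist D Z X X 0 (Id D X) 0"
proof -
  have "Dist D (Sh D (- 1) (Sh D 1 Z)) X X 0 (Id D X) 0"
    using dist_rotate_back[OF TR1_id[OF assms(1) zero_shift[OF assms(2)]]] assms
    by (simp add: shift_zero)
  then show ?thesis using assms by (simp add: sh_sh sh_zero zero_ob)
qed

text \<open>The triangle X = X -> 0 maps to the given one by the identity and f. The third component
  starts at a zero object, and \<open>g f\<close> factors through it.\<close>

lemma dist_comp_zero:
  assumes "Dist D X Y Z f g h" shows "g \<cdot> f = 0" "h \<cdot> g = 0" "ShM D 1 f \<cdot> h = 0"
proof -
  have *: "g \<cdot> f = 0" if T: "Dist D X Y Z f g h" for X Y Z f g h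
  proof -
    note a = dist_arr[OF T]
    obtain O' where O': "Dist D X X O' (Id D X) 0 0"
      using dist_zero_right arr_ob a by blast
    obtain c where "arr c O' Z" "c \<cdot> 0 = g \<cdot> f"
      by (rule dist_map[OF O' T dist_arr(1)[OF O'] a(1) refl])
    then show ?thesis using comp_zero_right[of c O' Z] by simp
  qed
  show "g \<cdot> f = 0" "h \<cdot> g = 0" using * assms dist_rotate by blast+
  have "(- ShM D 1 f) \<cdot> h = 0" using * dist_rotate[OF dist_rotate[OF assms]] dist_rotate[OF assms] by blast
  then show "ShM D 1 f \<cdot> h = 0"
    using comp_uminus_left[of h Z "Sh D 1 X" "ShM D 1 f" "Sh D 1 Y"] dist_arr[OF assms] arr_shift by auto
qed

text \<open>Exactness of Hom(W, -) at Y. TR3 only fills in third components, so W -> 0 -> W[1] is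
  mapped to the rotated triangle Y -> Z -> X[1]; the component W[1] -> X[1] is then shifted
  back.\<close>

lemma dist_lift:
  assumes T: "Dist D X Y Z f g h" and u: "arr u W Y" "g \<cdot> u = 0"
  shows "\<exists>v. arr v W X \<and> u = f \<cdot> v"
proof -
  note a = dist_arr[OF T]
  obtain O' where O': "zero_object D O'" "Dist D W W O' (Id D W) 0 0"
    using dist_zero_right arr_ob u by blast
  have W: "W \<in> Ob D" using u arr_ob by blast
  have X: "X \<in> Ob D" using a arr_ob by blast
  have z: "arr 0 O' Z" using arr_zero[OF zero_ob[OF O'(1)]] a arr_ob by blast
  have sq: "0 \<cdot> 0 = g \<cdot> u" using u comp_zero_right[OF z] by simp
  obtain c where c': "arr c (Sh D 1 W) (Sh D 1 X)"
    and c: "ShM D 1 u \<cdot> (- ShM D 1 (Id D W)) = (- ShM D 1 f) \<cdot> c"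
    by (rule dist_map[OF dist_rotate[OF O'(2)] dist_rotate[OF T] u(1) z sq])
  have "ShM D 1 u = ShM D 1 f \<cdot> c"
    using c comp_uminus_left[OF c' arr_shift[OF a(1)]] W
      comp_uminus_right[OF arr_shift[OF u(1)] arr_id[OF sh_ob[OF W]]] id_right[OF arr_shift[OF u(1), of 1]]
    by (simp add: shm_id)
  also have "\<dots> = ShM D 1 (f \<cdot> ShM D (-1) c)"
    using shift_comp[OF arr_unshift[OF c' W X] a(1), of 1] shift_cancel(2)[OF c', of 1] by simp
  finally have "u = f \<cdot> ShM D (-1) c"
    using shift_inj[OF u(1) arr_comp[OF arr_unshift[OF c' W X] a(1)]] by blast
  then show ?thesis using arr_unshift[OF c' W X] by blast
qed

text \<open>Exactness of Hom(-, W) at Y: the triangle is mapped to 0 -> W = W, and the third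
  component is the extension.\<close>

lemma dist_extend:
  assumes T: "Dist D X Y Z f g h" and u: "arr u Y W" "u \<cdot> f = 0"
  shows "\<exists>v. arr v Z W \<and> u = v \<cdot> g"
proof -
  note a = dist_arr[OF T]
  obtain O' where O': "zero_object D O'" using zero_object_exists by blast
  have W: "W \<in> Ob D" using u arr_ob by blast
  have z: "arr 0 X O'" "arr 0 O' W" using arr_zero O' zero_ob W a arr_ob(1) by blast+
  have sq: "u \<cdot> f = 0 \<cdot> 0" using u comp_zero_right[OF z(2)] by simp
  obtain c where c: "arr c Z W" "c \<cdot> g = Id D W \<cdot> u"
    by (rule dist_map[OF T dist_zero_left[OF W O'] z(1) u(1) sq])
  then show ?thesis using id_left[OF u(1)] by metis
qed

text \<open>Here \<open>k = c - 1\<close> factors through \<open>h\<close> and is killed by \<open>h\<close>, so \<open>k\<^sup>2 = 0\<close>.\<close>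

lemma triangle_endo_iso:
  assumes T: "Dist D X Y Z f g h" and c: "arr c Z Z" "c \<cdot> g = g" "h \<cdot> c = h"
  shows "\<exists>e. arr e Z Z \<and> e \<cdot> c = Id D Z \<and> c \<cdot> e = Id D Z"
proof -
  note a = dist_arr[OF T]
  have Z: "Z \<in> Ob D" "arr (Id D Z) Z Z" using a arr_ob arr_id by blast+
  define k where "k = c - Id D Z"
  have k: "arr k Z Z" unfolding k_def using c Z arr_diff by blast
  have "k \<cdot> g = 0" unfolding k_def using comp_diff_left[OF a(2) c(1) Z(2)] c id_left[OF a(2)] by simp
  then obtain w where w: "arr w (Sh D 1 X) Z" "k = w \<cdot> h"
    using dist_extend[OF dist_rotate[OF T] k] by blast
  have "h \<cdot> k = 0" unfolding k_def using comp_diff_right[OF a(3) c(1) Z(2)] c id_right[OF a(3)] by simp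
  then have kk: "k \<cdot> k = 0"
    using w assoc[OF k a(3) w(1)] comp_zero_right[OF w(1)] by simp
  have ck: "c = Id D Z + k" by (simp add: k_def)
  have e: "arr (Id D Z - k) Z Z" using Z k arr_diff by blast
  have "(Id D Z - k) \<cdot> c = Id D Z"
    unfolding ck using comp_add_right[OF e Z(2) k] id_right[OF e] comp_diff_left[OF k Z(2) k] id_left[OF k] kk
    by simp
  moreover have "c \<cdot> (Id D Z - k) = Id D Z"
    unfolding ck using comp_add_left[OF e Z(2) k] id_left[OF e] comp_diff_right[OF k Z(2) k] id_right[OF k] kk
    by simp
  ultimately show ?thesis using e by blast
qed

text \<open>TR3 yields c and c' independently, so they need not be inverse to each other. Their
  composite still fixes g and h, hence is invertible, and e is the correction.\<close>

lemma cone_maps: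
  assumes T: "Dist D X Y Z f g h" and T': "Dist D X' Y' Z' f' g' h'"
    and a: "arr a X X'" "arr a' X' X" "a' \<cdot> a = Id D X"
    and b: "arr b Y Y'" "arr b' Y' Y" "b' \<cdot> b = Id D Y"
    and c: "arr c Z Z'" "c \<cdot> g = g' \<cdot> b" "ShM D 1 a \<cdot> h = h' \<cdot> c"
    and c': "arr c' Z' Z" "c' \<cdot> g' = g \<cdot> b'" "ShM D 1 a' \<cdot> h' = h \<cdot> c'"
  shows "\<exists>e. arr e Z Z \<and> e \<cdot> (c' \<cdot> c) = Id D Z \<and> (c' \<cdot> c) \<cdot> e = Id D Z"
proof (rule triangle_endo_iso[OF T])
  note t = dist_arr[OF T] and t' = dist_arr[OF T']
  show "arr (c' \<cdot> c) Z Z" using c(1) c'(1) arr_comp by blast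
  have "(c' \<cdot> c) \<cdot> g = c' \<cdot> (g' \<cdot> b)" using assoc[OF t(2) c(1) c'(1)] c by simp
  also have "\<dots> = (g \<cdot> b') \<cdot> b" using assoc[OF b(1) t'(2) c'(1)] c' by simp
  also have "\<dots> = g" using assoc[OF b(1,2) t(2)] b id_right[OF t(2)] by simp
  finally show "(c' \<cdot> c) \<cdot> g = g" .
  have "h \<cdot> (c' \<cdot> c) = (ShM D 1 a' \<cdot> h') \<cdot> c" using assoc[OF c(1) c'(1) t(3)] c' by simp
  also have "\<dots> = ShM D 1 a' \<cdot> (ShM D 1 a \<cdot> h)" using assoc[OF c(1) t'(3) arr_shift[OF a(2)]] c by simp
  also have "\<dots> = ShM D 1 (a' \<cdot> a) \<cdot> h"
    using assoc[OF t(3) arr_shift[OF a(1)] arr_shift[OF a(2)]] shift_comp[OF a(1,2)] by simp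
  also have "\<dots> = h" using a id_left[OF t(3)] shm_id arr_ob by metis
  finally show "h \<cdot> (c' \<cdot> c) = h" .
qed

lemma cone_retr:
  assumes T: "Dist D X Y Z f g h" and T': "Dist D X' Y' Z' f' g' h'"
    and a: "arr a X X'" "arr a' X' X" "a' \<cdot> a = Id D X"
    and b: "arr b Y Y'" "arr b' Y' Y" "b' \<cdot> b = Id D Y"
    and sq: "b \<cdot> f = f' \<cdot> a" "b' \<cdot> f' = f \<cdot> a'"
  shows "retr Z Z'"
proof -
  note t = dist_arr[OF T] and t' = dist_arr[OF T']
  obtain c where c: "arr c Z Z'" "c \<cdot> g = g' \<cdot> b" "ShM D 1 a \<cdot> h = h' \<cdot> c"
    using dist_map[OF T T' a(1) b(1) sq(1)] by blast
  obtain c' where c': "arr c' Z' Z" "c' \<cdot> g' = g \<cdot> b'" "ShM D 1 a' \<cdot> h' = h \<cdot> c'"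
    using dist_map[OF T' T a(2) b(2) sq(2)] by blast
  obtain e where e: "arr e Z Z" "e \<cdot> (c' \<cdot> c) = Id D Z"
    using cone_maps[OF T T' a b c c'] by blast
  then show ?thesis unfolding retr_def using c(1) assoc[OF c(1) c'(1) e(1)] arr_comp[OF c'(1) e(1)] e(2) by auto
qed

lemma cone_iso:
  assumes T: "Dist D X Y Z f g h" and T': "Dist D X' Y' Z' f' g' h'"
    and a: "arr a X X'" "arr a' X' X" "a' \<cdot> a = Id D X" "a \<cdot> a' = Id D X'"
    and b: "arr b Y Y'" "arr b' Y' Y" "b' \<cdot> b = Id D Y" "b \<cdot> b' = Id D Y'"
    and sq: "b \<cdot> f = f' \<cdot> a"
  shows "iso Z Z'"
proof -
  note t = dist_arr[OF T] and t' = dist_arr[OF T']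
  \<comment> \<open>For isomorphisms the reverse square follows from the given one; for retracts, as
    in \<open>cone_retr\<close>, it has to be assumed.\<close>
  have sq': "b' \<cdot> f' = f \<cdot> a'"
  proof -
    have "b' \<cdot> f' = b' \<cdot> (f' \<cdot> (a \<cdot> a'))" using id_right[OF t'(1)] a by simp
    also have "\<dots> = b' \<cdot> ((b \<cdot> f) \<cdot> a')" using assoc[OF a(2,1) t'(1)] sq by simp
    also have "\<dots> = (b' \<cdot> b) \<cdot> (f \<cdot> a')"
      using assoc[OF a(2) t(1) b(1)] assoc[OF arr_comp[OF a(2) t(1)] b(1,2)] by simp
    also have "\<dots> = f \<cdot> a'" using b id_left[OF arr_comp[OF a(2) t(1)]] by simp
    finally show ?thesis .
  qed
  obtain c where c: "arr c Z Z'" "c \<cdot> g = g' \<cdot> b" "ShM D 1 a \<cdot> h = h' \<cdot> c"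
    using dist_map[OF T T' a(1) b(1) sq(1)] by blast
  obtain c' where c': "arr c' Z' Z" "c' \<cdot> g' = g \<cdot> b'" "ShM D 1 a' \<cdot> h' = h \<cdot> c'"
    using dist_map[OF T' T a(2) b(2) sq'] by blast
  obtain e where e: "arr e Z Z" "e \<cdot> (c' \<cdot> c) = Id D Z"
    using cone_maps[OF T T' a(1-3) b(1-3) c c'] by blast
  obtain e' where e': "arr e' Z' Z'" "(c \<cdot> c') \<cdot> e' = Id D Z'"
    using cone_maps[OF T' T a(2,1,4) b(2,1,4) c' c] by blast
  show ?thesis
  proof (rule two_sided_iso[OF c(1)])
    show "arr (e \<cdot> c') Z' Z" "(e \<cdot> c') \<cdot> c = Id D Z"
      using arr_comp[OF c'(1) e(1)] assoc[OF c(1) c'(1) e(1)] e by simp_all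
    show "arr (c' \<cdot> e') Z' Z" "c \<cdot> (c' \<cdot> e') = Id D Z'"
      using arr_comp[OF e'(1) c'(1)] assoc[OF e'(1) c'(1) c(1)] e' by simp_all
  qed
qed

lemma tri_iso:
  assumes "tri X Y Z" "iso X X'" "iso Y Y'" "iso Z Z'" shows "tri X' Y' Z'"
proof -
  obtain f g h where T: "Dist D X Y Z f g h" using assms tri_def by blast
  note t = dist_arr[OF T]
  obtain a a' where a: "arr a X X'" "arr a' X' X" "a' \<cdot> a = Id D X" "a \<cdot> a' = Id D X'"
    using assms iso_def by metis
  obtain b b' where b: "arr b Y Y'" "arr b' Y' Y" "b' \<cdot> b = Id D Y" "b \<cdot> b' = Id D Y'"
    using assms iso_def by metis
  obtain c c' where c: "arr c Z Z'" "arr c' Z' Z" "c' \<cdot> c = Id D Z" "c \<cdot> c' = Id D Z'"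
    using assms iso_def by metis
  let ?f = "(b \<cdot> f) \<cdot> a'" and ?g = "(c \<cdot> g) \<cdot> b'" and ?h = "(ShM D 1 a \<cdot> h) \<cdot> c'"
  have bf: "arr (b \<cdot> f) X Y'" "arr (c \<cdot> g) Y Z'" "arr (ShM D 1 a \<cdot> h) Z (Sh D 1 X')"
    using arr_comp t b c arr_shift[OF a(1)] by blast+
  have fs: "arr ?f X' Y'" "arr ?g Y' Z'" "arr ?h Z' (Sh D 1 X')"
    using bf arr_comp a b c by blast+
  have "?f \<cdot> a = b \<cdot> f" "?g \<cdot> b = c \<cdot> g" "?h \<cdot> c = ShM D 1 a \<cdot> h"
    using assoc[OF a(1,2) bf(1)] assoc[OF b(1,2) bf(2)] assoc[OF c(1,2) bf(3)] a b c id_right bf by auto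
  moreover have "is_iso D X X' a" "is_iso D Y Y' b" "is_iso D Z Z' c"
    using a b c is_iso_arr arr_ob by blast+
  ultimately have "Dist D X' Y' Z' ?f ?g ?h"
    using dist_iso[OF T, of X' Y' Z' ?f ?g ?h a b c] fs by (auto simp: arr_def)
  then show ?thesis unfolding tri_def by blast
qed

text \<open>After rotating back, the triangle starts with 0 -> X and can be compared with 0 -> X =
  X.\<close>

lemma tri_zero_right:
  assumes "tri X Y Z" "zero_object D Z" shows "iso X Y"
proof -
  obtain f g h where T: "Dist D (Sh D (-1) Z) X Y f g h"
    using tri_rotate_back[OF assms(1)] tri_def by blast
  have z: "zero_object D (Sh D (-1) Z)" using assms zero_shift by blast
  have X: "X \<in> Ob D" using assms tri_ob by blast
  have "f = 0" using z dist_arr[OF T] zero_arr_from by blast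
  then have "Dist D (Sh D (-1) Z) X Y 0 g h" using T by simp
  from cone_iso[OF dist_zero_left[OF X z] this arr_id[OF zero_ob[OF z]] arr_id[OF zero_ob[OF z]] _ _
      arr_id[OF X] arr_id[OF X]]
  show ?thesis
    using id_left id_right arr_id X zero_ob[OF z] arr_zero comp_zero_left comp_zero_right by metis
qed

lemma tri_zero_left:
  assumes "zero_object D Z" "X \<in> Ob D" "iso X Y" shows "tri Z X Y"
  using dist_zero_left[OF assms(2,1)] tri_iso assms iso_refl zero_ob unfolding tri_def by blast

subsection \<open>Biproducts\<close>

lemma biproductE:
  assumes "biproduct D X Y P" "X \<in> Ob D" "Y \<in> Ob D"
  obtains i j p q where "arr i X P" "arr j Y P" "arr p P X" "arr q P Y"
    "p \<cdot> i = Id D X" "q \<cdot> j = Id D Y" "p \<cdot> j = 0" "q \<cdot> i = 0" "i \<cdot> p + j \<cdot> q = Id D P"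
  using assms unfolding biproduct_def arr_def by blast

text \<open>A cone C of i is compared with Y. As i is a split monomorphism, the connecting map h
  vanishes, so anything that kills g is zero; this makes the induced map C -> Y invertible, with
  inverse \<open>g j\<close>.\<close>

lemma split_dist:
  assumes i: "arr i X P" and j: "arr j Y P" and p: "arr p P X" and q: "arr q P Y"
    and eqs: "p \<cdot> i = Id D X" "q \<cdot> j = Id D Y" "p \<cdot> j = 0" "q \<cdot> i = 0" "i \<cdot> p + j \<cdot> q = Id D P"
  shows "Dist D X P Y i q 0"
proof -
  obtain C g h where T: "Dist D X P C i g h"
    using TR1_cone i unfolding arr_def by blast
  note t = dist_arr[OF T]
  have gi: "g \<cdot> i = 0" and ih: "ShM D 1 i \<cdot> h = 0" using dist_comp_zero[OF T] by auto
  have "h = ShM D 1 (p \<cdot> i) \<cdot> h"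
    using eqs id_left[OF t(3)] shm_id arr_ob i by metis
  also have "\<dots> = 0"
    using shift_comp[OF i p] assoc[OF t(3) arr_shift[OF i] arr_shift[OF p]] ih
      comp_zero_right[OF arr_shift[OF p]] by simp
  finally have h: "h = 0" .
  obtain c where c: "arr c C Y" "q = c \<cdot> g" using dist_extend[OF T q] eqs by blast
  have cgj: "c \<cdot> (g \<cdot> j) = Id D Y" using assoc[OF j t(2) c(1)] c eqs by simp
  have gj: "arr (g \<cdot> j) Y C" using arr_comp j t by blast
  have gjc: "arr ((g \<cdot> j) \<cdot> c) C C" using arr_comp gj c by blast
  have idC: "arr (Id D C) C C" using arr_id t arr_ob by blast
  have "((g \<cdot> j) \<cdot> c) \<cdot> g = (g \<cdot> j) \<cdot> q" using assoc[OF t(2) c(1) gj] c by simp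
  also have "\<dots> = g \<cdot> (j \<cdot> q)" using assoc[OF q j t(2)] .
  also have "\<dots> = g \<cdot> (i \<cdot> p + j \<cdot> q)"
    using comp_add_right[OF t(2) arr_comp[OF p i] arr_comp[OF q j]] assoc[OF p i t(2)] gi
      comp_zero_left[OF p] by simp
  also have "\<dots> = g" using eqs id_right[OF t(2)] by simp
  \<comment> \<open>An arrow out of C that kills g factors through h, which is 0.\<close>
  finally have "((g \<cdot> j) \<cdot> c - Id D C) \<cdot> g = 0"
    using comp_diff_left[OF t(2) gjc idC] id_left[OF t(2)] by simp
  then obtain w where "arr w (Sh D 1 X) C" "(g \<cdot> j) \<cdot> c - Id D C = w \<cdot> h"
    using dist_extend[OF dist_rotate[OF T] arr_diff[OF gjc idC]] by blast
  then have gjc_id: "(g \<cdot> j) \<cdot> c = Id D C" using h comp_zero_right by fastforce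
  have X: "X \<in> Ob D" "P \<in> Ob D" "C \<in> Ob D" "Y \<in> Ob D" using i t j arr_ob by blast+
  have isos: "is_iso D X X (Id D X)" "is_iso D P P (Id D P)" "is_iso D C Y c"
    using X arr_id id_left is_iso_arr c gj gjc_id cgj by metis+
  have eqs': "Id D P \<cdot> i = i \<cdot> Id D X" "c \<cdot> g = q \<cdot> Id D P" "ShM D 1 (Id D X) \<cdot> h = 0 \<cdot> c"
    using id_left id_right i q c h comp_zero_left comp_zero_right[OF arr_shift[OF arr_id[OF X(1)]]] by metis+
  have "0 \<in> Hom D Y (Sh D 1 X)" using arr_zero X sh_ob arr_def by blast
  then show ?thesis
    using dist_iso[OF T X(1,2,4) _ _ _ isos eqs'] i q by (auto simp: arr_def)
qed

lemma biproduct_tri: "biproduct D X Y P \<Longrightarrow> X \<in> Ob D \<Longrightarrow> Y \<in> Ob D \<Longrightarrow> tri X P Y"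
  unfolding tri_def by (metis biproductE split_dist)

lemma biproduct_retr: "biproduct D X Y P \<Longrightarrow> X \<in> Ob D \<Longrightarrow> Y \<in> Ob D \<Longrightarrow> retr X P"
  unfolding retr_def by (metis biproductE)

text \<open>Retracts split in a triangulated category: the complement is the cone of the section i,
  whose connecting map vanishes. This matches \<open>retr\<close> with the direct summands in the
  definition of complexity.\<close>

lemma retr_biproduct:
  assumes "retr X P" shows "\<exists>Y\<in>Ob D. biproduct D X Y P"
proof -
  obtain i p where i: "arr i X P" and p: "arr p P X" and pi: "p \<cdot> i = Id D X"
    using assms retr_def by metis
  obtain Y q h where T: "Dist D X P Y i q h"
    using TR1_cone i unfolding arr_def by blast
  note t = dist_arr[OF T]
  have qi: "q \<cdot> i = 0" and ih: "ShM D 1 i \<cdot> h = 0" using dist_comp_zero[OF T] by auto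
  have "h = ShM D 1 (p \<cdot> i) \<cdot> h"
    using pi id_left[OF t(3)] shm_id arr_ob i by metis
  also have "\<dots> = 0"
    using shift_comp[OF i p] assoc[OF t(3) arr_shift[OF i] arr_shift[OF p]] ih
      comp_zero_right[OF arr_shift[OF p]] by simp
  finally have h: "h = 0" .
  have Y: "Y \<in> Ob D" "P \<in> Ob D" using t arr_ob by blast+
  obtain k where k: "arr k Y P" "Id D Y = q \<cdot> k"
    using dist_lift[OF dist_rotate[OF T] arr_id[OF Y(1)]] h
      comp_zero_left[OF arr_id[OF Y(1)]] by blast
  \<comment> \<open>k is a section of q; subtracting its component along i makes it orthogonal to p
    without changing \<open>q k\<close>.\<close>
  define j where "j = k - i \<cdot> (p \<cdot> k)"
  have pk: "arr (p \<cdot> k) Y X" and ipk: "arr (i \<cdot> (p \<cdot> k)) Y P" using arr_comp i p k by blast+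
  have j: "arr j Y P" unfolding j_def using k ipk arr_diff by blast
  have pj: "p \<cdot> j = 0"
    unfolding j_def using comp_diff_right[OF p k(1) ipk] assoc[OF pk i p] pi id_left[OF pk] by simp
  have qj: "q \<cdot> j = Id D Y"
    unfolding j_def using comp_diff_right[OF t(2) k(1) ipk] assoc[OF pk i t(2)] qi comp_zero_left[OF pk] k by simp
  have ip: "arr (i \<cdot> p) P P" and jq: "arr (j \<cdot> q) P P" using arr_comp i p j t by blast+
  \<comment> \<open>The defect s is killed by q, so it factors through i; it is also killed by p, so
    that factor is zero.\<close>
  define s where "s = Id D P - (i \<cdot> p + j \<cdot> q)"
  have idP: "arr (Id D P) P P" using arr_id Y by blast
  have s: "arr s P P" unfolding s_def using idP ip jq arr_diff arr_add by blast
  have "q \<cdot> s = 0"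
    unfolding s_def using comp_diff_right[OF t(2) idP arr_add[OF ip jq]] comp_add_right[OF t(2) ip jq]
      id_right[OF t(2)] assoc[OF p i t(2)] assoc[OF t(2) j t(2)] qi qj comp_zero_left[OF p] id_left[OF t(2)]
    by simp
  then obtain w where w: "arr w P X" "s = i \<cdot> w" using dist_lift[OF T s] by blast
  have "w = p \<cdot> s" using w assoc[OF w(1) i p] pi id_left[OF w(1)] by simp
  also have "\<dots> = 0"
    unfolding s_def using comp_diff_right[OF p idP arr_add[OF ip jq]] comp_add_right[OF p ip jq]
      id_right[OF p] assoc[OF p i p] assoc[OF t(2) j p] pi pj comp_zero_left[OF t(2)] id_left[OF p]
    by simp
  finally have "s = 0" using w comp_zero_right i by metis
  then have "i \<cdot> p + j \<cdot> q = Id D P" by (simp add: s_def)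
  then have "biproduct D X Y P"
    unfolding biproduct_def using i j p t pi qj pj qi Y unfolding arr_def by blast
  then show ?thesis using Y by blast
qed

text \<open>Y' is the fibre of the composite Y -> Z -> W. This is the step that moves the last layer
  of a tower on Z to a last layer on Y.\<close>

lemma octahedron:
  assumes "tri X Y Z" "tri Z' Z W"
  shows "\<exists>Y'. tri X Y' Z' \<and> tri Y' Y W"
proof -
  obtain f g h where T: "Dist D X Y Z f g h" using assms tri_def by blast
  obtain a b c where U: "Dist D Z' Z W a b c" using assms tri_def by blast
  note t = dist_arr[OF T] and u = dist_arr[OF U]
  have gb: "arr (b \<cdot> g) Y W" using t u arr_comp by blast
  obtain Q m n where Q: "Dist D Y W Q (b \<cdot> g) m n"
    using TR1_cone gb unfolding arr_def by blast
  have "tri (Sh D 1 X) Q (Sh D 1 Z')"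
    using TR4[OF dist_rotate[OF T] dist_rotate[OF U] Q] unfolding tri_def by blast
  from tri_shift[OF this, of "-1"] have "tri X (Sh D (-1) Q) Z'"
    using t u arr_ob by (simp add: sh_sh sh_zero)
  moreover have "tri (Sh D (-1) Q) Y W"
    using Q tri_rotate_back tri_def by blast
  ultimately show ?thesis by blast
qed

text \<open>The middle term Y' is the cone of B[-1] -> Z[-1] -> X -> A. Both squares with the
  connecting map of the original triangle commute, so Y is a retract of it.\<close>

lemma tri_retr:
  assumes X: "retr X A" and Z: "retr Z B" and T: "tri X Y Z"
  shows "\<exists>Y'. tri A Y' B \<and> retr Y Y'"
proof -
  obtain f g h where T: "Dist D (Sh D (-1) Z) X Y f g h"
    using tri_rotate_back[OF T] tri_def by blast
  note t = dist_arr[OF T]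
  obtain i p where i: "arr i X A" "arr p A X" "p \<cdot> i = Id D X" using X retr_def by metis
  obtain j q where j: "arr j (Sh D (-1) Z) (Sh D (-1) B)" "arr q (Sh D (-1) B) (Sh D (-1) Z)" 
    "q \<cdot> j = Id D (Sh D (-1) Z)" using retr_shift[OF Z] retr_def by metis
  have fq: "arr (f \<cdot> q) (Sh D (-1) B) X" using j t arr_comp by blast
  have "arr (i \<cdot> (f \<cdot> q)) (Sh D (-1) B) A" using i fq arr_comp by blast
  then obtain Y' g' h' where T': "Dist D (Sh D (-1) B) A Y' (i \<cdot> (f \<cdot> q)) g' h'"
    using TR1_cone unfolding arr_def by blast
  have "(i \<cdot> (f \<cdot> q)) \<cdot> j = i \<cdot> f"
    using assoc[OF j(1) fq i(1)] assoc[OF j(1,2) t(1)] j id_right[OF t(1)] by simp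
  moreover have "p \<cdot> (i \<cdot> (f \<cdot> q)) = f \<cdot> q"
    using assoc[OF fq i(1,2)] i id_left[OF fq] by simp
  ultimately have "retr Y Y'" using cone_retr[OF T T' j i] by simp
  moreover have "tri A Y' B"
    using tri_rotate[of "Sh D (-1) B" A Y'] T' retr_ob[OF Z] tri_def by (auto simp: sh_sh sh_zero)
  ultimately show ?thesis by blast
qed

end

section \<open>Complexity\<close>

text \<open>The factor a may be 0: it will be a complexity, for which only nonnegativity is known
  without finite type.\<close>

lemma le_mult_cInf:
  fixes a c :: real
  assumes "S \<noteq> {}" "0 \<le> a" "\<And>x. x \<in> S \<Longrightarrow> c \<le> a * x"
  shows "c \<le> a * Inf S"
proof (cases "a = 0")
  case True
  then show ?thesis using assms by auto
next
  case False
  then have "c / a \<le> Inf S"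
    using assms by (intro cInf_greatest) (auto simp: field_simps)
  then show ?thesis using False assms by (simp add: field_simps)
qed

definition cost :: "real \<Rightarrow> int list \<Rightarrow> real" where
  "cost t ns = (\<Sum>n\<leftarrow>ns. exp (real_of_int n * t))"

lemma cost_simps [simp]: "cost t [] = 0" "cost t (ns @ ms) = cost t ns + cost t ms"
  "cost t [n] = exp (real_of_int n * t)"
  by (simp_all add: cost_def)

lemma cost_nonneg: "0 \<le> cost t ns"
  unfolding cost_def by (intro sum_list_nonneg) auto

lemma cost_shift: "cost t (map (\<lambda>n. n + m) ns) = exp (real_of_int m * t) * cost t ns"
  by (induction ns) (auto simp: cost_def algebra_simps exp_add)

lemma exp_le_cost: "n \<in> set ns \<Longrightarrow> exp (real_of_int n * t) \<le> cost t ns"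
  unfolding cost_def by (rule member_le_sum_list) auto

section \<open>Towers as an inductive predicate, and objects reached up to retracts\<close>

context tricat
begin

text \<open>The intermediate objects of a \<open>tower\<close> are forgotten, so towers can be
  extended and spliced by rule induction.\<close>

inductive built :: "'o \<Rightarrow> int list \<Rightarrow> 'o \<Rightarrow> bool" for E where
  nil: "zero_object D X \<Longrightarrow> built E [] X"
| snoc: "built E ns X \<Longrightarrow> tri X Y (Sh D n E) \<Longrightarrow> built E (ns @ [n]) Y"

lemma tower_iff:
  "tower D E ns A \<longleftrightarrow> zero_object D (A 0) \<and> (\<forall>i<length ns. tri (A i) (A (Suc i)) (Sh D (ns ! i) E))"
  by (simp add: tower_def tri_def)

lemma tower_append:
  "tower D E (ns @ [n]) A \<longleftrightarrow> tower D E ns A \<and> tri (A (length ns)) (A (Suc (length ns))) (Sh D n E)"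
  by (auto simp: tower_iff nth_append less_Suc_eq)

lemma tower_imp_built: "tower D E ns A \<Longrightarrow> built E ns (A (length ns))"
proof (induction ns rule: rev_induct)
  case Nil
  then show ?case by (auto simp: tower_def intro: built.nil)
next
  case (snoc n ns)
  then show ?case using built.snoc by (simp add: tower_append)
qed

lemma built_imp_tower: "built E ns X \<Longrightarrow> \<exists>A. tower D E ns A \<and> A (length ns) = X"
proof (induction rule: built.induct)
  case (nil X)
  then show ?case by (intro exI[of _ "\<lambda>_. X"]) (simp add: tower_def)
next
  case (snoc ns X Y n)
  then obtain A where A: "tower D E ns A" "A (length ns) = X" by blast
  have "tower D E ns (A(Suc (length ns) := Y))"
    using A(1) by (simp add: tower_iff)
  then have "tower D E (ns @ [n]) (A(Suc (length ns) := Y))"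
    using A(2) snoc(2) by (simp add: tower_append)
  moreover have "(A(Suc (length ns) := Y)) (length (ns @ [n])) = Y" by simp
  ultimately show ?case by blast
qed

lemma built_ob: "built E ns X \<Longrightarrow> X \<in> Ob D"
  by (induction rule: built.induct) (auto simp: zero_ob tri_ob)

lemma built_iso: "built E ns X \<Longrightarrow> iso X Y \<Longrightarrow> built E ns Y"
proof (induction rule: built.induct)
  case (nil X)
  then show ?case using zero_retr iso_retr iso_sym built.nil by blast
next
  case (snoc ns X Y' n)
  have "tri X Y (Sh D n E)"
    using tri_iso[OF snoc(2) iso_refl snoc(4) iso_refl] tri_ob[OF snoc(2)] by blast
  then show ?case using snoc(1) built.snoc by blast
qed

text \<open>Induction on the tower of Z: the octahedron detaches its last layer and reattaches it on
  top of an object Y' that is built from X and the shorter tower.\<close>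

lemma built_append:
  "built E ms Z \<Longrightarrow> built E ns X \<Longrightarrow> tri X Y Z \<Longrightarrow> built E (ns @ ms) Y"
proof (induction arbitrary: Y rule: built.induct)
  case (nil Z)
  then show ?case using tri_zero_right built_iso by fastforce
next
  case (snoc ms Z' Z m)
  then obtain Y' where "tri X Y' Z'" "tri Y' Y (Sh D m E)" using octahedron by blast
  then show ?case using snoc built.snoc by (metis append.assoc)
qed

lemma built_shift:
  assumes "E \<in> Ob D"
  shows "built E ns X \<Longrightarrow> built E (map (\<lambda>n. n + m) ns) (Sh D m X)"
proof (induction rule: built.induct)
  case (nil X)
  then show ?case using zero_shift built.nil by simp
next
  case (snoc ns X Y n)
  then show ?case
    using tri_shift[OF snoc(2), of m] built.snoc assms by (simp add: sh_sh add.commute)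
qed

lemma built_single:
  assumes "E \<in> Ob D" shows "built E [n] (Sh D n E)"
proof -
  obtain Z where Z: "zero_object D Z" using zero_object_exists by blast
  have "tri Z (Sh D n E) (Sh D n E)" using tri_zero_left Z assms sh_ob iso_refl by blast
  then show ?thesis using built.snoc[OF built.nil[OF Z]] by fastforce
qed

text \<open>Retracts are easier to extend along triangles than direct summands; by \<open>retr_biproduct\<close> they agree.\<close>

definition reach :: "'o \<Rightarrow> int list \<Rightarrow> 'o \<Rightarrow> bool" where
  "reach G ns X \<longleftrightarrow> (\<exists>A. built G ns A \<and> retr X A)"

lemma built_reach: "built G ns X \<Longrightarrow> reach G ns X"
  using built_ob retr_refl reach_def by blast

lemma reach_ob: "reach G ns X \<Longrightarrow> X \<in> Ob D"
  using reach_def retr_ob by blast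

lemma reach_retr: "reach G ns Y \<Longrightarrow> retr X Y \<Longrightarrow> reach G ns X"
  unfolding reach_def using retr_trans by blast

lemma reach_self: "G \<in> Ob D \<Longrightarrow> reach G [0] G"
  using built_reach[OF built_single[of G 0]] by (simp add: sh_zero)

lemma reach_shift: "G \<in> Ob D \<Longrightarrow> reach G ns X \<Longrightarrow> reach G (map (\<lambda>n. n + m) ns) (Sh D m X)"
  unfolding reach_def using built_shift retr_shift by blast

lemma reach_tri: "reach G ns X \<Longrightarrow> reach G ms Z \<Longrightarrow> tri X Y Z \<Longrightarrow> reach G (ns @ ms) Y"
  unfolding reach_def
proof (elim exE conjE)
  fix A B assume "built G ns A" "retr X A" "built G ms B" "retr Z B" "tri X Y Z"
  moreover from this obtain Y' where "tri A Y' B" "retr Y Y'" using tri_retr by blast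
  ultimately show "\<exists>A. built G (ns @ ms) A \<and> retr Y A" using built_append by blast
qed

lemma reach_zero: "zero_object D X \<Longrightarrow> reach G [] X"
  using built_reach built.nil by blast

text \<open>Each layer F[n] is replaced by a copy of the tower for F shifted by n, whose cost is
  that of F times \<open>exp (n t)\<close>. The result is a \<open>reach\<close> because F itself is
  only a retract.\<close>

lemma reach_built:
  assumes "G \<in> Ob D" "reach G ns F"
  shows "built F ms X \<Longrightarrow> \<exists>ks. reach G ks X \<and> cost t ks = cost t ns * cost t ms"
proof (induction rule: built.induct)
  case (nil X)
  then show ?case using reach_zero by fastforce
next
  case (snoc ms X Y n)
  then obtain ks where ks: "reach G ks X" "cost t ks = cost t ns * cost t ms" by blast
  have "reach G (ks @ map (\<lambda>k. k + n) ns) Y"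
    using reach_tri[OF ks(1) reach_shift[OF assms] snoc(2)] .
  moreover have "cost t (ks @ map (\<lambda>k. k + n) ns) = cost t ns * cost t (ms @ [n])"
    using ks by (simp add: cost_shift algebra_simps)
  ultimately show ?case by blast
qed

lemma reach_trans:
  assumes "G \<in> Ob D" "reach G ns F" "reach F ms X"
  shows "\<exists>ks. reach G ks X \<and> cost t ks = cost t ns * cost t ms"
  using reach_built[OF assms(1,2)] assms(3) reach_retr unfolding reach_def[of F] by blast

section \<open>Complexity as a real number and its inequalities\<close>

definition gens :: "'o \<Rightarrow> 'o \<Rightarrow> bool" where
  "gens G X \<longleftrightarrow> G \<in> Ob D \<and> (\<exists>ns. reach G ns X)"

text \<open>Zero objects receive the value 0 automatically, through the empty tower. Under
  \<open>gens\<close> the infimum is over a nonempty set bounded below, so it is a genuine real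
  infimum.\<close>

definition cx :: "real \<Rightarrow> 'o \<Rightarrow> 'o \<Rightarrow> real" where
  "cx t G X = Inf {cost t ns | ns. reach G ns X}"

lemma complexity_eq:
  assumes "gens G X" shows "complexity D t G X = ereal (cx t G X)"
proof -
  let ?S = "{cost t ns | ns. reach G ns X}"
  have X: "X \<in> Ob D" using assms gens_def reach_ob by blast
  have ne: "?S \<noteq> {}" using assms gens_def by auto
  have bdd: "bdd_below ?S" using cost_nonneg by (intro bdd_belowI[of _ 0]) auto
  show ?thesis
  proof (cases "zero_object D X")
    case True
    then have "0 \<in> ?S" using reach_zero[OF True, of G] by (auto intro!: exI[of _ "[]"])
    then have "Inf ?S = 0"
      using cost_nonneg by (intro cInf_eq_minimum) auto
    then show ?thesis using True by (simp add: complexity_def cx_def zero_ereal_def)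
  next
    case False
    have "(\<exists>A. \<exists>F'\<in>Ob D. tower D G ns A \<and> biproduct D X F' (A (length ns))) \<longleftrightarrow> reach G ns X" for ns
      unfolding reach_def using tower_imp_built built_imp_tower retr_biproduct biproduct_retr X by metis
    then have "complexity D t G X = Inf (ereal ` ?S)"
      using False unfolding complexity_def cost_def by (auto intro!: arg_cong[of _ _ Inf])
    then show ?thesis using ereal_Inf'[OF bdd ne] by (simp add: cx_def)
  qed
qed

lemma cx_le: "reach G ns X \<Longrightarrow> cx t G X \<le> cost t ns"
  unfolding cx_def using cost_nonneg by (intro cInf_lower bdd_belowI[of _ 0]) auto

lemma cx_greatest:
  "gens G X \<Longrightarrow> (\<And>ns. reach G ns X \<Longrightarrow> c \<le> cost t ns) \<Longrightarrow> c \<le> cx t G X"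
  unfolding cx_def gens_def by (intro cInf_greatest) auto

lemma cx_mult_greatest:
  assumes "gens G X" "0 \<le> a" "\<And>ns. reach G ns X \<Longrightarrow> c \<le> a * cost t ns"
  shows "c \<le> a * cx t G X"
  unfolding cx_def using assms unfolding gens_def by (intro le_mult_cInf) auto

lemma cx_nonneg: "gens G X \<Longrightarrow> 0 \<le> cx t G X"
  using cx_greatest cost_nonneg by blast

text \<open>The two infima are taken one after the other, each time with the other factor held
  fixed.\<close>

lemma cx_mult:
  assumes "gens G F" "gens F X" shows "cx t G X \<le> cx t G F * cx t F X"
proof (rule cx_mult_greatest[OF assms(2) cx_nonneg[OF assms(1)]])
  fix ms assume ms: "reach F ms X"
  have "cx t G X \<le> cost t ms * cx t G F"
  proof (rule cx_mult_greatest[OF assms(1) cost_nonneg])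
    fix ns assume "reach G ns F"
    then obtain ks where "reach G ks X" "cost t ks = cost t ns * cost t ms"
      using reach_trans[OF _ _ ms] assms(1) unfolding gens_def by blast
    then show "cx t G X \<le> cost t ms * cost t ns" using cx_le by (metis mult.commute)
  qed
  then show "cx t G X \<le> cx t G F * cost t ms" by (simp add: mult.commute)
qed

lemma gens_tri: "gens G X \<Longrightarrow> gens G Z \<Longrightarrow> tri X Y Z \<Longrightarrow> gens G Y"
  unfolding gens_def using reach_tri by blast

lemma cx_tri:
  assumes "gens G X" "gens G Z" "tri X Y Z" shows "cx t G Y \<le> cx t G X + cx t G Z"
proof -
  have "cx t G Y - cost t ns \<le> cx t G Z" if ns: "reach G ns X" for ns
  proof (rule cx_greatest[OF assms(2)])
    fix ms assume "reach G ms Z"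
    then show "cx t G Y - cost t ns \<le> cost t ms"
      using cx_le[OF reach_tri[OF ns _ assms(3)], of ms t] by simp
  qed
  then have "cx t G Y - cx t G Z \<le> cx t G X"
    by (intro cx_greatest[OF assms(1)]) (simp add: algebra_simps)
  then show ?thesis by simp
qed

lemma gens_retr: "gens G Y \<Longrightarrow> retr X Y \<Longrightarrow> gens G X"
  unfolding gens_def using reach_retr by blast

lemma cx_retr: "gens G Y \<Longrightarrow> retr X Y \<Longrightarrow> cx t G X \<le> cx t G Y"
  by (rule cx_greatest) (auto intro: cx_le reach_retr)

lemma cx_iso: "gens G X \<Longrightarrow> iso X Y \<Longrightarrow> cx t G X = cx t G Y"
  by (meson antisym cx_retr gens_retr iso_retr iso_sym)

lemma gens_self: "G \<in> Ob D \<Longrightarrow> gens G G"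
  using reach_self gens_def by blast

lemma cx_self: "G \<in> Ob D \<Longrightarrow> cx t G G \<le> 1"
  using cx_le[OF reach_self] by fastforce

lemma gens_shift: "gens G X \<Longrightarrow> gens G (Sh D m X)"
  unfolding gens_def using reach_shift by blast

lemma cx_shift_le:
  assumes "gens G X" shows "cx t G (Sh D m X) \<le> exp (real_of_int m * t) * cx t G X"
proof (rule cx_mult_greatest[OF assms])
  fix ns assume "reach G ns X"
  then show "cx t G (Sh D m X) \<le> exp (real_of_int m * t) * cost t ns"
    using cx_le[OF reach_shift] assms gens_def by (metis cost_shift)
qed simp

text \<open>The reverse inequality is \<open>cx_shift_le\<close> for the shift back by -m.\<close>

lemma cx_shift:
  assumes "gens G X" shows "cx t G (Sh D m X) = exp (real_of_int m * t) * cx t G X"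
proof (rule antisym[OF cx_shift_le[OF assms]])
  have X: "X \<in> Ob D" using assms gens_def reach_ob by blast
  have "cx t G X \<le> exp (real_of_int (- m) * t) * cx t G (Sh D m X)"
    using cx_shift_le[OF gens_shift[OF assms, of m], of t "- m"] X by (simp add: sh_sh sh_zero)
  then have "exp (real_of_int m * t) * cx t G X \<le> exp (real_of_int m * t) * (exp (real_of_int (- m) * t) * cx t G (Sh D m X))"
    by (intro mult_left_mono) auto
  also have "\<dots> = cx t G (Sh D m X)" by (simp add: mult.assoc[symmetric] exp_add[symmetric])
  finally show "exp (real_of_int m * t) * cx t G X \<le> cx t G (Sh D m X)" .
qed

subsection \<open>Split-generators\<close>

text \<open>Consequently a split-generator reaches every object at finite cost, and all complexities
  from it are real numbers.\<close>

lemma thick_gens: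
  assumes "G \<in> Ob D" shows "thick_subcategory D {X. gens G X}"
  unfolding thick_subcategory_def
proof (intro conjI subsetI ballI allI impI)
  show "X \<in> Ob D" if "X \<in> {X. gens G X}" for X using that gens_def reach_ob by blast
  show "Sh D n X \<in> {X. gens G X}" if "X \<in> {X. gens G X}" for X n using that gens_shift by blast
  show "Z \<in> {X. gens G X}" if "X \<in> {X. gens G X}" "Y \<in> {X. gens G X}" "Dist D X Y Z f g h" for X Y Z f g h
    \<comment> \<open>The third vertex is the middle of the rotated triangle Y -> Z -> X[1].\<close>
    using that gens_tri[of G Y "Sh D 1 X" Z] gens_shift tri_rotate tri_def by blast
  show "X \<in> {X. gens G X}" if "X \<in> Ob D" "Y \<in> Ob D" "P \<in> {X. gens G X}" "biproduct D X Y P" for X Y P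
    using that biproduct_retr gens_retr by blast
qed

lemma split_generator_least: 
  "split_generator D G \<Longrightarrow> thick_subcategory D S \<Longrightarrow> G \<in> S \<Longrightarrow> X \<in> Ob D \<Longrightarrow> X \<in> S"
  unfolding split_generator_def by blast

lemma split_generator_gens: "split_generator D G \<Longrightarrow> X \<in> Ob D \<Longrightarrow> gens G X"
  using split_generator_least[of G "{X. gens G X}" X] thick_gens gens_self
  by (simp add: split_generator_def)

section \<open>Detection of nonzero objects and positivity of complexity\<close>

lemma no_arr_tri_middle:
  assumes "tri X Y Z" "\<And>f. arr f W X \<Longrightarrow> f = 0" "\<And>f. arr f W Z \<Longrightarrow> f = 0" "arr f W Y"
  shows "f = 0"
proof -
  obtain a b c where T: "Dist D X Y Z a b c" using assms tri_def by blast
  have "b \<cdot> f = 0" using assms arr_comp dist_arr(2)[OF T] by blast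
  then obtain v where "arr v W X" "f = a \<cdot> v" using dist_lift[OF T assms(4)] by blast
  then show ?thesis using assms comp_zero_right dist_arr(1)[OF T] by metis
qed

lemma no_arr_tri_right:
  assumes "tri X Y Z" "\<And>f. arr f (Sh D 1 X) W \<Longrightarrow> f = 0" "\<And>f. arr f Y W \<Longrightarrow> f = 0" "arr f Z W"
  shows "f = 0"
proof -
  obtain a b c where T: "Dist D X Y Z a b c" using assms tri_def by blast
  have "f \<cdot> b = 0" using assms arr_comp dist_arr(2)[OF T] by blast
  then obtain v where v: "arr v (Sh D 1 X) W" "f = v \<cdot> c"
    using dist_extend[OF dist_rotate[OF T] assms(4)] by blast
  then show ?thesis using assms(2)[OF v(1)] comp_zero_left[OF dist_arr(3)[OF T]] by simp
qed

lemma no_arr_retr_from: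
  assumes "retr X Y" "\<And>f. arr f Y W \<Longrightarrow> f = 0" "arr f X W" shows "f = 0"
proof -
  obtain i p where i: "arr i X Y" "arr p Y X" "p \<cdot> i = Id D X" using assms retr_def by blast
  have "f = (f \<cdot> p) \<cdot> i" using assoc[OF i(1,2) assms(3)] i id_right[OF assms(3)] by simp
  moreover have "f \<cdot> p = 0" using assms arr_comp i by blast
  ultimately show ?thesis using comp_zero_left i by metis
qed

lemma no_arr_retr_to:
  assumes "retr X Y" "\<And>f. arr f W Y \<Longrightarrow> f = 0" "arr f W X" shows "f = 0"
proof -
  obtain i p where i: "arr i X Y" "arr p Y X" "p \<cdot> i = Id D X" using assms retr_def by blast
  have "f = p \<cdot> (i \<cdot> f)" using assoc[OF assms(3) i(1,2)] i id_left[OF assms(3)] by simp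
  moreover have "i \<cdot> f = 0" using assms arr_comp i by blast
  ultimately show ?thesis using comp_zero_right i by metis
qed

lemma arr_shift_iff:
  assumes "X \<in> Ob D" "Y \<in> Ob D"
  shows "(\<forall>f. arr f (Sh D n X) (Sh D n Y) \<longrightarrow> f = 0) \<longleftrightarrow> (\<forall>f. arr f X Y \<longrightarrow> f = 0)"
proof (intro iffI allI impI)
  fix f assume *: "\<forall>f. arr f (Sh D n X) (Sh D n Y) \<longrightarrow> f = 0" and f: "arr f X Y"
  then have "ShM D n f = ShM D n 0" using arr_shift shift_zero assms by metis
  then show "f = 0" using shift_inj f arr_zero assms by blast
next
  fix f assume *: "\<forall>f. arr f X Y \<longrightarrow> f = 0" and f: "arr f (Sh D n X) (Sh D n Y)"
  then have "ShM D (-n) f = 0" using arr_unshift assms by blast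
  then show "f = 0" using shift_cancel(2)[OF f, of n] shift_zero assms by simp
qed

text \<open>The objects without nonzero maps to any shift of F form a thick subcategory. If it
  contained G, it would contain F, and the identity of F would vanish.\<close>

lemma split_generator_detects:
  assumes G: "split_generator D G" and F: "F \<in> Ob D" "\<not> zero_object D F"
  shows "\<exists>i f. arr f G (Sh D i F) \<and> f \<noteq> 0"
proof (rule ccontr)
  assume neg: "\<not> ?thesis"
  define S where "S = {X \<in> Ob D. \<forall>i f. arr f X (Sh D i F) \<longrightarrow> f = 0}"
  have "thick_subcategory D S"
    unfolding thick_subcategory_def
  proof (intro conjI subsetI ballI allI impI)
    show "X \<in> Ob D" if "X \<in> S" for X using that S_def by blast
    show sh: "Sh D n X \<in> S" if "X \<in> S" for X n
    proof -
      have X: "X \<in> Ob D" using that S_def by blast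
      have "f = 0" if f: "arr f (Sh D n X) (Sh D i F)" for i f
      proof -
        have "\<forall>f. arr f X (Sh D (i - n) F) \<longrightarrow> f = 0" using \<open>X \<in> S\<close> S_def by blast
        then show ?thesis
          using arr_shift_iff[OF X, of "Sh D (i - n) F" n] F f by (simp add: sh_ob sh_sh)
      qed
      then show ?thesis unfolding S_def using X sh_ob by blast
    qed
    show "Z \<in> S" if "X \<in> S" "Y \<in> S" "Dist D X Y Z f g h" for X Y Z f g h
    proof -
      have T: "tri X Y Z" using that tri_def by blast
      have "f = 0" if "arr f Z (Sh D i F)" for i f
        \<comment> \<open>Maps out of Z are controlled by those out of Y and X[1], so closure under
          shifts enters here.\<close>
        using no_arr_tri_right[OF T _ _ that] sh[OF \<open>X \<in> S\<close>] \<open>Y \<in> S\<close> unfolding S_def by blast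
      then show ?thesis unfolding S_def using tri_ob T by blast
    qed
    show "X \<in> S" if "X \<in> Ob D" "Y \<in> Ob D" "P \<in> S" "biproduct D X Y P" for X Y P
      using no_arr_retr_from[OF biproduct_retr[OF that(4,1,2)]] that unfolding S_def by blast
  qed
  moreover have "G \<in> S" using G neg unfolding S_def split_generator_def by blast
  ultimately have "F \<in> S" using split_generator_least G F by blast
  moreover have "arr (Id D F) F (Sh D 0 F)" using arr_id[OF F(1)] sh_zero[OF F(1)] by simp
  ultimately have "Id D F = 0" unfolding S_def by blast
  then show False using F zero_object_iff by blast
qed

text \<open>A nonzero arrow into a tower must be visible in some layer: if none reaches the lower
  part, exactness produces one into the top layer.\<close>

lemma built_arr:
  "built G ns X \<Longrightarrow> W \<in> Ob D \<Longrightarrow> G \<in> Ob D \<Longrightarrow> arr f W (Sh D j X) \<Longrightarrow> f \<noteq> 0 \<Longrightarrow>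
    \<exists>n\<in>set ns. \<exists>f. arr f W (Sh D (n + j) G) \<and> f \<noteq> 0"
proof (induction arbitrary: f rule: built.induct)
  case (nil X)
  then show ?case using zero_arr_to zero_shift by blast
next
  case (snoc ns X Y n)
  show ?case
  proof (cases "\<exists>f. arr f W (Sh D j X) \<and> f \<noteq> 0")
    case True
    then show ?thesis using snoc.IH snoc.prems by auto
  next
    case False
    have "tri (Sh D j X) (Sh D j Y) (Sh D (n + j) G)"
      using tri_shift[OF snoc(2), of j] snoc.prems by (simp add: sh_sh add.commute)
    then have "\<exists>f. arr f W (Sh D (n + j) G) \<and> f \<noteq> 0"
      using no_arr_tri_middle[of "Sh D j X" "Sh D j Y" "Sh D (n + j) G" W f] False snoc.prems(3,4) by blast
    then show ?thesis by simp
  qed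
qed

lemma cx_pos:
  assumes ft: "finite_type D" and G: "split_generator D G" and F: "F \<in> Ob D" "\<not> zero_object D F"
  shows "0 < cx t G F"
proof -
  have GD: "G \<in> Ob D" using G by (simp add: split_generator_def)
  obtain j f where f: "arr f G (Sh D j F)" "f \<noteq> 0" using split_generator_detects[OF G F] by blast
  define S where "S = {i. Hom D G (Sh D i G) \<noteq> {0}}"
  have fin: "finite S" unfolding S_def using ft GD by (simp add: finite_type_def)
  \<comment> \<open>A tower reaching F has a layer G[n] with Hom(G, G[n + j]) nonzero. With i = n +
    j in the finite set S, its cost is at least \<open>exp ((i - j) t)\<close>, and c bounds all
    these from below. The inserted 1 keeps the set visibly nonempty.\<close>
  define c where "c = Min (insert 1 ((\<lambda>i. exp (real_of_int (i - j) * t)) ` S))"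
  have "0 < c" unfolding c_def using fin by (subst Min_gr_iff) auto
  moreover have "c \<le> cx t G F"
  proof (rule cx_greatest[OF split_generator_gens[OF G F(1)]])
    fix ns assume "reach G ns F"
    then obtain A where A: "built G ns A" "retr F A" using reach_def by blast
    have "\<exists>f. arr f G (Sh D j A) \<and> f \<noteq> 0"
      using no_arr_retr_to[OF retr_shift[OF A(2)] _ f(1)] f(2) by blast
    then obtain n g where n: "n \<in> set ns" "arr g G (Sh D (n + j) G)" "g \<noteq> 0"
      using built_arr[OF A(1) GD GD] by blast
    then have "n + j \<in> S" unfolding S_def arr_def by blast
    then have "c \<le> exp (real_of_int (n + j - j) * t)"
      unfolding c_def using fin by (intro Min_le insertI2 imageI) simp_all
    then show "c \<le> cost t ns" using exp_le_cost[OF n(1), of t] by simp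
  qed
  ultimately show ?thesis by simp
qed

end

subsection \<open>Exact endofunctors\<close>

locale exact_endofunctor = tricat D
  for D :: "('o, 'm::ab_group_add, 'k::field) tri_cat" (structure) +
  fixes T :: "('o, 'm, 'o, 'm) func"
  assumes exact: "exact_functor D D T"
begin

lemma linear: "linear_functor D D T"
  using exact unfolding exact_functor_def by (rule conjunct1)

lemma functor_ob: "\<forall>X\<in>Ob D. FOb T X \<in> Ob D \<and> FMor T (Id D X) = Id D (FOb T X)"
  and functor_hom: "\<forall>X\<in>Ob D. \<forall>Y\<in>Ob D. FMor T ` Hom D X Y \<subseteq> Hom D (FOb T X) (FOb T Y) \<and>
        klinear_on (Scale D) (Hom D X Y) (Scale D) (FMor T)"
  and functor_comp: "\<forall>X\<in>Ob D. \<forall>Y\<in>Ob D. \<forall>Z\<in>Ob D. \<forall>f\<in>Hom D X Y. \<forall>g\<in>Hom D Y Z.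
        FMor T (g \<cdot> f) = FMor T g \<cdot> FMor T f"
  using linear unfolding linear_functor_def by - (elim conjE, assumption)+

lemma F_ob: "X \<in> Ob D \<Longrightarrow> FOb T X \<in> Ob D"
  using functor_ob by simp

lemma F_id: "X \<in> Ob D \<Longrightarrow> FMor T (Id D X) = Id D (FOb T X)"
  using functor_ob by simp

lemma F_arr: "arr f X Y \<Longrightarrow> arr (FMor T f) (FOb T X) (FOb T Y)"
  using functor_hom F_ob unfolding arr_def image_subset_iff by simp

lemma F_comp: "arr f X Y \<Longrightarrow> arr g Y Z \<Longrightarrow> FMor T (g \<cdot> f) = FMor T g \<cdot> FMor T f"
  using functor_comp unfolding arr_def by blast

lemma F_zero: "X \<in> Ob D \<Longrightarrow> FMor T 0 = 0"
proof -
  assume X: "X \<in> Ob D"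
  have "klinear_on (Scale D) (Hom D X X) (Scale D) (FMor T)"
    using functor_hom X by simp
  moreover have "0 \<in> Hom D X X" using arr_zero X arr_def by blast
  ultimately have "FMor T (0 + 0) = FMor T 0 + FMor T 0" unfolding klinear_on_def by blast
  then show ?thesis by simp
qed

lemma F_zero_object: "zero_object D X \<Longrightarrow> zero_object D (FOb T X)"
  using F_id[of X] F_ob[of X] F_zero[of X] zero_ob[of X] zero_object_iff[of X] zero_object_iff[of "FOb T X"]
  by simp

lemma F_iso: "iso X Y \<Longrightarrow> iso (FOb T X) (FOb T Y)"
  unfolding iso_def
proof (elim exE conjE)
  fix f g assume "arr f X Y" "arr g Y X" "g \<cdot> f = Id D X" "f \<cdot> g = Id D Y"
  then have "arr (FMor T f) (FOb T X) (FOb T Y)" "arr (FMor T g) (FOb T Y) (FOb T X)"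
    "FMor T g \<cdot> FMor T f = Id D (FOb T X)" "FMor T f \<cdot> FMor T g = Id D (FOb T Y)"
    using F_arr F_comp[of f X Y g X] F_comp[of g Y X f Y] F_id arr_ob by auto
  then show "\<exists>f g. arr f (FOb T X) (FOb T Y) \<and> arr g (FOb T Y) (FOb T X) \<and>
      g \<cdot> f = Id D (FOb T X) \<and> f \<cdot> g = Id D (FOb T Y)" by blast
qed

lemma F_retr: "retr X Y \<Longrightarrow> retr (FOb T X) (FOb T Y)"
  unfolding retr_def
proof (elim exE conjE)
  fix f g assume "arr f X Y" "arr g Y X" "g \<cdot> f = Id D X"
  then have "arr (FMor T f) (FOb T X) (FOb T Y)" "arr (FMor T g) (FOb T Y) (FOb T X)"
    "FMor T g \<cdot> FMor T f = Id D (FOb T X)"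
    using F_arr F_comp[of f X Y g X] F_id arr_ob by auto
  then show "\<exists>f g. arr f (FOb T X) (FOb T Y) \<and> arr g (FOb T Y) (FOb T X) \<and>
      g \<cdot> f = Id D (FOb T X)" by blast
qed

lemma F_tri: "tri X Y Z \<Longrightarrow> tri (FOb T X) (FOb T Y) (FOb T Z)"
proof -
  obtain \<omega> where "\<forall>X Y Z f g h. Dist D X Y Z f g h \<longrightarrow>
      Dist D (FOb T X) (FOb T Y) (FOb T Z) (FMor T f) (FMor T g) (\<omega> X \<cdot> FMor T h)"
    using exact unfolding exact_functor_def by (elim conjE exE) (rule that)
  then show "tri X Y Z \<Longrightarrow> tri (FOb T X) (FOb T Y) (FOb T Z)" unfolding tri_def by blast
qed

lemma F_shift_one: "X \<in> Ob D \<Longrightarrow> iso (FOb T (Sh D 1 X)) (Sh D 1 (FOb T X))"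
proof -
  assume X: "X \<in> Ob D"
  obtain \<omega> where "\<forall>X\<in>Ob D. is_iso D (FOb T (Sh D 1 X)) (Sh D 1 (FOb T X)) (\<omega> X)"
    using exact unfolding exact_functor_def by (elim conjE exE) (rule that)
  then show ?thesis using isoI[OF F_ob[OF sh_ob[OF X]] sh_ob[OF F_ob[OF X]]] X by blast
qed

text \<open>An exact functor comes with the comparison for the shift by one only. Downwards, that
  comparison is applied to X[i - 1] and the result is shifted back.\<close>

lemma F_shift: "X \<in> Ob D \<Longrightarrow> iso (FOb T (Sh D n X)) (Sh D n (FOb T X))"
proof (induction n rule: int_induct[where k = 0])
  case base
  then show ?case by (simp add: sh_zero iso_refl F_ob)
next
  case (step1 i)
  have "iso (FOb T (Sh D 1 (Sh D i X))) (Sh D 1 (Sh D i (FOb T X)))"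
    using iso_trans[OF F_shift_one iso_shift] step1 sh_ob by blast
  then show ?case using step1 by (simp add: sh_sh F_ob add.commute)
next
  case (step2 i)
  have "iso (Sh D 1 (FOb T (Sh D (i - 1) X))) (FOb T (Sh D 1 (Sh D (i - 1) X)))"
    using iso_sym F_shift_one step2 sh_ob by blast
  moreover have "Sh D 1 (Sh D (i - 1) X) = Sh D i X" using step2 by (simp add: sh_sh)
  ultimately have "iso (Sh D 1 (FOb T (Sh D (i - 1) X))) (Sh D i (FOb T X))"
    using iso_trans[OF _ step2(2)[OF step2(3)]] by simp
  from iso_shift[OF this, of "-1"] show ?case using step2 by (simp add: sh_sh F_ob sh_ob sh_zero)
qed

lemma F_built: "G \<in> Ob D \<Longrightarrow> built G ns X \<Longrightarrow> built (FOb T G) ns (FOb T X)"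
proof (rotate_tac, induction rule: built.induct)
  case (nil X)
  then show ?case using F_zero_object built.nil by blast
next
  case (snoc ns X Y n)
  then have "tri (FOb T X) (FOb T Y) (Sh D n (FOb T G))"
    using tri_iso[OF F_tri[OF snoc(2)] _ _ F_shift] iso_refl F_ob tri_ob by blast
  then show ?case using snoc built.snoc by blast
qed

abbreviation Tn :: "nat \<Rightarrow> 'o \<Rightarrow> 'o" where
  "Tn n X \<equiv> (FOb T ^^ n) X"

lemma Tn_ob: "X \<in> Ob D \<Longrightarrow> Tn n X \<in> Ob D"
  by (induction n) (auto simp: F_ob)

lemma Tn_reach: "G \<in> Ob D \<Longrightarrow> reach G ns X \<Longrightarrow> reach (Tn n G) ns (Tn n X)"
proof (induction n)
  case (Suc n)
  then show ?case using F_built F_retr Tn_ob unfolding reach_def by (simp, blast)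
qed simp

lemma Tn_gens: "gens G X \<Longrightarrow> gens (Tn n G) (Tn n X)"
  unfolding gens_def using Tn_ob Tn_reach by blast

text \<open>An exact functor carries a tower to a tower with the same integers, so the complexity
  cannot increase.\<close>

lemma Tn_cx: "gens G X \<Longrightarrow> cx t (Tn n G) (Tn n X) \<le> cx t G X"
  by (rule cx_greatest) (auto simp: gens_def intro: cx_le Tn_reach)

lemma Tn_tri: "tri X Y Z \<Longrightarrow> tri (Tn n X) (Tn n Y) (Tn n Z)"
  by (induction n) (auto simp: F_tri)

lemma Tn_shift: "X \<in> Ob D \<Longrightarrow> iso (FOb T X) (Sh D m X) \<Longrightarrow> iso (Tn n X) (Sh D (int n * m) X)"
proof (induction n)
  case 0
  then show ?case by (simp add: sh_zero iso_refl)
next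
  case (Suc n)
  have "iso (Tn (Suc n) X) (FOb T (Sh D (int n * m) X))" using Suc F_iso by simp
  moreover have "iso (FOb T (Sh D (int n * m) X)) (Sh D (int n * m) (FOb T X))" using F_shift Suc by blast
  moreover have "iso (Sh D (int n * m) (FOb T X)) (Sh D (int n * m) (Sh D m X))" using iso_shift Suc by blast
  ultimately have "iso (Tn (Suc n) X) (Sh D (int n * m) (Sh D m X))" using iso_trans by blast
  then show ?case using Suc by (simp add: sh_sh algebra_simps)
qed

end

section \<open>The twist on objects\<close>

context tricat
begin

section \<open>Tensor objects through their universal property\<close>

lemma tensor_objectD:
  assumes "tensor_object D (\<lambda>n. Hom D E (Sh D n F)) E P \<iota>" "E \<in> Ob D" "F \<in> Ob D"
  shows "P \<in> Ob D"
    and "arr v E (Sh D n F) \<Longrightarrow> arr (\<iota> n v) E (Sh D n P)"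
    and "arr v E (Sh D n F) \<Longrightarrow> arr w E (Sh D n F) \<Longrightarrow> \<iota> n (v + w) = \<iota> n v + \<iota> n w"
    and "arr v E (Sh D n F) \<Longrightarrow> \<iota> n (Scale D c v) = Scale D c (\<iota> n v)"
proof -
  have P: "P \<in> Ob D" and l: "\<And>n. klinear_on (Scale D) (Hom D E (Sh D n F)) (Scale D) (\<iota> n)"
    and i: "\<And>n. \<iota> n ` Hom D E (Sh D n F) \<subseteq> Hom D E (Sh D n P)"
    using assms(1) unfolding tensor_object_def by blast+
  show "P \<in> Ob D" by (rule P)
  show "arr v E (Sh D n F) \<Longrightarrow> arr (\<iota> n v) E (Sh D n P)"
    using i[of n] P by (auto simp: arr_def sh_ob)
  show "arr v E (Sh D n F) \<Longrightarrow> arr w E (Sh D n F) \<Longrightarrow> \<iota> n (v + w) = \<iota> n v + \<iota> n w"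
    "arr v E (Sh D n F) \<Longrightarrow> \<iota> n (Scale D c v) = Scale D c (\<iota> n v)"
    using l[of n] by (auto simp: arr_def klinear_on_def)
qed

lemma tensor_object_factor:
  assumes P: "tensor_object D (\<lambda>n. Hom D E (Sh D n F)) E P \<iota>" "E \<in> Ob D" "F \<in> Ob D"
    and Z: "Z \<in> Ob D"
    and l: "\<And>n. klinear_on (Scale D) (Hom D E (Sh D n F)) (Scale D) (l n)"
      "\<And>n v. arr v E (Sh D n F) \<Longrightarrow> arr (l n v) E (Sh D n Z)"
  shows "\<exists>g. arr g P Z \<and> (\<forall>n v. arr v E (Sh D n F) \<longrightarrow> ShM D n g \<cdot> \<iota> n v = l n v)"
proof -
  have *: "(\<forall>n. klinear_on (Scale D) (Hom D E (Sh D n F)) (Scale D) (l n) \<and>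
      l n ` Hom D E (Sh D n F) \<subseteq> Hom D E (Sh D n Z))"
    using l P Z by (auto simp: arr_def sh_ob)
  have "\<exists>!g. g \<in> Hom D P Z \<and> (\<forall>n. \<forall>v\<in>Hom D E (Sh D n F). ShM D n g \<cdot> \<iota> n v = l n v)"
    by (rule mp[OF spec[OF bspec[OF conjunct2[OF conjunct2[OF P(1)[unfolded tensor_object_def]]] Z], of l] *])
  then obtain g where "g \<in> Hom D P Z" "\<forall>n. \<forall>v\<in>Hom D E (Sh D n F). ShM D n g \<cdot> \<iota> n v = l n v"
    by blast
  then show ?thesis using tensor_objectD(1)[OF P] Z by (auto simp: arr_def)
qed

text \<open>The uniqueness half of the universal property, in the form used to recognise identities:
  an endomorphism is tested on the images of \<open>\<iota>\<close>.\<close>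

lemma tensor_object_endo:
  assumes P: "tensor_object D (\<lambda>n. Hom D E (Sh D n F)) E P \<iota>" "E \<in> Ob D" "F \<in> Ob D"
    and g: "arr g P P" "\<And>n v. arr v E (Sh D n F) \<Longrightarrow> ShM D n g \<cdot> \<iota> n v = \<iota> n v"
  shows "g = Id D P"
proof -
  note PD = tensor_objectD(1)[OF P]
  have *: "(\<forall>n. klinear_on (Scale D) (Hom D E (Sh D n F)) (Scale D) (\<iota> n) \<and>
      \<iota> n ` Hom D E (Sh D n F) \<subseteq> Hom D E (Sh D n P))"
    using P(1) unfolding tensor_object_def by blast
  have "\<exists>!g. g \<in> Hom D P P \<and> (\<forall>n. \<forall>v\<in>Hom D E (Sh D n F). ShM D n g \<cdot> \<iota> n v = \<iota> n v)"
    by (rule mp[OF spec[OF bspec[OF conjunct2[OF conjunct2[OF P(1)[unfolded tensor_object_def]]] PD], of \<iota>] *])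
  moreover have "g \<in> Hom D P P \<and> (\<forall>n. \<forall>v\<in>Hom D E (Sh D n F). ShM D n g \<cdot> \<iota> n v = \<iota> n v)"
    using g P by (auto simp: arr_def sh_ob)
  moreover have "ShM D n (Id D P) \<cdot> \<iota> n v = \<iota> n v" if "v \<in> Hom D E (Sh D n F)" for n v
  proof -
    have "arr v E (Sh D n F)" using that P by (simp add: arr_def sh_ob)
    then show ?thesis using id_left[OF tensor_objectD(2)[OF P]] PD by (simp add: shm_id)
  qed
  moreover have "Id D P \<in> Hom D P P" using id_hom[OF PD] .
  ultimately show ?thesis by blast
qed

text \<open>With no nonzero v to test on, the zero endomorphism passes the test for being the
  identity.\<close>

lemma tensor_object_zero:
  assumes P: "tensor_object D (\<lambda>n. Hom D E (Sh D n F)) E P \<iota>" "E \<in> Ob D" "F \<in> Ob D"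
    and zero: "\<And>n v. arr v E (Sh D n F) \<Longrightarrow> v = 0"
  shows "zero_object D P"
proof -
  have PD: "P \<in> Ob D" using tensor_objectD(1)[OF P] .
  have "0 = Id D P"
  proof (rule tensor_object_endo[OF P arr_zero[OF PD PD]])
    fix n v assume v: "arr v E (Sh D n F)"
    then have "\<iota> n (Scale D 0 v) = Scale D 0 (\<iota> n v)" using tensor_objectD(4)[OF P] by blast
    then have "\<iota> n v = 0" using zero[OF v] by simp
    moreover have "arr 0 E (Sh D n P)" "arr 0 (Sh D n P) (Sh D n P)" using arr_zero sh_ob P PD by blast+
    ultimately show "ShM D n 0 \<cdot> \<iota> n v = \<iota> n v"
      using shift_zero[OF PD] comp_zero_right by simp
  qed
  then show ?thesis using zero_object_iff PD by simp
qed

text \<open>A is the direct sum of one copy of E[-n] for each member (n, u) of the family, and a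
  restricts on that summand to the arrow corresponding to u. The arrows c are the shifted inclusions
  of the summands.\<close>

lemma built_family:
  assumes E: "E \<in> Ob D" and P: "P \<in> Ob D"
  shows "finite J \<Longrightarrow> (\<And>n u. (n, u) \<in> J \<Longrightarrow> arr u E (Sh D n P)) \<Longrightarrow>
    \<exists>ns A a. built E ns A \<and> arr a A P \<and>
      (\<forall>n u. (n, u) \<in> J \<longrightarrow> (\<exists>c. arr c E (Sh D n A) \<and> ShM D n a \<cdot> c = u))"
proof (induction J rule: finite_induct)
  case empty
  obtain Z where Z: "zero_object D Z" using zero_object_exists by blast
  then show ?case using built.nil[OF Z] arr_zero[OF zero_ob[OF Z] P] by blast
next
  case (insert z J)
  obtain n u where z: "z = (n, u)" by fastforce
  have J: "arr w E (Sh D m P)" if "(m, w) \<in> J" for m w using insert.prems that by blast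
  obtain ns A a where A: "built E ns A" "arr a A P"
    "\<And>m w. (m, w) \<in> J \<Longrightarrow> \<exists>c. arr c E (Sh D m A) \<and> ShM D m a \<cdot> c = w"
    using insert.IH[OF J] by blast
  have u: "arr u E (Sh D n P)" using insert.prems z by blast
  have En: "Sh D n (Sh D (- n) E) = E" "Sh D (- n) E \<in> Ob D" using E by (simp_all add: sh_sh sh_zero sh_ob)
  have u': "arr (ShM D (- n) u) (Sh D (- n) E) P"
    using arr_shift[OF u, of "- n"] P by (simp add: sh_sh sh_zero)
  have AD: "A \<in> Ob D" using A built_ob by blast
  obtain B where B: "biproduct D A (Sh D (- n) E) B" using biproduct_exists AD En by blast
  obtain i j p q where i: "arr i A B" and j: "arr j (Sh D (- n) E) B" and p: "arr p B A"
    and q: "arr q B (Sh D (- n) E)" and eqs: "p \<cdot> i = Id D A" "q \<cdot> j = Id D (Sh D (- n) E)"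
    "p \<cdot> j = 0" "q \<cdot> i = 0"
    using biproductE[OF B AD En(2)] by metis
  have 1: "built E (ns @ [- n]) B" using A(1) biproduct_tri[OF B AD En(2)] built.snoc by blast
  have ap: "arr (a \<cdot> p) B P" and uq: "arr (ShM D (- n) u \<cdot> q) B P" using A p u' q arr_comp by blast+
  define b where "b = a \<cdot> p + ShM D (- n) u \<cdot> q"
  have b: "arr b B P" unfolding b_def using ap uq arr_add by blast
  have bi: "b \<cdot> i = a"
    unfolding b_def using comp_add_left[OF i ap uq] assoc[OF i p A(2)] assoc[OF i q u'] eqs
      id_right[OF A(2)] comp_zero_right[OF u'] by simp
  have bj: "b \<cdot> j = ShM D (- n) u"
    unfolding b_def using comp_add_left[OF j ap uq] assoc[OF j p A(2)] assoc[OF j q u'] eqs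
      id_right[OF u'] comp_zero_right[OF A(2)] by simp
  have "\<exists>c. arr c E (Sh D m B) \<and> ShM D m b \<cdot> c = w" if mw: "(m, w) \<in> insert z J" for m w
  proof (cases "(m, w) = (n, u)")
    case True
    have "arr (ShM D n j) E (Sh D n B)" using arr_shift[OF j, of n] En by simp
    moreover have "ShM D n b \<cdot> ShM D n j = u"
      using shift_comp[OF j b, of n] bj shift_cancel(2)[OF u, of n] by simp
    ultimately show ?thesis using True by blast
  next
    case False
    then obtain c where c: "arr c E (Sh D m A)" "ShM D m a \<cdot> c = w" using A(3) mw z by blast
    have "arr (ShM D m i \<cdot> c) E (Sh D m B)" using c arr_shift[OF i] arr_comp by blast
    moreover have "ShM D m b \<cdot> (ShM D m i \<cdot> c) = w"
      using assoc[OF c(1) arr_shift[OF i] arr_shift[OF b]] shift_comp[OF i b, of m] bi c by simp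
    ultimately show ?thesis by blast
  qed
  then show ?case using 1 b by blast
qed

text \<open>Finite type gives finitely many nonzero degrees, each with a finite basis. A finite sum
  A of shifts of E maps to P and hits the images of the basis vectors; lifting these linearly and
  using the universal property gives a section P -> A. So P is a retract of A.\<close>

lemma tensor_object_gens:
  assumes ft: "finite_type D"
    and P: "tensor_object D (\<lambda>n. Hom D E (Sh D n F)) E P \<iota>" "E \<in> Ob D" "F \<in> Ob D"
  shows "gens E P"
proof -
  interpret pair: vector_space_pair "Scale D" "Scale D" ..
  define V where "V n = Hom D E (Sh D n F)" for n
  have V: "v \<in> V n \<longleftrightarrow> arr v E (Sh D n F)" for v n using P by (simp add: V_def arr_def sh_ob)
  have subV: "vs.subspace (V n)" for n unfolding V_def using hom_subspace P sh_ob by blast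
  have finV: "finite {n. V n \<noteq> {0}}" "\<And>n. \<exists>B. finite B \<and> V n = vs.span B"
    using ft P unfolding finite_type_def V_def by auto
  note PD = tensor_objectD[OF P]
  have "\<exists>B. finite B \<and> B \<subseteq> V n \<and> vs.independent B \<and> V n \<subseteq> vs.span B" for n
  proof -
    obtain B where B: "B \<subseteq> V n" "vs.independent B" "V n \<subseteq> vs.span B"
      using vs.maximal_independent_subset[of "V n"] by blast
    obtain S where "finite S" "V n = vs.span S" using finV by blast
    then have "finite B" using vs.independent_span_bound[of S B] B by blast
    then show ?thesis using B by blast
  qed
  then obtain B where B: "\<And>n. finite (B n)" "\<And>n. B n \<subseteq> V n" "\<And>n. vs.independent (B n)"
    "\<And>n. V n \<subseteq> vs.span (B n)" by metis
  have Bz: "B n = {}" if "V n = {0}" for n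
  proof -
    have "0 \<notin> B n" using B(3) vs.dependent_zero by blast
    then show ?thesis using B(2)[of n] that by auto
  qed
  \<comment> \<open>Restricting to the nonzero degrees makes J finite; the other degrees have an
    empty basis by \<open>Bz\<close>.\<close>
  define J where "J = (\<Union>n\<in>{n. V n \<noteq> {0}}. (\<lambda>b. (n, \<iota> n b)) ` B n)"
  have "finite J" unfolding J_def using finV B by blast
  moreover have "arr u E (Sh D n P)" if "(n, u) \<in> J" for n u
    using that B(2) PD(2) V unfolding J_def by blast
  ultimately obtain ns A a where A: "built E ns A" "arr a A P"
    and c: "\<And>n u. (n, u) \<in> J \<Longrightarrow> \<exists>c. arr c E (Sh D n A) \<and> ShM D n a \<cdot> c = u"
    using built_family[OF P(2) PD(1), of J] by blast
  have AD: "A \<in> Ob D" using A built_ob by blast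
  have "\<exists>g. Vector_Spaces.linear (Scale D) (Scale D) g \<and>
      (\<forall>v\<in>V n. arr (g v) E (Sh D n A) \<and> ShM D n a \<cdot> g v = \<iota> n v)" for n
  proof -
    have "\<forall>b\<in>B n. \<exists>c. arr c E (Sh D n A) \<and> ShM D n a \<cdot> c = \<iota> n b"
    proof
      fix b assume b: "b \<in> B n"
      then have "(n, \<iota> n b) \<in> J" unfolding J_def using Bz by blast
      then show "\<exists>c. arr c E (Sh D n A) \<and> ShM D n a \<cdot> c = \<iota> n b" using c by blast
    qed
    then obtain f where f: "\<And>b. b \<in> B n \<Longrightarrow> arr (f b) E (Sh D n A) \<and> ShM D n a \<cdot> f b = \<iota> n b"
      by metis
    obtain g where g: "Vector_Spaces.linear (Scale D) (Scale D) g" "\<forall>b\<in>B n. g b = f b"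
      using pair.linear_independent_extend[OF B(3)] by blast
    interpret g: Vector_Spaces.linear "Scale D" "Scale D" g by (rule g(1))
    have sa: "arr (ShM D n a) (Sh D n A) (Sh D n P)" using arr_shift A by blast
    \<comment> \<open>The extension g is linear on the whole ambient space, so its typing and the
      lifting property have to be recovered on \<open>V n\<close>: they hold on a subspace that
      contains the basis.\<close>
    let ?W = "{v \<in> V n. arr (g v) E (Sh D n A) \<and> ShM D n a \<cdot> g v = \<iota> n v}"
    have "vs.subspace ?W"
      unfolding vs.subspace_def
    proof (intro conjI ballI allI)
      have "\<iota> n (Scale D 0 0) = Scale D 0 (\<iota> n 0)"
        using PD(4)[of 0 n 0] arr_zero P sh_ob by blast
      then have "\<iota> n 0 = 0" by simp
      then show "0 \<in> ?W" using vs.subspace_0[OF subV] arr_zero P AD sh_ob comp_zero_right[OF sa]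
        by (auto simp: g.zero)
    next
      fix v w assume v: "v \<in> ?W" and w: "w \<in> ?W"
      then show "v + w \<in> ?W"
        using vs.subspace_add[OF subV] arr_add PD(3) V comp_add_right[OF sa] by (auto simp: g.add)
    next
      fix c v assume v: "v \<in> ?W"
      then show "Scale D c v \<in> ?W"
        using vs.subspace_scale[OF subV] arr_scale PD(4) V comp_scale_right[OF sa] by (auto simp: g.scale)
    qed
    moreover have "B n \<subseteq> ?W" using B(2) f g(2) by auto
    ultimately have "V n \<subseteq> ?W" using B(4) vs.span_minimal by blast
    then show ?thesis using g(1) by blast
  qed
  then obtain l where l: "\<And>n. Vector_Spaces.linear (Scale D) (Scale D) (l n)"
    "\<And>n v. v \<in> V n \<Longrightarrow> arr (l n v) E (Sh D n A) \<and> ShM D n a \<cdot> l n v = \<iota> n v" by metis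
  have "klinear_on (Scale D) (Hom D E (Sh D n F)) (Scale D) (l n)" for n
    using pair.linear_add[OF l(1)] pair.linear_scale[OF l(1)] by (simp add: klinear_on_def)
  then obtain b where b: "arr b P A" "\<And>n v. v \<in> V n \<Longrightarrow> ShM D n b \<cdot> \<iota> n v = l n v"
    using tensor_object_factor[OF P AD, of l] l(2) V by blast
  have "a \<cdot> b = Id D P"
  proof (rule tensor_object_endo[OF P arr_comp[OF b(1) A(2)]])
    fix n v assume v: "arr v E (Sh D n F)"
    then show "ShM D n (a \<cdot> b) \<cdot> \<iota> n v = \<iota> n v"
      using shift_comp[OF b(1) A(2)] assoc[OF PD(2)[OF v] arr_shift[OF b(1)] arr_shift[OF A(2)]] b(2) l(2) V
      by simp
  qed
  then have "retr P A" unfolding retr_def using b A by blast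
  then show ?thesis unfolding gens_def reach_def using A P by blast
qed

text \<open>The graded Hom from E to F has basis x in degree 0 and h in degree d. The proof exhibits
  P as E + E[-d] with inclusions i, j and projections p, q, so that e becomes the projection p
  followed by the isomorphism x.\<close>

lemma tensor_object_cone:
  assumes P: "tensor_object D (\<lambda>n. Hom D E (Sh D n F)) E P \<iota>" "E \<in> Ob D" "F \<in> Ob D"
    and C: "Dist D P F C e c c'" and ev: "\<And>n v. arr v E (Sh D n F) \<Longrightarrow> ShM D n e \<cdot> \<iota> n v = v"
    and d: "d \<noteq> 0"
    and x: "arr x E F" and y: "arr y F E" "y \<cdot> x = Id D E" "x \<cdot> y = Id D F"
    and V0: "\<And>v. arr v E F \<Longrightarrow> \<exists>k. v = Scale D k x"
    and h: "arr h E (Sh D d F)"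
    and \<kappa>: "klinear_on (Scale D) (Hom D E (Sh D d F)) (*) \<kappa>"
      "\<And>v. arr v E (Sh D d F) \<Longrightarrow> v = Scale D (\<kappa> v) h" "\<kappa> h = 1"
    and Vn: "\<And>n v. arr v E (Sh D n F) \<Longrightarrow> n \<noteq> 0 \<Longrightarrow> n \<noteq> d \<Longrightarrow> v = 0"
  shows "iso C (Sh D (1 - d) E)"
proof -
  note PD = tensor_objectD[OF P]
  have e: "arr e P F" using dist_arr[OF C] by blast
  have x0: "arr x E (Sh D 0 F)" using x P by (simp add: sh_zero)
  define i where "i = \<iota> 0 x"
  have i: "arr i E P" using PD(2)[OF x0] PD(1) by (simp add: i_def sh_zero)
  have ei: "e \<cdot> i = x" using ev[OF x0] shift_0[OF e] by (simp add: i_def)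
  define p where "p = y \<cdot> e"
  have p: "arr p P E" unfolding p_def using e y arr_comp by blast
  have pi: "p \<cdot> i = Id D E" unfolding p_def using assoc[OF i e y(1)] ei y by simp
  define g where "g = \<iota> d h"
  have g: "arr g E (Sh D d P)" unfolding g_def using PD(2)[OF h] .
  have eg: "ShM D d e \<cdot> g = h" unfolding g_def using ev[OF h] .
  have ed: "arr (ShM D d e) (Sh D d P) (Sh D d F)" "arr (ShM D d y) (Sh D d F) (Sh D d E)"
    "arr (ShM D d i) (Sh D d E) (Sh D d P)" "arr (ShM D d x) (Sh D d E) (Sh D d F)"
    using arr_shift e y i x by blast+
  define w where "w = ShM D d y \<cdot> h"
  have w: "arr w E (Sh D d E)" unfolding w_def using arr_comp[OF h ed(2)] .
  have xw: "ShM D d x \<cdot> w = h"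
    unfolding w_def using assoc[OF h ed(2,4)] shift_comp[OF y(1) x] y P id_left[OF h] by (simp add: shm_id)
  have iw: "arr (ShM D d i \<cdot> w) E (Sh D d P)" using arr_comp[OF w ed(3)] .
  \<comment> \<open>Here w is h transported to E, so e sends both g and \<open>i w\<close> to h. The
    difference is killed by e, and its shift by -d is the inclusion j of the kernel summand
    E[-d].\<close>
  define k where "k = g - ShM D d i \<cdot> w"
  have k: "arr k E (Sh D d P)" unfolding k_def using g iw arr_diff by blast
  have ek: "ShM D d e \<cdot> k = 0"
    unfolding k_def using comp_diff_right[OF ed(1) g iw] eg assoc[OF w ed(3,1)] shift_comp[OF i e] ei xw
    by simp
  have Ed: "Sh D d (Sh D (- d) E) = E" "Sh D (- d) E \<in> Ob D" using P by (simp_all add: sh_sh sh_zero sh_ob)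
  define j where "j = ShM D (- d) k"
  have j: "arr j (Sh D (- d) E) P"
    unfolding j_def using arr_shift[OF k, of "- d"] PD(1) by (simp add: sh_sh sh_zero)
  have jd: "ShM D d j = k" unfolding j_def using shift_cancel(2)[OF k] .
  have "ShM D d (e \<cdot> j) = ShM D d 0" using shift_comp[OF j e] jd ek shift_zero[OF P(2)] by simp
  then have ej: "e \<cdot> j = 0" using shift_inj[OF arr_comp[OF j e] arr_zero[OF Ed(2) P(3)]] by blast
  have pj: "p \<cdot> j = 0" unfolding p_def using assoc[OF j e y(1)] ej comp_zero_right[OF y(1)] by simp
  \<comment> \<open>The coordinate along h, read as a map of degree 0 into the graded Hom from E to
    E[-d]; the universal property turns it into the projection q. It vanishes in degree 0 because d
    is nonzero, which gives \<open>q i = 0\<close>.\<close>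
  define l where "l n v = (if n = d then Scale D (\<kappa> v) (Id D E) else 0)" for n v
  have "klinear_on (Scale D) (Hom D E (Sh D n F)) (Scale D) (l n)" for n
    using \<kappa>(1) unfolding klinear_on_def l_def by (auto simp: vs.scale_left_distrib)
  moreover have "arr (l n v) E (Sh D n (Sh D (- d) E))" if "arr v E (Sh D n F)" for n v
    unfolding l_def using Ed arr_scale[OF arr_id[OF P(2)]] arr_zero[OF P(2) sh_ob[OF Ed(2)]] by simp
  ultimately obtain q where q: "arr q P (Sh D (- d) E)"
    "\<And>n v. arr v E (Sh D n F) \<Longrightarrow> ShM D n q \<cdot> \<iota> n v = l n v"
    using tensor_object_factor[OF P Ed(2), of l] by blast
  have qi: "q \<cdot> i = 0" using q(2)[OF x0] shift_0[OF q(1)] d by (simp add: i_def l_def)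
  have qg: "ShM D d q \<cdot> g = Id D E" using q(2)[OF h] \<kappa>(3) by (simp add: g_def l_def)
  have qd: "arr (ShM D d q) (Sh D d P) E" using arr_shift[OF q(1), of d] Ed by simp
  have "ShM D d (q \<cdot> j) = ShM D d q \<cdot> k" using shift_comp[OF j q(1)] jd by simp
  also have "\<dots> = Id D E - (ShM D d q \<cdot> ShM D d i) \<cdot> w"
    unfolding k_def using comp_diff_right[OF qd g iw] qg assoc[OF w ed(3) qd] by simp
  also have "\<dots> = ShM D d (Id D (Sh D (- d) E))"
    using shift_comp[OF i q(1), of d] qi shift_zero[OF P(2)] comp_zero_left[OF w] Ed by (simp add: shm_id)
  finally have qj: "q \<cdot> j = Id D (Sh D (- d) E)"
    using shift_inj[OF arr_comp[OF j q(1)] arr_id[OF Ed(2)]] by blast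
  have jq: "arr (j \<cdot> q) P P" and ip: "arr (i \<cdot> p) P P" using arr_comp i p j q by blast+
  have m: "arr (j \<cdot> q + i \<cdot> p) P P" using jq ip arr_add by blast
  have mi: "(j \<cdot> q + i \<cdot> p) \<cdot> i = i"
    using comp_add_left[OF i jq ip] assoc[OF i q(1) j] assoc[OF i p i] qi pi comp_zero_right[OF j] id_right[OF i]
    by simp
  have mg: "ShM D d (j \<cdot> q + i \<cdot> p) \<cdot> g = g"
  proof -
    have kd: "arr k (Sh D d (Sh D (- d) E)) (Sh D d P)" using k Ed by simp
    have "ShM D d (j \<cdot> q + i \<cdot> p) \<cdot> g = ShM D d (j \<cdot> q) \<cdot> g + ShM D d (i \<cdot> p) \<cdot> g"
      using shift_add[OF jq ip] comp_add_left[OF g arr_shift[OF jq] arr_shift[OF ip]] by simp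
    also have "ShM D d (j \<cdot> q) \<cdot> g = k"
      using shift_comp[OF q(1) j, of d] jd assoc[OF g qd k] qg id_right[OF k] by simp
    also have "ShM D d p \<cdot> g = w"
      unfolding p_def w_def using shift_comp[OF e y(1)] assoc[OF g ed(1,2)] eg by simp
    then have "ShM D d (i \<cdot> p) \<cdot> g = ShM D d i \<cdot> w"
      using shift_comp[OF p i, of d] assoc[OF g arr_shift[OF p] ed(3)] by simp
    finally show ?thesis by (simp add: k_def)
  qed
  \<comment> \<open>By linearity it suffices to test on i and g, the images under
    \<open>\<iota>\<close> of the basis vectors x and h; these are \<open>mi\<close> and
    \<open>mg\<close>.\<close>
  have sum: "j \<cdot> q + i \<cdot> p = Id D P"
  proof (rule tensor_object_endo[OF P m])
    fix n v assume v: "arr v E (Sh D n F)"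
    note mn = arr_shift[OF m, of n]
    consider "n = 0" | "n = d" | "n \<noteq> 0" "n \<noteq> d" by blast
    then show "ShM D n (j \<cdot> q + i \<cdot> p) \<cdot> \<iota> n v = \<iota> n v"
    proof cases
      case 1
      obtain r where r: "v = Scale D r x" using V0 v 1 P by (auto simp: sh_zero)
      have "\<iota> n v = Scale D r i" unfolding r i_def 1 using PD(4)[OF x0] .
      then show ?thesis using comp_scale_right[OF m i] mi shift_0[OF m] 1 by simp
    next
      case 2
      have "\<iota> n v = Scale D (\<kappa> v) g" unfolding g_def 2 using PD(4)[OF h] \<kappa>(2) v 2 by metis
      then show ?thesis using comp_scale_right[OF arr_shift[OF m] g] mg 2 by simp
    next
      case 3
      have "\<iota> n (Scale D 0 v) = Scale D 0 (\<iota> n v)" using PD(4)[OF v] .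
      then have "\<iota> n v = 0" using Vn[OF v] 3 by simp
      then show ?thesis using comp_zero_right[OF mn] by simp
    qed
  qed
  have "Dist D (Sh D (- d) E) P E j p 0"
    using split_dist[OF j i q(1) p qj pi qi pj sum] .
  \<comment> \<open>The rotated split triangle shows that p has cone E[-d][1]. Since x is invertible
    and \<open>x p = e\<close>, the cone of e is the same.\<close>
  then have R: "Dist D P E (Sh D 1 (Sh D (- d) E)) p 0 (- ShM D 1 j)" using dist_rotate by blast
  have idP: "arr (Id D P) P P" "Id D P \<cdot> Id D P = Id D P" using arr_id[OF PD(1)] id_left by blast+
  have "x \<cdot> p = e \<cdot> Id D P"
    unfolding p_def using assoc[OF e y(1) x] y id_left[OF e] id_right[OF e] by simp
  from cone_iso[OF R C idP(1) idP(1) idP(2) idP(2) x y(1) y(2) y(3) this]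
  have "iso (Sh D (1 - d) E) C" using P by (simp add: sh_sh)
  then show ?thesis using iso_sym by blast
qed

section \<open>Spherical objects and the cone of the evaluation\<close>

lemma dual_numbers_part_cases:
  assumes "p \<in> dual_numbers_part d n" "d > 0"
  shows "n = 0 \<Longrightarrow> p = smult (coeff p 0) 1"
    and "n = d \<Longrightarrow> p = smult (coeff p 1) [:0, 1:]"
    and "n \<noteq> 0 \<Longrightarrow> n \<noteq> d \<Longrightarrow> p = 0"
proof -
  \<comment> \<open>The k-th coefficient lives in degree \<open>k d\<close> and vanishes for k at
    least 2; since d > 0, degrees 0 and d are distinct and each homogeneous part is at most a
    line.\<close>
  have "coeff p k = 0" if "int k * d \<noteq> n \<or> k \<ge> 2" for k
    using assms that coeff_eq_0[of p k] unfolding dual_numbers_part_def by force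
  note * = this
  have eq: "p = [:coeff p 0, coeff p 1:]"
  proof (rule poly_eqI)
    fix k show "coeff p k = coeff [:coeff p 0, coeff p 1:] k"
      using *[of k] by (cases k; cases "k - 1") (auto simp: coeff_pCons split: nat.splits)
  qed
  show "p = smult (coeff p 0) 1" if "n = 0"
    using eq *[of 1] that assms by (simp add: one_pCons)
  show "p = smult (coeff p 1) [:0, 1:]" if "n = d"
    using eq *[of 0] that assms by simp
  show "p = 0" if "n \<noteq> 0" "n \<noteq> d"
    using eq *[of 0] *[of 1] that by simp
qed

text \<open>All of this is pulled back along the isomorphism with the dual numbers: h is the
  preimage of the generator, \<open>\<kappa>\<close> reads off its coefficient, and E is nonzero
  because its identity corresponds to 1.\<close>

lemma spherical_basis:
  assumes sph: "spherical_object D d E" and d: "d > 0"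
  shows "E \<in> Ob D" "\<not> zero_object D E"
    and "\<exists>h \<kappa>. arr h E (Sh D d E) \<and> klinear_on (Scale D) (Hom D E (Sh D d E)) (*) \<kappa> \<and>
      (\<forall>v. arr v E (Sh D d E) \<longrightarrow> v = Scale D (\<kappa> v) h) \<and> \<kappa> h = 1"
    and "\<And>v. arr v E E \<Longrightarrow> \<exists>k. v = Scale D k (Id D E)"
    and "\<And>v n. arr v E (Sh D n E) \<Longrightarrow> n \<noteq> 0 \<Longrightarrow> n \<noteq> d \<Longrightarrow> v = 0"
proof -
  show E: "E \<in> Ob D" using sph by (simp add: spherical_object_def)
  obtain \<phi> where \<phi>: "\<forall>i. klinear_on (Scale D) (Hom D E (Sh D i E)) smult (\<phi> i) \<and>
      bij_betw (\<phi> i) (Hom D E (Sh D i E)) (dual_numbers_part d i)"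
    and one: "\<phi> 0 (Id D E) = 1"
    using sph[unfolded spherical_object_def, THEN conjunct2, THEN conjunct1]
    by (elim exE conjE) (rule that)
  have lin: "klinear_on (Scale D) (Hom D E (Sh D i E)) smult (\<phi> i)"
    and bij: "bij_betw (\<phi> i) (Hom D E (Sh D i E)) (dual_numbers_part d i)" for i
    using \<phi> by blast+
  have part: "\<phi> n v \<in> dual_numbers_part d n" if "arr v E (Sh D n E)" for n v
    using that bij[of n] by (auto simp: arr_def bij_betw_def)
  have inj: "v = w" if "arr v E (Sh D n E)" "arr w E (Sh D n E)" "\<phi> n v = \<phi> n w" for n v w
    using that bij[of n] by (auto simp: arr_def bij_betw_def inj_on_def)
  have scale: "\<phi> n (Scale D c v) = smult c (\<phi> n v)" if "arr v E (Sh D n E)" for n c v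
    using that lin[of n] by (auto simp: arr_def klinear_on_def)
  have zero: "\<phi> n 0 = 0" for n
    using scale[of 0 n 0] arr_zero[OF E sh_ob[OF E]] by simp
  have id0: "arr (Id D E) E (Sh D 0 E)" using arr_id[OF E] E by (simp add: sh_zero)
  show "\<not> zero_object D E" using one zero[of 0] zero_object_iff[OF E] by auto
  show "\<exists>k. v = Scale D k (Id D E)" if "arr v E E" for v
  proof -
    have v: "arr v E (Sh D 0 E)" using that E by (simp add: sh_zero)
    have "\<phi> 0 v = \<phi> 0 (Scale D (coeff (\<phi> 0 v) 0) (Id D E))"
      using dual_numbers_part_cases(1)[OF part[OF v] d refl] scale[OF id0] one by simp
    then show ?thesis using inj[OF v arr_scale[OF id0]] by blast
  qed
  show "v = 0" if v: "arr v E (Sh D n E)" and n: "n \<noteq> 0" "n \<noteq> d" for v n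
    using inj[OF v arr_zero[OF E sh_ob[OF E]]] dual_numbers_part_cases(3)[OF part[OF v] d n] zero by simp
  have "[:0, 1:] \<in> dual_numbers_part d d"
    by (auto simp: dual_numbers_part_def coeff_pCons split: nat.splits)
  then obtain h where h: "arr h E (Sh D d E)" "\<phi> d h = [:0, 1:]"
    using bij[of d] E sh_ob unfolding bij_betw_def arr_def by (metis imageE)
  let ?\<kappa> = "\<lambda>v. coeff (\<phi> d v) 1"
  have "klinear_on (Scale D) (Hom D E (Sh D d E)) (*) ?\<kappa>"
    using lin[of d] by (auto simp: klinear_on_def)
  moreover have "v = Scale D (?\<kappa> v) h" if v: "arr v E (Sh D d E)" for v
    using inj[OF v arr_scale[OF h(1)]] dual_numbers_part_cases(2)[OF part[OF v] d refl] scale[OF h(1)] h(2)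
    by metis
  moreover have "?\<kappa> h = 1" using h(2) by simp
  ultimately show "\<exists>h \<kappa>. arr h E (Sh D d E) \<and> klinear_on (Scale D) (Hom D E (Sh D d E)) (*) \<kappa> \<and>
      (\<forall>v. arr v E (Sh D d E) \<longrightarrow> v = Scale D (\<kappa> v) h) \<and> \<kappa> h = 1"
    using h(1) by blast
qed

text \<open>The evaluation triangle is available only for objects in the image of the enhancement,
  hence for some F isomorphic to E. The basis of the graded Hom is transported along this
  isomorphism.\<close>

lemma spherical_cone:
  assumes sph: "spherical_object D d E" and d: "d > 0" and EF: "iso E F"
    and P: "tensor_object D (\<lambda>n. Hom D E (Sh D n F)) E P \<iota>"
    and C: "Dist D P F C e c c'" and ev: "\<And>n v. arr v E (Sh D n F) \<Longrightarrow> ShM D n e \<cdot> \<iota> n v = v"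
  shows "iso C (Sh D (1 - d) E)"
proof -
  note s = spherical_basis[OF sph d]
  have F: "F \<in> Ob D" using EF iso_ob by blast
  obtain x y where x: "arr x E F" and y: "arr y F E" "y \<cdot> x = Id D E" "x \<cdot> y = Id D F"
    using EF iso_def by metis
  obtain h \<kappa> where h: "arr h E (Sh D d E)" and \<kappa>: "klinear_on (Scale D) (Hom D E (Sh D d E)) (*) \<kappa>"
      "\<And>v. arr v E (Sh D d E) \<Longrightarrow> v = Scale D (\<kappa> v) h" "\<kappa> h = 1"
    using s(3) by blast
  have xn: "arr (ShM D n x) (Sh D n E) (Sh D n F)" and yn: "arr (ShM D n y) (Sh D n F) (Sh D n E)" for n
    using arr_shift x y by blast+
  have xy: "ShM D n x \<cdot> (ShM D n y \<cdot> v) = v" if "arr v E (Sh D n F)" for n v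
    using assoc[OF that yn xn] shift_comp[OF y(1) x] y F id_left[OF that] by (simp add: shm_id)
  have yx: "ShM D n y \<cdot> (ShM D n x \<cdot> v) = v" if "arr v E (Sh D n E)" for n v
    using assoc[OF that xn yn] shift_comp[OF x y(1)] y s(1) id_left[OF that] by (simp add: shm_id)
  have yv: "arr (ShM D n y \<cdot> v) E (Sh D n E)" if "arr v E (Sh D n F)" for n v
    using arr_comp[OF that yn] .
  have "d \<noteq> 0" using d by simp
  show ?thesis
  proof (rule tensor_object_cone[OF P s(1) F C ev \<open>d \<noteq> 0\<close> x y, where
        h = "ShM D d x \<cdot> h" and \<kappa> = "\<lambda>v. \<kappa> (ShM D d y \<cdot> v)"])
    fix v assume v: "arr v E F"
    then obtain k where "y \<cdot> v = Scale D k (Id D E)" using s(4)[OF arr_comp[OF v y(1)]] by blast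
    then have "x \<cdot> (y \<cdot> v) = Scale D k x"
      using comp_scale_right[OF x arr_id[OF s(1)]] id_right[OF x] by simp
    then show "\<exists>k. v = Scale D k x" using assoc[OF v y(1) x] y id_left[OF v] by auto
  next
    show "arr (ShM D d x \<cdot> h) E (Sh D d F)" using arr_comp[OF h xn] .
    show "\<kappa> (ShM D d y \<cdot> (ShM D d x \<cdot> h)) = 1" using yx[OF h] \<kappa>(3) by simp
    have V: "v \<in> Hom D E (Sh D n F) \<longleftrightarrow> arr v E (Sh D n F)" for v n using s(1) F by (simp add: arr_def sh_ob)
    have V': "v \<in> Hom D E (Sh D n E) \<longleftrightarrow> arr v E (Sh D n E)" for v n using s(1) by (simp add: arr_def sh_ob)
    show "klinear_on (Scale D) (Hom D E (Sh D d F)) (*) (\<lambda>v. \<kappa> (ShM D d y \<cdot> v))"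
      using \<kappa>(1) yv comp_add_right[OF yn, where X = E] comp_scale_right[OF yn, where X = E]
      by (simp add: klinear_on_def Ball_def V V')
  next
    fix v assume v: "arr v E (Sh D d F)"
    show "v = Scale D (\<kappa> (ShM D d y \<cdot> v)) (ShM D d x \<cdot> h)"
      using \<kappa>(2)[OF yv[OF v]] comp_scale_right[OF xn h] xy[OF v] by metis
  next
    fix n v assume v: "arr v E (Sh D n F)" and n: "n \<noteq> 0" "n \<noteq> d"
    show "v = 0" using s(5)[OF yv[OF v] n] xy[OF v] comp_zero_right[OF xn] by metis
  qed
qed

text \<open>The passage from dg data to triangles: F' is the image of a dg object isomorphic to F,
  and e is the map induced by the dg evaluation. What follows about T on objects rests on this
  triangle and on exactness of T.\<close>

lemma spherical_twist_cone:
  assumes enh: "dg_enhancement D A \<Psi>" and tw: "spherical_twist D A \<Psi> E T" and E: "E \<in> Ob D" and F: "F \<in> Ob D"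
  shows "\<exists>F' P \<iota> C e c c'. iso F F' \<and> iso (FOb T F') C \<and> Dist D P F' C e c c' \<and>
    tensor_object D (\<lambda>n. Hom D E (Sh D n F')) E P \<iota> \<and>
    (\<forall>n v. arr v E (Sh D n F') \<longrightarrow> ShM D n e \<cdot> \<iota> n v = v)"
proof -
  have ess: "\<forall>F\<in>Ob D. \<exists>X\<in>DOb A. \<exists>f. is_iso D (EOb \<Psi> X) F f"
    and cones: "\<forall>X\<in>DOb A. \<forall>Y\<in>DOb A. \<forall>f\<in>cycles A X Y 0. \<forall>C i p j q. dg_cone A X Y f C i p j q \<longrightarrow>
        Dist D (EOb \<Psi> X) (EOb \<Psi> Y) (EOb \<Psi> C) (EMor \<Psi> 0 f) (EMor \<Psi> 0 j) (EMor \<Psi> 1 p)"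
    and "\<forall>X\<in>DOb A. EOb \<Psi> X \<in> Ob D \<and> EMor \<Psi> 0 (DId A X) = Id D (EOb \<Psi> X)"
    using enh unfolding dg_enhancement_def by - (elim conjE, assumption)+
  then have obs: "\<And>X. X \<in> DOb A \<Longrightarrow> EOb \<Psi> X \<in> Ob D" by blast
  obtain S \<epsilon> C i p j q \<tau> where ev: "evaluation_lift D A \<Psi> E S \<epsilon>"
    and cone: "\<And>X. X \<in> DOb A \<Longrightarrow> dg_cone A (FOb S X) X (\<epsilon> X) (C X) (i X) (p X) (j X) (q X)"
    and \<tau>: "\<And>X. X \<in> DOb A \<Longrightarrow> is_iso D (FOb T (EOb \<Psi> X)) (EOb \<Psi> (C X)) (\<tau> X)"
    using tw unfolding spherical_twist_def by blast
  obtain X f where X: "X \<in> DOb A" "is_iso D (EOb \<Psi> X) F f"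
    using ess F by blast
  have "\<forall>X\<in>Ob D. FOb T X \<in> Ob D \<and> FMor T (Id D X) = Id D (FOb T X)"
    using tw unfolding spherical_twist_def exact_autoequivalence_def exact_functor_def linear_functor_def
    by (elim conjE)
  then have TX: "FOb T (EOb \<Psi> X) \<in> Ob D" using obs[OF X(1)] by blast
  have CX: "C X \<in> DOb A" using cone[OF X(1)] unfolding dg_cone_def by blast
  have "\<forall>X\<in>DOb A. FOb S X \<in> DOb A \<and> FMor S (DId A X) = DId A (FOb S X)"
    and "\<forall>X\<in>DOb A. \<epsilon> X \<in> cycles A (FOb S X) X 0"
    using ev unfolding evaluation_lift_def dg_functor_def by - (elim conjE, assumption)+
  then have SX: "FOb S X \<in> DOb A" and \<epsilon>: "\<epsilon> X \<in> cycles A (FOb S X) X 0"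
    using X(1) by blast+
  obtain \<iota> where \<iota>: "\<forall>X\<in>DOb A.
      tensor_object D (\<lambda>n. Hom D E (Sh D n (EOb \<Psi> X))) E (EOb \<Psi> (FOb S X)) (\<iota> X)"
    "\<forall>X\<in>DOb A. \<forall>n. \<forall>v\<in>Hom D E (Sh D n (EOb \<Psi> X)). ShM D n (EMor \<Psi> 0 (\<epsilon> X)) \<cdot> \<iota> X n v = v"
    using ev unfolding evaluation_lift_def by (elim conjE exE) (rule that)
  have "Dist D (EOb \<Psi> (FOb S X)) (EOb \<Psi> X) (EOb \<Psi> (C X)) (EMor \<Psi> 0 (\<epsilon> X)) (EMor \<Psi> 0 (j X)) (EMor \<Psi> 1 (p X))"
    using cones SX X(1) \<epsilon> cone[OF X(1)] by blast
  moreover have "iso F (EOb \<Psi> X)" using iso_sym isoI[OF obs[OF X(1)] F X(2)] by blast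
  moreover have "iso (FOb T (EOb \<Psi> X)) (EOb \<Psi> (C X))" using isoI[OF TX obs[OF CX] \<tau>[OF X(1)]] .
  moreover have "\<forall>n v. arr v E (Sh D n (EOb \<Psi> X)) \<longrightarrow> ShM D n (EMor \<Psi> 0 (\<epsilon> X)) \<cdot> \<iota> X n v = v"
    using \<iota>(2) X(1) unfolding arr_def by blast
  moreover have "tensor_object D (\<lambda>n. Hom D E (Sh D n (EOb \<Psi> X))) E (EOb \<Psi> (FOb S X)) (\<iota> X)"
    using \<iota>(1) X(1) by blast
  ultimately show ?thesis by blast
qed

end

context exact_endofunctor
begin

lemma twist_triangle:
  assumes "dg_enhancement D A \<Psi>" "spherical_twist D A \<Psi> E T" "E \<in> Ob D" "finite_type D" "F \<in> Ob D"
  shows "\<exists>Q. gens E Q \<and> tri F (FOb T F) Q"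
proof -
  obtain F' P \<iota> C e c c' where *: "iso F F'" "iso (FOb T F') C" "Dist D P F' C e c c'"
    "tensor_object D (\<lambda>n. Hom D E (Sh D n F')) E P \<iota>"
    using spherical_twist_cone[OF assms(1-3,5)] by blast
  have P: "gens E P" using tensor_object_gens[OF assms(4) *(4) assms(3)] iso_ob[OF *(1)] by blast
  have "tri P F' C" using * tri_def by blast
  then have "tri F' C (Sh D 1 P)" using tri_rotate by blast
  moreover have "iso F' F" "iso C (FOb T F)" using *(1,2) iso_sym iso_trans F_iso by blast+
  moreover have "iso (Sh D 1 P) (Sh D 1 P)" using iso_refl tri_ob calculation(1) by blast
  ultimately have "tri F (FOb T F) (Sh D 1 P)" using tri_iso by blast
  then show ?thesis using gens_shift[OF P] by blast
qed

lemma twist_sphere: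
  assumes "dg_enhancement D A \<Psi>" "spherical_twist D A \<Psi> E T" "spherical_object D d E" "d > 0"
  shows "iso (FOb T E) (Sh D (1 - d) E)"
proof -
  have E: "E \<in> Ob D" using assms(3) by (simp add: spherical_object_def)
  obtain F' P \<iota> C e c c' where *: "iso E F'" "iso (FOb T F') C" "Dist D P F' C e c c'"
    "tensor_object D (\<lambda>n. Hom D E (Sh D n F')) E P \<iota>"
    "\<And>n v. arr v E (Sh D n F') \<Longrightarrow> ShM D n e \<cdot> \<iota> n v = v"
    using spherical_twist_cone[OF assms(1,2) E E] by blast
  have "iso C (Sh D (1 - d) E)" using spherical_cone[OF assms(3,4) *(1,4,3,5)] .
  then show ?thesis using *(1,2) F_iso iso_trans by blast
qed

text \<open>The tensor object P vanishes, so F' -> C is an isomorphism.\<close>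

lemma twist_orthogonal:
  assumes "dg_enhancement D A \<Psi>" "spherical_twist D A \<Psi> E T" "E \<in> Ob D" "F \<in> right_orthogonal D E"
  shows "iso (FOb T F) F"
proof -
  have F: "F \<in> Ob D" "\<And>n v. arr v E (Sh D n F) \<Longrightarrow> v = 0"
    using assms(4) unfolding right_orthogonal_def arr_def by blast+
  obtain F' P \<iota> C e c c' where *: "iso F F'" "iso (FOb T F') C" "Dist D P F' C e c c'"
    "tensor_object D (\<lambda>n. Hom D E (Sh D n F')) E P \<iota>"
    using spherical_twist_cone[OF assms(1-3) F(1)] by blast
  have "v = 0" if "arr v E (Sh D n F')" for n v
    using no_arr_retr_to[OF iso_retr[OF iso_shift[OF iso_sym[OF *(1)]]] _ that] F(2) by blast
  then have P: "zero_object D P" using tensor_object_zero[OF *(4) assms(3)] iso_ob[OF *(1)] by blast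
  have "tri F' C (Sh D 1 P)" using *(3) tri_rotate tri_def by blast
  then have "iso F' C" using tri_zero_right zero_shift[OF P] by blast
  then have "iso F C" "iso (FOb T F) C" using *(1,2) F_iso iso_trans by blast+
  then show ?thesis using iso_sym iso_trans by blast
qed

end

section \<open>Entropy\<close>

lemma subadditive_multiple:
  fixes a :: "nat \<Rightarrow> real"
  assumes "\<And>m n. a (m + n) \<le> a m + a n"
  shows "a (q * m + r) \<le> real q * a m + a r"
proof (induction q)
  case (Suc q)
  have "a (Suc q * m + r) \<le> a m + a (q * m + r)"
    using assms[of m "q * m + r"] by (simp add: add.assoc)
  then show ?case using Suc by (simp add: algebra_simps)
qed simp

text \<open>Fekete's lemma, with the infimum over positive n as limit; the linear lower bound keeps
  that infimum finite.\<close>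

lemma fekete:
  fixes a :: "nat \<Rightarrow> real"
  assumes sub: "\<And>m n. a (m + n) \<le> a m + a n" and low: "\<And>n. c * real n \<le> a n"
  shows "convergent (\<lambda>n. a n / real n)"
proof -
  define L where "L = (INF n\<in>{1..}. a n / real n)"
  have bdd: "bdd_below ((\<lambda>n. a n / real n) ` {1..})"
    by (intro bdd_belowI[of _ c]) (auto simp: field_simps low)
  have lower: "L \<le> a n / real n" if "n \<ge> 1" for n
    unfolding L_def using bdd that by (intro cINF_lower) auto
  have "(\<lambda>n. a n / real n) \<longlonglongrightarrow> L"
  proof (rule LIMSEQ_I)
    fix e :: real assume e: "e > 0"
    have "\<exists>m\<in>{1..}. a m / real m < L + e / 2"
      using cINF_less_iff[OF _ bdd, of "L + e / 2"] e unfolding L_def by auto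
    then obtain m where m: "m \<ge> 1" "a m / real m < L + e / 2" by auto
    \<comment> \<open>M absorbs the error of division by m: the remainder contributes
      \<open>a r\<close> for some r < m, and replacing the quotient q by n / m changes the main term
      by at most \<open>\<bar>a m\<bar>\<close>.\<close>
    define M where "M = \<bar>a m\<bar> + Max ((\<lambda>r. \<bar>a r\<bar>) ` {..<m})"
    have M: "\<bar>a m\<bar> + \<bar>a r\<bar> \<le> M" if "r < m" for r
      unfolding M_def using that by (intro add_left_mono Max_ge) auto
    have upper: "a n / real n \<le> a m / real m + M / real n" if n: "n \<ge> 1" for n
    proof -
      define q r where "q = n div m" and "r = n mod m"
      have r: "r < m" unfolding r_def using m by simp
      have n_eq: "n = q * m + r" unfolding q_def r_def by simp
      have q: "real q = (real n - real r) / real m" using m n_eq by (simp add: field_simps)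
      have "a (q * m + r) \<le> real q * a m + a r" by (rule subadditive_multiple[OF sub])
      moreover have "real q * a m = real n * (a m / real m) - (real r / real m) * a m"
        unfolding q using m by (simp add: field_simps)
      moreover have "\<bar>(real r / real m) * a m\<bar> \<le> 1 * \<bar>a m\<bar>"
        unfolding abs_mult using r m by (intro mult_right_mono) auto
      ultimately have "a n \<le> real n * (a m / real m) + M"
        using M[OF r] unfolding n_eq[symmetric] by linarith
      then have "a n / real n \<le> (real n * (a m / real m) + M) / real n"
        by (intro divide_right_mono) auto
      also have "\<dots> = a m / real m + M / real n" using n by (simp add: add_divide_distrib)
      finally show ?thesis .
    qed
    have "(\<lambda>n. M / real n) \<longlonglongrightarrow> 0" by (rule lim_const_over_n)
    then obtain N where N: "\<And>n. n \<ge> N \<Longrightarrow> \<bar>M / real n\<bar> < e / 2"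
      using LIMSEQ_D[of _ 0 "e / 2"] e by fastforce
    show "\<exists>N. \<forall>n\<ge>N. norm (a n / real n - L) < e"
    proof (intro exI[of _ "max N 1"] allI impI)
      fix n assume "n \<ge> max N 1"
      then have "L \<le> a n / real n" "a n / real n \<le> a m / real m + M / real n" "\<bar>M / real n\<bar> < e / 2"
        using lower upper N by auto
      then show "norm (a n / real n - L) < e" using m(2) unfolding real_norm_def by linarith
    qed
  qed
  then show ?thesis by (auto simp: convergent_def)
qed

lemma ln_growth_limit_zero:
  assumes "0 \<le> C" shows "(\<lambda>n. ln (1 + C * real n) / real n) \<longlonglongrightarrow> 0"
proof (rule tendsto_sandwich[OF _ _ tendsto_const])
  show "\<forall>\<^sub>F n in sequentially. 0 \<le> ln (1 + C * real n) / real n"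
    using assms by (intro always_eventually allI divide_nonneg_nonneg) auto
  have "ln (1 + C * real n) / real n \<le> (ln (1 + C) + ln (real n)) / real n" if "n \<ge> 1" for n
  proof (rule divide_right_mono)
    have "1 + C * real n \<le> (1 + C) * real n" using that assms by (simp add: algebra_simps)
    then have "ln (1 + C * real n) \<le> ln ((1 + C) * real n)"
      using assms that by (subst ln_le_cancel_iff) (auto intro: add_pos_nonneg)
    then show "ln (1 + C * real n) \<le> ln (1 + C) + ln (real n)"
      using assms that by (simp add: ln_mult)
  qed auto
  then show "\<forall>\<^sub>F n in sequentially. ln (1 + C * real n) / real n \<le> ln (1 + C) / real n + ln (real n) / real n"
    by (auto simp: eventually_sequentially add_divide_distrib intro!: exI[of _ 1])
  have "(\<lambda>n. ln (1 + C) / real n + ln (real n) / real n) \<longlonglongrightarrow> 0 + 0"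
    by (intro tendsto_add lim_const_over_n filterlim_compose[OF ln_x_over_x_tendsto_0 filterlim_real_sequentially])
  then show "(\<lambda>n. ln (1 + C) / real n + ln (real n) / real n) \<longlonglongrightarrow> 0" by simp
qed

section \<open>Growth of complexity along the iterates of the twist\<close>

locale spherical_twist_setting = exact_endofunctor D T
  for D :: "('o, 'm::ab_group_add, 'k::field) tri_cat" (structure)
    and T :: "('o, 'm, 'o, 'm) func" +
  fixes A :: "('a, 'r::ab_group_add, 'k) dg_cat"
    and \<Psi> :: "('a, 'r, 'o, 'm) enh"
    and d :: int
    and E :: 'o
  assumes enh: "dg_enhancement D A \<Psi>"
    and ft: "finite_type D"
    and ex_gen: "\<exists>G. split_generator D G"
    and d: "d > 0"
    and sph: "spherical_object D d E"
    and twist: "spherical_twist D A \<Psi> E T"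
begin

lemmas E_ob = spherical_basis(1)[OF sph d]
lemmas E_nonzero = spherical_basis(2)[OF sph d]

text \<open>The autoequivalence is faithful and sends the identity and 0 to the same arrow. This
  keeps all iterates of G nonzero, so the logarithms of their complexities are finite.\<close>

lemma T_zero_reflect:
  assumes X: "X \<in> Ob D" and z: "zero_object D (FOb T X)" shows "zero_object D X"
proof -
  have "bij_betw (FMor T) (Hom D X X) (Hom D (FOb T X) (FOb T X))"
    using twist X unfolding spherical_twist_def exact_autoequivalence_def by blast
  moreover have "Id D X \<in> Hom D X X" "0 \<in> Hom D X X" using arr_id arr_zero X arr_def by blast+
  moreover have "FMor T (Id D X) = FMor T 0"
    using F_id[OF X] F_zero[OF X] z zero_object_iff[OF F_ob[OF X]] by simp
  ultimately have "Id D X = 0" unfolding bij_betw_def inj_on_def by blast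
  then show ?thesis using zero_object_iff X by blast
qed

lemma Tn_nonzero: "X \<in> Ob D \<Longrightarrow> \<not> zero_object D X \<Longrightarrow> \<not> zero_object D (Tn n X)"
  by (induction n) (auto dest: T_zero_reflect[OF Tn_ob])

lemma gen_nonzero: "split_generator D G \<Longrightarrow> \<not> zero_object D G"
  using split_generator_detects[OF _ E_ob E_nonzero] zero_arr_from by blast

lemma gen_ob: "split_generator D G \<Longrightarrow> G \<in> Ob D"
  by (simp add: split_generator_def)

definition growth :: "real \<Rightarrow> 'o \<Rightarrow> nat \<Rightarrow> real" where
  "growth t G n = cx t G (Tn n G)"

lemma growth_pos: "split_generator D G \<Longrightarrow> 0 < growth t G n"
  unfolding growth_def using cx_pos[OF ft] Tn_ob Tn_nonzero gen_ob gen_nonzero by blast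

text \<open>Reach \<open>T^m G\<close> from G, then use the image under \<open>T^m\<close> of a
  tower reaching \<open>T^n G\<close>.\<close>

lemma growth_mult:
  assumes G: "split_generator D G" shows "growth t G (m + n) \<le> growth t G m * growth t G n"
proof -
  have GD: "gens G X" if "X \<in> Ob D" for X using split_generator_gens[OF G that] .
  have G': "gens (Tn m G) (Tn m (Tn n G))" using Tn_gens[OF GD[OF Tn_ob[OF gen_ob[OF G]]]] .
  have "growth t G (m + n) = cx t G (Tn m (Tn n G))" by (simp add: growth_def funpow_add)
  also have "\<dots> \<le> cx t G (Tn m G) * cx t (Tn m G) (Tn m (Tn n G))"
    using cx_mult[OF GD[OF Tn_ob[OF gen_ob[OF G]]] G'] .
  also have "\<dots> \<le> cx t G (Tn m G) * cx t G (Tn n G)"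
    using Tn_cx[OF GD[OF Tn_ob[OF gen_ob[OF G]]]] cx_nonneg[OF GD[OF Tn_ob[OF gen_ob[OF G]]]]
    by (rule mult_left_mono)
  finally show ?thesis by (simp add: growth_def)
qed

text \<open>The chain is G', G, \<open>T^n G\<close>, \<open>T^n G'\<close>; its last link is the
  image of the link from G to G', so both changes of generator cost a factor independent of
  n.\<close>

lemma growth_compare:
  assumes G: "split_generator D G" and G': "split_generator D G'"
  shows "growth t G' n \<le> (cx t G' G * cx t G G') * growth t G n"
proof -
  note ob = gen_ob[OF G] gen_ob[OF G']
  note gens = split_generator_gens[OF G] split_generator_gens[OF G']
  have T': "gens (Tn n G) (Tn n G')" using Tn_gens gens ob by blast
  have "growth t G' n \<le> cx t G' (Tn n G) * cx t (Tn n G) (Tn n G')"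
    unfolding growth_def using cx_mult[OF gens(2)[OF Tn_ob[OF ob(1)]] T'] .
  also have "\<dots> \<le> cx t G' (Tn n G) * cx t G G'"
    using Tn_cx[OF gens(1)[OF ob(2)]] cx_nonneg[OF gens(2)[OF Tn_ob[OF ob(1)]]] by (rule mult_left_mono)
  also have "\<dots> \<le> (cx t G' G * cx t G (Tn n G)) * cx t G G'"
    using cx_mult[OF gens(2)[OF ob(1)] gens(1)[OF Tn_ob[OF ob(1)]]] cx_nonneg[OF gens(1)[OF ob(2)]]
    by (rule mult_right_mono)
  finally show ?thesis by (simp add: growth_def algebra_simps)
qed

lemma growth_fixed:
  assumes G: "split_generator D G" and F: "F \<in> Ob D" "\<not> zero_object D F"
    and iso: "iso (FOb T F) (Sh D m F)"
  shows "exp (real_of_int m * t) ^ n \<le> growth t G n"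
proof -
  note gens = split_generator_gens[OF G]
  have pos: "0 < cx t G F" using cx_pos[OF ft G F] .
  have "exp (real_of_int m * t) ^ n * cx t G F = exp (real_of_int (int n * m) * t) * cx t G F"
    by (simp add: exp_of_nat_mult[symmetric] mult.assoc)
  also have "\<dots> = cx t G (Sh D (int n * m) F)" using cx_shift[OF gens[OF F(1)]] by simp
  also have "\<dots> = cx t G (Tn n F)" using cx_iso[OF gens[OF Tn_ob[OF F(1)]] Tn_shift[OF F(1) iso]] by simp
  also have "\<dots> \<le> cx t G (Tn n G) * cx t (Tn n G) (Tn n F)"
    using cx_mult[OF gens[OF Tn_ob[OF gen_ob[OF G]]] Tn_gens[OF gens[OF F(1)]]] .
  also have "\<dots> \<le> growth t G n * cx t G F"
    unfolding growth_def
    using Tn_cx[OF gens[OF F(1)]] cx_nonneg[OF gens[OF Tn_ob[OF gen_ob[OF G]]]] by (rule mult_left_mono)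
  finally show ?thesis using pos by simp
qed

abbreviation \<rho> :: "real \<Rightarrow> real" where
  "\<rho> t \<equiv> exp (real_of_int (1 - d) * t)"

lemma growth_lower: "split_generator D G \<Longrightarrow> \<rho> t ^ n \<le> growth t G n"
  using growth_fixed[OF _ E_ob E_nonzero twist_sphere[OF enh twist sph d]] .

lemma growth_lower_orthogonal:
  assumes "split_generator D G" "F \<in> right_orthogonal D E" "\<not> zero_object D F"
  shows "1 \<le> growth t G n"
proof -
  have F: "F \<in> Ob D" using assms(2) by (simp add: right_orthogonal_def)
  have "iso (FOb T F) (Sh D 0 F)"
    using twist_orthogonal[OF enh twist E_ob assms(2)] F by (simp add: sh_zero)
  from growth_fixed[OF assms(1) F assms(3) this] show ?thesis by simp
qed

lemma growth_Suc:
  assumes G: "split_generator D G"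
  shows "\<exists>C\<ge>0. \<forall>n. growth t G (Suc n) \<le> growth t G n + C * \<rho> t ^ n"
proof -
  note gens = split_generator_gens[OF G] and GD = gen_ob[OF G]
  obtain Q where Q: "gens E Q" "tri G (FOb T G) Q"
    using twist_triangle[OF enh twist E_ob ft GD] by blast
  have QD: "Q \<in> Ob D" using tri_ob Q by blast
  define C where "C = cx t G E * cx t E Q"
  have C: "C \<ge> 0" unfolding C_def using cx_nonneg gens E_ob Q by simp
  have "growth t G (Suc n) \<le> growth t G n + C * \<rho> t ^ n" for n
  proof -
    \<comment> \<open>Unfolding from the inside makes this the middle vertex of \<open>T^n\<close>
      applied to the fixed triangle G -> T G -> Q, so C is independent of n.\<close>
    have "Tn (Suc n) G = Tn n (FOb T G)" by (simp add: funpow_swap1)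
    then have tri: "tri (Tn n G) (Tn (Suc n) G) (Tn n Q)" using Tn_tri[OF Q(2)] by simp
    have "growth t G (Suc n) \<le> growth t G n + cx t G (Tn n Q)"
      unfolding growth_def using cx_tri[OF _ _ tri] gens Tn_ob GD QD by blast
    also have "cx t G (Tn n Q) \<le> cx t G (Tn n E) * cx t (Tn n E) (Tn n Q)"
      using cx_mult[OF gens[OF Tn_ob[OF E_ob]] Tn_gens[OF Q(1)]] .
    also have "\<dots> \<le> cx t G (Tn n E) * cx t E Q"
      using Tn_cx[OF Q(1)] cx_nonneg[OF gens[OF Tn_ob[OF E_ob]]] by (rule mult_left_mono)
    also have "cx t G (Tn n E) = cx t G (Sh D (int n * (1 - d)) E)"
      using cx_iso[OF gens[OF Tn_ob[OF E_ob]] Tn_shift[OF E_ob twist_sphere[OF enh twist sph d]]] .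
    also have "\<dots> = \<rho> t ^ n * cx t G E"
      using cx_shift[OF gens[OF E_ob]] by (simp add: exp_of_nat_mult[symmetric] mult.assoc)
    finally show ?thesis by (simp add: C_def algebra_simps)
  qed
  then show ?thesis using C by blast
qed

text \<open>The increments are at most C times powers of \<open>max 1 (\<rho> t)\<close>. Since this
  base is at least 1, all n of them are dominated by the last power, which leaves a factor linear in
  n.\<close>

lemma growth_upper:
  assumes G: "split_generator D G"
  shows "\<exists>C\<ge>0. \<forall>n. growth t G n \<le> (1 + C * real n) * max 1 (\<rho> t) ^ n"
proof -
  obtain C where C: "C \<ge> 0" "\<And>n. growth t G (Suc n) \<le> growth t G n + C * \<rho> t ^ n"
    using growth_Suc[OF G] by blast
  define M where "M = max 1 (\<rho> t)"
  have "growth t G n \<le> (1 + C * real n) * M ^ n" for n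
  proof (induction n)
    case 0
    then show ?case using cx_self[OF gen_ob[OF G]] by (simp add: growth_def)
  next
    case (Suc n)
    have "C * \<rho> t ^ n \<le> C * M ^ n"
      unfolding M_def using C by (intro mult_left_mono power_mono) auto
    then have "growth t G (Suc n) \<le> (1 + C * real (Suc n)) * M ^ n"
      using C(2)[of n] Suc by (simp add: algebra_simps)
    also have "\<dots> \<le> (1 + C * real (Suc n)) * M ^ Suc n"
      unfolding M_def using C by (intro mult_left_mono power_increasing) auto
    finally show ?case .
  qed
  then show ?thesis using C unfolding M_def by blast
qed

section \<open>From growth to entropy\<close>

abbreviation rate :: "real \<Rightarrow> 'o \<Rightarrow> nat \<Rightarrow> real" where
  "rate t G n \<equiv> ln (growth t G n) / real n"

lemma rate_convergent:
  assumes G: "split_generator D G" shows "convergent (rate t G)"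
proof (rule fekete[where c = "real_of_int (1 - d) * t"])
  show "ln (growth t G (m + n)) \<le> ln (growth t G m) + ln (growth t G n)" for m n
    using growth_mult[OF G] growth_pos[OF G] by (simp flip: ln_mult_pos)
  show "real_of_int (1 - d) * t * real n \<le> ln (growth t G n)" for n
    using growth_lower[OF G, of t n] growth_pos[OF G, of t n]
    by (simp add: ln_ge_iff exp_of_nat2_mult)
qed

text \<open>The comparison constant K contributes only \<open>ln K / n\<close>. Used in both
  directions, this makes the limit independent of the generator.\<close>

lemma rate_limit_le:
  assumes G: "split_generator D G" and G': "split_generator D G'"
    and L: "rate t G \<longlonglongrightarrow> L" and L': "rate t G' \<longlonglongrightarrow> L'"
  shows "L' \<le> L"
proof -
  define K where "K = cx t G' G * cx t G G'"
  have K: "0 < K"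
    unfolding K_def using cx_pos[OF ft] G G' gen_ob gen_nonzero by (intro mult_pos_pos) blast+
  have "rate t G' n \<le> ln K / real n + rate t G n" for n
  proof -
    have "growth t G' n \<le> K * growth t G n" unfolding K_def using growth_compare[OF G G'] .
    then have "ln (growth t G' n) \<le> ln K + ln (growth t G n)"
      using K growth_pos[OF G] growth_pos[OF G'] by (simp flip: ln_mult_pos)
    then show ?thesis by (simp add: add_divide_distrib[symmetric] divide_right_mono)
  qed
  moreover have "(\<lambda>n. ln K / real n + rate t G n) \<longlonglongrightarrow> 0 + L"
    by (intro tendsto_add lim_const_over_n L)
  ultimately show ?thesis using LIMSEQ_le[OF L'] by auto
qed

lemma entropy_limit:
  assumes G: "split_generator D G" and L: "rate t G \<longlonglongrightarrow> L"
  shows "entropy D t T = ereal L"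
proof -
  have lim: "(\<lambda>n. ereal (1 / real n) * log_ereal (complexity D t G' ((FOb T ^^ n) G'))) \<longlonglongrightarrow> ereal L"
    if G': "split_generator D G'" for G'
  proof -
    obtain L' where L': "rate t G' \<longlonglongrightarrow> L'" using rate_convergent[OF G'] convergent_def by blast
    then have "L' = L"
      using rate_limit_le[OF G G' L L'] rate_limit_le[OF G' G L' L] by simp
    \<comment> \<open>This includes n = 0, where both sides are 0 because division by zero yields
      0.\<close>
    have "ereal (1 / real n) * log_ereal (complexity D t G' (Tn n G')) = ereal (rate t G' n)" for n
      using complexity_eq[OF split_generator_gens[OF G' Tn_ob[OF gen_ob[OF G']]], of t n] growth_pos[OF G', of t n]
      by (simp add: log_ereal_def growth_def)
    then show ?thesis using L' \<open>L' = L\<close> by simp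
  qed
  show ?thesis
    unfolding entropy_def
  proof (rule the_equality)
    fix h assume "\<forall>G. split_generator D G \<longrightarrow>
      (\<lambda>n. ereal (1 / real n) * log_ereal (complexity D t G ((FOb T ^^ n) G))) \<longlonglongrightarrow> h"
    then show "h = ereal L" using G lim[OF G] LIMSEQ_unique by blast
  qed (use lim in blast)
qed

lemma entropy_bounds:
  "\<exists>L. entropy D t T = ereal L \<and> real_of_int (1 - d) * t \<le> L \<and> L \<le> max 0 (real_of_int (1 - d) * t) \<and>
    ((\<exists>F\<in>right_orthogonal D E. \<not> zero_object D F) \<longrightarrow> 0 \<le> L)"
proof -
  obtain G where G: "split_generator D G" using ex_gen by blast
  obtain L where L: "rate t G \<longlonglongrightarrow> L" using rate_convergent[OF G] convergent_def by blast
  have "real_of_int (1 - d) * t \<le> L"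
  proof (rule LIMSEQ_le_const[OF L], intro exI[of _ 1] allI impI)
    fix n :: nat assume n: "1 \<le> n"
    have "real_of_int (1 - d) * t * real n \<le> ln (growth t G n)"
      using growth_lower[OF G, of t n] growth_pos[OF G, of t n] by (simp add: ln_ge_iff exp_of_nat2_mult)
    then show "real_of_int (1 - d) * t \<le> rate t G n" using n by (simp add: field_simps)
  qed
  moreover have "L \<le> max 0 (real_of_int (1 - d) * t)"
  proof -
    obtain C where C: "C \<ge> 0" "\<And>n. growth t G n \<le> (1 + C * real n) * max 1 (\<rho> t) ^ n"
      using growth_upper[OF G] by blast
    \<comment> \<open>The logarithm turns the base of the upper bound into the bound on the
      entropy.\<close>
    have lnM: "ln (max 1 (\<rho> t)) = max 0 (real_of_int (1 - d) * t)"
      by (simp add: max_def)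
    have "rate t G n \<le> ln (1 + C * real n) / real n + max 0 (real_of_int (1 - d) * t)" if n: "n \<ge> 1" for n
    proof -
      have p: "0 < 1 + C * real n" "0 < max 1 (\<rho> t)" using C by (auto intro: add_pos_nonneg)
      have "ln (growth t G n) \<le> ln ((1 + C * real n) * max 1 (\<rho> t) ^ n)"
        using C(2)[of n] growth_pos[OF G, of t n] by simp
      also have "\<dots> = ln (1 + C * real n) + real n * max 0 (real_of_int (1 - d) * t)"
        using p lnM by (subst ln_mult_pos) (auto simp: ln_realpow)
      finally have "rate t G n \<le> (ln (1 + C * real n) + real n * max 0 (real_of_int (1 - d) * t)) / real n"
        by (intro divide_right_mono) auto
      then show ?thesis using n by (simp add: add_divide_distrib)
    qed
    moreover have "(\<lambda>n. ln (1 + C * real n) / real n + max 0 (real_of_int (1 - d) * t))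
        \<longlonglongrightarrow> 0 + max 0 (real_of_int (1 - d) * t)"
      by (intro tendsto_add ln_growth_limit_zero C tendsto_const)
    ultimately show ?thesis using LIMSEQ_le[OF L] by auto
  qed
  moreover have "0 \<le> L" if F: "F \<in> right_orthogonal D E" "\<not> zero_object D F" for F
    \<comment> \<open>Here the growth is at least 1, so every rate is nonnegative.\<close>
    using growth_lower_orthogonal[OF G F]
    by (intro LIMSEQ_le_const[OF L]) (auto intro!: divide_nonneg_nonneg)
  ultimately show ?thesis using entropy_limit[OF G L] by blast
qed

end

theorem proposition5p3:
  fixes D :: "('o, 'm::ab_group_add, 'k::field) tri_cat"
    and A :: "('a, 'r::ab_group_add, 'k) dg_cat"
    and \<Psi> :: "('a, 'r, 'o, 'm) enh"
    and d :: int
    and E :: 'o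
    and T :: "('o, 'm, 'o, 'm) func"
  assumes "triangulated_category D"
    and "dg_enhancement D A \<Psi>"
    and "finite_type D"
    and "\<exists>G. split_generator D G"
    and "d > 0"
    and "spherical_object D d E"
    and "spherical_twist D A \<Psi> E T"
  shows "(\<forall>t::real.
            ereal (real_of_int (1 - d) * t) \<le> entropy D t T \<and>
            entropy D t T \<le> (if t \<ge> 0 then 0 else ereal (real_of_int (1 - d) * t))) \<and>
         ((\<exists>F\<in>right_orthogonal D E. \<not> zero_object D F) \<longrightarrow>
            (\<forall>t::real. t \<ge> 0 \<longrightarrow> entropy D t T = 0))"
proof -
  have "exact_functor D D T"
    using assms(7) unfolding spherical_twist_def exact_autoequivalence_def by blast
  then interpret spherical_twist_setting D T A \<Psi> d E
    using assms by (intro spherical_twist_setting.intro exact_endofunctor.intro tricat.intro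
        exact_endofunctor_axioms.intro spherical_twist_setting_axioms.intro)
  \<comment> \<open>As d is at least 1, \<open>(1 - d) t\<close> has the sign opposite to t or
    vanishes, so the maximum splits into the two cases of the theorem.\<close>
  have sign: "max 0 (real_of_int (1 - d) * t) = (if t \<ge> 0 then 0 else real_of_int (1 - d) * t)" for t :: real
  proof -
    have "0 \<le> real_of_int (d - 1)" using assms(5) by simp
    then have "t \<ge> 0 \<Longrightarrow> 0 \<le> real_of_int (d - 1) * t" "t < 0 \<Longrightarrow> real_of_int (d - 1) * t \<le> 0"
      by (simp_all add: mult_nonneg_nonpos)
    then show ?thesis by (auto simp: algebra_simps max_def)
  qed
  show ?thesis
  proof (intro conjI allI impI)
    fix t :: real
    show "ereal (real_of_int (1 - d) * t) \<le> entropy D t T"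
      using entropy_bounds[of t] by auto
    show "entropy D t T \<le> (if t \<ge> 0 then 0 else ereal (real_of_int (1 - d) * t))"
      using entropy_bounds[of t] unfolding sign by (auto simp: zero_ereal_def)
    assume "\<exists>F\<in>right_orthogonal D E. \<not> zero_object D F" "t \<ge> 0"
    then show "entropy D t T = 0"
      using entropy_bounds[of t] unfolding sign by (auto simp: zero_ereal_def)
  qed
qed

end
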